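(* Let $d,n\ge1$ be integers. Let $\mathcal{A}\subseteq\mathrm{End}(\mathbb{C}^d)$ be a von Neumann algebra and let $G_{\mathcal{A}}$ be its gauge group. In the $n$-copy estimation scenario with single-copy prior $p$, parameters $\vec{\mathfrak{s}}=(\mathfrak{s}^{(1)},\dots,\mathfrak{s}^{(l)})$ and channel $\mathcal{E}$ (described in the context), assume that: 1. the prior $p$ and the vector of parameters $\vec{\mathfrak{s}}$ have the gauge group $G_{\mathcal{A}}$ as a symmetry; 2. the channel $\mathcal{E}$ is noiseless on $\mathcal{A}^{\otimes n}$; 3. the prior $p$ is a $G_{\mathcal{A}}$-distortion of a prior that has support only on the pure states. Then for any given measurement with POVM $M:\sigma(\Omega)\to\mathrm{End}((\mathbb{C}^d)^{\otimes n})$, there is another measurement with POVM $M':\sigma(\Omega)\to\mathrm{End}((\mathbb{C}^d)^{\otimes n})$ whose image is entirely confined to $\mathcal{A}^{\otimes n}$, such that $$q_{M}(B|\vec S\in\vec\Delta)=q_{M'}(B|\vec S\in\vec\Delta)$$ for all $B\in\sigma(\Omega)$ and all $l$-dimensional intervals $\vec\Delta\subseteq\mathbb{R}^l$ which are assigned nonzero probability.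
   Context: A von Neumann algebra $\mathcal{A}\subseteq\mathrm{End}(\mathbb{C}^d)$ is a complex subalgebra containing the identity and closed under adjoint; its gauge group $G_{\mathcal{A}}$ is the group of all unitaries in $\mathrm{U}(d)$ commuting with every element of $\mathcal{A}$. A quantum channel is a completely positive trace-preserving map. Scenario: $d\rho$ is a fixed reference (Borel) measure on the set of density operators in $\mathrm{End}(\mathbb{C}^d)$, invariant under $\rho\mapsto V\rho V^\dagger$ for all $V\in\mathrm{U}(d)$. A state $\rho$ is chosen randomly according to a probability density $p$ relative to $d\rho$ (the single-copy prior), and $\rho^{\otimes n}$ is sent through a quantum channel $\mathcal{E}$ on $\mathrm{End}((\mathbb{C}^d)^{\otimes n})$, then measured. $\mathrm{supp}(p)$ is the set of states to which $p$ assigns nonzero density. The parameters are (measurable) functions $\mathfrak{s}^{(i)}:\mathrm{supp}(p)\to\mathbb{R}$, $\vec{\mathfrak{s}}=(\mathfrak{s}^{(1)},\dots,\mathfrak{s}^{(l)})$, and $\vec S=\vec{\mathfrak{s}}(\rho)$ is the induced random vector. $p$ has a subgroup $H\subseteq\mathrm{U}(d)$ as a symmetry if $p(V\rho V^\dagger)=p(\rho)$ for all $V\in H$ and all $\rho$. $\vec{\mathfrak{s}}$ has $H$ as a symmetry if $\vec{\mathfrak{s}}(V\rho V^\dagger)=\vec{\mathfrak{s}}(\rho)$ for all $V\in H$ and all $\rho\in\mathrm{supp}(p)$. $\mathcal{E}$ is noiseless on $\mathcal{A}^{\otimes n}$ if $\mathrm{tr}(R\,\mathcal{E}(\rho))=\mathrm{tr}(R\rho)$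 for all $R\in\mathcal{A}^{\otimes n}$ and all states $\rho$ in $\mathrm{End}((\mathbb{C}^d)^{\otimes n})$ (and analogously for a channel on $\mathrm{End}(\mathbb{C}^d)$ and $\mathcal{A}$). Given a prior density $\tilde p$ (relative to $d\rho$) with support confined to pure states, $p$ is a $G_{\mathcal{A}}$-distortion of $\tilde p$ via $\mathcal{N}$ if $p$ can be realized by sampling a pure state from $\tilde p$ and applying a quantum channel $\mathcal{N}$ on $\mathrm{End}(\mathbb{C}^d)$ to it (i.e. the law with density $p$ is the pushforward under $\mathcal{N}$ of the law with density $\tilde p$), where $\mathcal{N}$ is noiseless on $\mathcal{A}$ and $G_{\mathcal{A}}$-covariant, i.e. $\mathcal{N}(V\cdot V^\dagger)=V\mathcal{N}(\cdot)V^\dagger$ for all $V\in G_{\mathcal{A}}$. A POVM with outcome space a measurable space $(\Omega,\sigma(\Omega))$ is a countably additive map $M$ from $\sigma(\Omega)$ to positive operators with $M(\Omega)=\mathbb{I}^{\otimes n}$. Set $q_M(B|\rho)=\mathrm{tr}(M(B)\mathcal{E}(\rho^{\otimes n}))$, $\Pr(\vec S\in\vec\Delta)=\int_{\vec{\mathfrak{s}}(\rho)\in\vec\Delta}d\rho\,p(\rho)$ and $$q_M(B|\vec S\in\vec\Delta)=\frac{1}{\Pr(\vec S\in\vec\Delta)}\int_{\vec{\mathfrak{s}}(\rho)\in\vec\Delta}d\rho\,p(\rho)\,q_M(B|\rho).$$ *)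

theory Defs
  imports "HOL-Probability.Probability"
begin

section \<open>Complex matrices\<close>

text \<open>
  Operators on a space with orthonormal basis indexed by \<open>'a\<close> are square matrices over \<open>'a\<close>.
  The space of \<open>n\<close> copies of \<open>\<complex>\<^sup>d\<close>, with \<open>d = CARD('d)\<close> and \<open>n = CARD('n)\<close>, has its product
  basis indexed by the finite type \<open>'n \<Rightarrow> 'd\<close>.
\<close>

type_synonym 'a cmat = "complex^'a^'a"

definition cscale :: "complex \<Rightarrow> 'a::finite cmat \<Rightarrow> 'a cmat"
  where "cscale c X = (\<chi> i j. c * X $ i $ j)"

text \<open>The library instance makes matrices a real vector space only; this is the complex structure.\<close>

interpretation cmat: vector_space "cscale :: complex \<Rightarrow> 'a::finite cmat \<Rightarrow> 'a cmat"
  by unfold_locales (simp_all add: cscale_def vec_eq_iff algebra_simps)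

definition dagger :: "'a::finite cmat \<Rightarrow> 'a cmat"
  where "dagger X = (\<chi> i j. cnj (X $ j $ i))"

definition unitary :: "'a::finite cmat \<Rightarrow> bool"
  where "unitary V \<longleftrightarrow> V ** dagger V = mat 1 \<and> dagger V ** V = mat 1"

definition conjugate_by :: "'a::finite cmat \<Rightarrow> 'a cmat \<Rightarrow> 'a cmat"
  where "conjugate_by V X = V ** X ** dagger V"

definition cinner :: "complex^'a \<Rightarrow> complex^'a \<Rightarrow> complex"
  where "cinner u v = (\<Sum>i\<in>UNIV. cnj (u $ i) * v $ i)"

definition positive_op :: "'a::finite cmat \<Rightarrow> bool"
  where "positive_op X \<longleftrightarrow> (\<forall>v. cinner v (X *v v) \<in> \<real>\<^sub>\<ge>\<^sub>0)"

definition tensor :: "('n::finite \<Rightarrow> 'd::finite cmat) \<Rightarrow> ('n \<Rightarrow> 'd) cmat"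
  where "tensor X = (\<chi> f g. \<Prod>k\<in>UNIV. X k $ f k $ g k)"

definition tensor_power :: "'d::finite cmat \<Rightarrow> ('n::finite \<Rightarrow> 'd) cmat"
  where "tensor_power X = tensor (\<lambda>_. X)"

section \<open>Von Neumann algebras and gauge groups\<close>

text \<open>In finite dimension no topological closure condition is needed.\<close>

definition von_neumann_algebra :: "'a::finite cmat set \<Rightarrow> bool"
  where "von_neumann_algebra A \<longleftrightarrow>
    cmat.subspace A \<and> mat 1 \<in> A \<and>
    (\<forall>X\<in>A. \<forall>Y\<in>A. X ** Y \<in> A) \<and> (\<forall>X\<in>A. dagger X \<in> A)"

definition gauge_group :: "'a::finite cmat set \<Rightarrow> 'a cmat set"
  where "gauge_group A = {V. unitary V \<and> (\<forall>X\<in>A. V ** X = X ** V)}"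

definition algebra_power :: "'d::finite cmat set \<Rightarrow> ('n::finite \<Rightarrow> 'd) cmat set"
  where "algebra_power A = cmat.span {tensor X | X. \<forall>k. X k \<in> A}"

section \<open>States, channels and POVMs\<close>

definition states :: "'a::finite cmat set"
  where "states = {\<rho>. positive_op \<rho> \<and> trace \<rho> = 1}"

definition pure_states :: "'a::finite cmat set"
  where "pure_states = {(\<chi> i j. \<psi> $ i * cnj (\<psi> $ j)) | \<psi>. norm \<psi> = 1}"

text \<open>
  An operator on \<open>\<complex>\<^sup>k \<otimes> \<complex>\<^sup>a\<close> is given by its blocks \<open>X i j\<close> for \<open>i, j < k\<close>, and a vector by
  its components \<open>v i\<close> for \<open>i < k\<close>. The map \<open>id \<otimes> E\<close> acts as \<open>E\<close> on every block, so the
  following says that \<open>id \<otimes> E\<close> preserves positivity for every dimension \<open>k\<close> of the ancilla.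
\<close>

definition positive_block :: "nat \<Rightarrow> (nat \<Rightarrow> nat \<Rightarrow> 'a::finite cmat) \<Rightarrow> bool"
  where "positive_block k X \<longleftrightarrow>
    (\<forall>v :: nat \<Rightarrow> complex^'a. (\<Sum>i<k. \<Sum>j<k. cinner (v i) (X i j *v v j)) \<in> \<real>\<^sub>\<ge>\<^sub>0)"

definition completely_positive :: "('a::finite cmat \<Rightarrow> 'b::finite cmat) \<Rightarrow> bool"
  where "completely_positive E \<longleftrightarrow>
    (\<forall>k X. positive_block k X \<longrightarrow> positive_block k (\<lambda>i j. E (X i j)))"

definition quantum_channel :: "('a::finite cmat \<Rightarrow> 'b::finite cmat) \<Rightarrow> bool"
  where "quantum_channel E \<longleftrightarrow>
    Vector_Spaces.linear cscale cscale E \<and> completely_positive E \<and>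
    (\<forall>X. trace (E X) = trace X)"

definition noiseless_on :: "'a::finite cmat set \<Rightarrow> ('a cmat \<Rightarrow> 'a cmat) \<Rightarrow> bool"
  where "noiseless_on A E \<longleftrightarrow> (\<forall>R\<in>A. \<forall>\<rho>\<in>states. trace (R ** E \<rho>) = trace (R ** \<rho>))"

definition covariant :: "'a::finite cmat set \<Rightarrow> ('a cmat \<Rightarrow> 'a cmat) \<Rightarrow> bool"
  where "covariant H N \<longleftrightarrow> (\<forall>V\<in>H. \<forall>X. N (conjugate_by V X) = conjugate_by V (N X))"

text \<open>Only the \<open>\<sigma>\<close>-algebra of the outcome space \<open>\<Omega>\<close> is used, not its measure.\<close>

definition povm :: "'w measure \<Rightarrow> ('w set \<Rightarrow> 'a::finite cmat) \<Rightarrow> bool"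
  where "povm \<Omega> M \<longleftrightarrow>
    (\<forall>B\<in>sets \<Omega>. positive_op (M B)) \<and> M (space \<Omega>) = mat 1 \<and>
    (\<forall>B :: nat \<Rightarrow> 'w set. range B \<subseteq> sets \<Omega> \<longrightarrow> disjoint_family B \<longrightarrow>
      (\<lambda>i. M (B i)) sums M (\<Union>i. B i))"

section \<open>Priors and parameters\<close>

definition reference_measure :: "'d::finite cmat measure \<Rightarrow> bool"
  where "reference_measure \<mu> \<longleftrightarrow>
    sets \<mu> = sets (restrict_space borel states) \<and>
    (\<forall>V. unitary V \<longrightarrow> distr \<mu> \<mu> (conjugate_by V) = \<mu>)"

text \<open>The law of a random state with density \<open>p\<close>.\<close>

definition law :: "'d::finite cmat measure \<Rightarrow> ('d cmat \<Rightarrow> real) \<Rightarrow> 'd cmat measure"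
  where "law \<mu> p = density \<mu> (\<lambda>\<rho>. ennreal (p \<rho>))"

definition prior :: "'d::finite cmat measure \<Rightarrow> ('d cmat \<Rightarrow> real) \<Rightarrow> bool"
  where "prior \<mu> p \<longleftrightarrow>
    p \<in> borel_measurable \<mu> \<and> (\<forall>\<rho>\<in>states. 0 \<le> p \<rho>) \<and> prob_space (law \<mu> p)"

definition supp :: "('d::finite cmat \<Rightarrow> real) \<Rightarrow> 'd cmat set"
  where "supp p = {\<rho>\<in>states. p \<rho> \<noteq> 0}"

text \<open>
  A parameter vector is a total function in HOL; its values outside \<open>supp p\<close> are irrelevant
  and are never used below.
\<close>

definition parameters ::
    "'d::finite cmat measure \<Rightarrow> ('d cmat \<Rightarrow> real) \<Rightarrow> ('d cmat \<Rightarrow> real^'l) \<Rightarrow> bool"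
  where "parameters \<mu> p s \<longleftrightarrow>
    (\<forall>i. (\<lambda>\<rho>. s \<rho> $ i) \<in> borel_measurable (restrict_space \<mu> (supp p)))"

definition prior_symmetry :: "'d::finite cmat set \<Rightarrow> ('d cmat \<Rightarrow> real) \<Rightarrow> bool"
  where "prior_symmetry H p \<longleftrightarrow> (\<forall>V\<in>H. \<forall>\<rho>\<in>states. p (conjugate_by V \<rho>) = p \<rho>)"

definition parameter_symmetry ::
    "'d::finite cmat set \<Rightarrow> ('d cmat \<Rightarrow> real) \<Rightarrow> ('d cmat \<Rightarrow> real^'l) \<Rightarrow> bool"
  where "parameter_symmetry H p s \<longleftrightarrow>
    (\<forall>V\<in>H. \<forall>\<rho>\<in>supp p. s (conjugate_by V \<rho>) = s \<rho>)"

definition gauge_distortion ::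
    "'d::finite cmat measure \<Rightarrow> 'd cmat set \<Rightarrow> ('d cmat \<Rightarrow> real) \<Rightarrow> ('d cmat \<Rightarrow> real) \<Rightarrow>
     ('d cmat \<Rightarrow> 'd cmat) \<Rightarrow> bool"
  where "gauge_distortion \<mu> A p p' N \<longleftrightarrow>
    quantum_channel N \<and> noiseless_on A N \<and> covariant (gauge_group A) N \<and>
    distr (law \<mu> p') \<mu> N = law \<mu> p"

section \<open>Outcome statistics\<close>

text \<open>
  The trace below is real, being the trace of a product of two positive operators, so taking
  the real part only changes its type.
\<close>

definition outcome_prob ::
    "(('n::finite \<Rightarrow> 'd::finite) cmat \<Rightarrow> ('n \<Rightarrow> 'd) cmat) \<Rightarrow> ('w set \<Rightarrow> ('n \<Rightarrow> 'd) cmat) \<Rightarrow>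
     'w set \<Rightarrow> 'd cmat \<Rightarrow> real"
  where "outcome_prob E M B \<rho> = Re (trace (M B ** E (tensor_power \<rho>)))"

definition parameter_prob ::
    "'d::finite cmat measure \<Rightarrow> ('d cmat \<Rightarrow> real) \<Rightarrow> ('d cmat \<Rightarrow> real^'l) \<Rightarrow> (real^'l) set \<Rightarrow> real"
  where "parameter_prob \<mu> p s \<Delta> = (LINT \<rho>:{\<rho>\<in>supp p. s \<rho> \<in> \<Delta>}|\<mu>. p \<rho>)"

definition conditional_outcome_prob ::
    "'d::finite cmat measure \<Rightarrow> ('d cmat \<Rightarrow> real) \<Rightarrow> ('d cmat \<Rightarrow> real^'l) \<Rightarrow>
     (('n::finite \<Rightarrow> 'd) cmat \<Rightarrow> ('n \<Rightarrow> 'd) cmat) \<Rightarrow> ('w set \<Rightarrow> ('n \<Rightarrow> 'd) cmat) \<Rightarrow>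
     'w set \<Rightarrow> (real^'l) set \<Rightarrow> real"
  where "conditional_outcome_prob \<mu> p s E M B \<Delta> =
    1 / parameter_prob \<mu> p s \<Delta> *
      (LINT \<rho>:{\<rho>\<in>supp p. s \<rho> \<in> \<Delta>}|\<mu>. p \<rho> * outcome_prob E M B \<rho>)"

end

theory Submission
  imports Defs
begin

text \<open>
  The moments \<open>l = \<integral> \<rho>\<^sup>\<otimes>\<^sup>n\<close> of the prior over the event \<open>S \<in> \<Delta>\<close> are invariant under the gauge
  group, so \<open>E\<^sup>* (M B)\<close> may be replaced by its projection onto the commutant of the operators
  \<open>V\<^sup>\<otimes>\<^sup>n\<close>. Since \<open>l\<close> is the image under \<open>N\<^sup>\<otimes>\<^sup>n\<close> of a moment \<open>l'\<close> of pure states, which lives on the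
  symmetric subspace, only the compression \<open>P Q P\<close> of \<open>Q = N\<^sup>\<otimes>\<^sup>n\<^sup>* (\<dots>)\<close> to that subspace matters.

  Schur-Weyl duality gives \<open>P Q P = R P\<close> with a permutation invariant \<open>R\<close> in the algebra power. The
  compression \<open>R \<mapsto> R P\<close> is a *-homomorphism; inverting it on the orthocomplement of its kernel, which
  is again an ideal, selects \<open>R\<close> linearly and positively, up to a multiple of the unit of the kernel
  that restores normalization. As \<open>R\<close> lies in the algebra power, noiselessness of \<open>N\<close> and \<open>E\<close> turns
  \<open>l'\<close> back into \<open>E l\<close>.

  All arguments are finite dimensional linear algebra: least-norm points of convex hulls replace
  Haar averages, and no decomposition of the algebra into factors is needed.
\<close>

text \<open>The new measurement has to be fixed before \<open>B\<close> and \<open>\<Delta>\<close>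
  are known. It is obtained as \<open>M' B = \<Psi> (M B)\<close> with one linear, positive, unital
  map \<open>\<Psi>\<close>: linearity carries countable additivity, and \<open>\<Delta>\<close>
  enters only through the moment with which operators are paired. So a suitable \<open>R\<close> for
  each single operator is not enough; \<open>R\<close> must depend linearly and positively on it.
  The obstacle is that different \<open>R\<close> can have the same \<open>R P\<close>, and
  positivity of \<open>R P\<close> says nothing about \<open>R\<close> away from the symmetric
  subspace.

  Duality by itself only places an invariant operator in the algebra generated by the algebra power
  together with the permutations of the copies. Permutations act trivially on the symmetric
  subspace, and this is what purity buys. Covariance and noiselessness of \<open>N\<close> have
  separate tasks: the first keeps the pulled-back operator invariant, so that duality applies to it,
  and the second removes \<open>N\<close> again once the operator lies in the algebra power.\<close>

lemma dagger_nth [simp]: "dagger X $ i $ j = cnj (X $ j $ i)"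
  by (simp add: dagger_def)

lemma cscale_nth [simp]: "cscale c X $ i $ j = c * X $ i $ j"
  by (simp add: cscale_def)

lemma matrix_mult_nth: "(X ** Y) $ i $ j = (\<Sum>k\<in>UNIV. X $ i $ k * Y $ k $ j)"
  by (simp add: matrix_matrix_mult_def)

lemma mat_nth: "(mat c :: 'a::finite cmat) $ i $ j = (if i = j then c else 0)"
  by (simp add: mat_def)

lemma cmat_eqI: "(\<And>i j. X $ i $ j = Y $ i $ j) \<Longrightarrow> X = (Y :: 'c^'m^'n)"
  by (simp add: vec_eq_iff)

lemma dagger_dagger [simp]: "dagger (dagger X) = X"
  by (rule cmat_eqI) simp

lemma dagger_mult: "dagger (X ** Y) = dagger Y ** dagger X"
  by (rule cmat_eqI) (simp add: matrix_mult_nth mult.commute)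

lemma dagger_mat_1 [simp]: "dagger (mat 1) = mat 1"
  by (rule cmat_eqI) (simp add: mat_nth)

lemma dagger_add: "dagger (X + Y) = dagger X + dagger Y"
  by (rule cmat_eqI) simp

lemma dagger_diff: "dagger (X - Y) = dagger X - dagger Y"
  by (rule cmat_eqI) simp

lemma dagger_scaleR: "dagger (r *\<^sub>R X) = r *\<^sub>R dagger X"
  by (rule cmat_eqI) simp

lemma dagger_cscale: "dagger (cscale c X) = cscale (cnj c) (dagger X)"
  by (rule cmat_eqI) simp

lemma dagger_0 [simp]: "dagger 0 = 0"
  by (rule cmat_eqI) simp

lemma dagger_sum: "dagger (\<Sum>x\<in>A. f x) = (\<Sum>x\<in>A. dagger (f x))"
  by (induction A rule: infinite_finite_induct) (simp_all add: dagger_add)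

lemma scaleR_eq_cscale: "r *\<^sub>R X = cscale (of_real r) X"
  by (rule cmat_eqI) (simp add: complex_eq_iff)

lemma cscale_mult_left: "cscale c X ** Y = cscale c (X ** Y)"
  by (rule cmat_eqI) (simp add: matrix_mult_nth sum_distrib_left mult.assoc)

lemma cscale_mult_right: "X ** cscale c Y = cscale c (X ** Y)"
  by (rule cmat_eqI) (simp add: matrix_mult_nth sum_distrib_left mult_ac)

lemma scaleR_mult_left: "(r *\<^sub>R X) ** Y = r *\<^sub>R (X ** Y)"
  for X Y :: "'a::finite cmat"
  by (simp add: scaleR_eq_cscale cscale_mult_left)

lemma scaleR_mult_right: "X ** (r *\<^sub>R Y) = r *\<^sub>R (X ** Y)"
  for X Y :: "'a::finite cmat"
  by (simp add: scaleR_eq_cscale cscale_mult_right)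

lemma mult_add_left: "(X + Y) ** Z = X ** Z + Y ** Z" for X :: "'a::finite cmat"
  by (rule cmat_eqI) (simp add: matrix_mult_nth algebra_simps sum.distrib)

lemma mult_diff_left: "(X - Y) ** Z = X ** Z - Y ** Z" for X :: "'a::finite cmat"
  by (rule cmat_eqI) (simp add: matrix_mult_nth algebra_simps sum_subtractf)

lemma mult_diff_right: "Z ** (X - Y) = Z ** X - Z ** Y" for X :: "'a::finite cmat"
  by (rule cmat_eqI) (simp add: matrix_mult_nth algebra_simps sum_subtractf)

lemma mult_sum_left: "(\<Sum>x\<in>A. f x) ** Z = (\<Sum>x\<in>A. f x ** Z)" for f :: "'b \<Rightarrow> 'a::finite cmat"
  by (induction A rule: infinite_finite_induct) (simp_all add: mult_add_left)

lemma mult_sum_right: "Z ** (\<Sum>x\<in>A. f x) = (\<Sum>x\<in>A. Z ** f x)" for f :: "'b \<Rightarrow> 'a::finite cmat"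
  by (induction A rule: infinite_finite_induct) (simp_all add: matrix_add_ldistrib)

lemma linear_mult_left: "linear (\<lambda>X :: 'a::finite cmat. X ** Z)" for Z :: "'a::finite cmat"
  by (rule linearI) (simp_all add: mult_add_left scaleR_mult_left)

lemma linear_mult_right: "linear (\<lambda>X :: 'a::finite cmat. Z ** X)" for Z :: "'a::finite cmat"
  by (rule linearI) (simp_all add: matrix_add_ldistrib scaleR_mult_right)

lemma cscale_linear_imp_linear:
  assumes "Vector_Spaces.linear cscale cscale f"
  shows "linear f"
proof -
  interpret f: Vector_Spaces.linear cscale cscale f by fact
  show ?thesis
    by (rule linearI) (simp_all add: f.add f.scale scaleR_eq_cscale)
qed

section \<open>The real Hilbert-Schmidt inner product\<close>

lemma inner_cmat: "X \<bullet> Y = (\<Sum>i\<in>UNIV. \<Sum>j\<in>UNIV. Re (cnj (X $ i $ j) * Y $ i $ j))"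
  for X :: "'a::finite cmat"
  by (simp add: inner_vec_def inner_complex_def)

lemma inner_eq_trace: "X \<bullet> Y = Re (trace (dagger X ** Y))" for X :: "'a::finite cmat"
  unfolding inner_cmat trace_def matrix_mult_nth Re_sum dagger_nth by (rule sum.swap)

lemma inner_mult_left: "(X ** Y) \<bullet> Z = Y \<bullet> (dagger X ** Z)" for X Y Z :: "'a::finite cmat"
  by (simp add: inner_eq_trace dagger_mult matrix_mul_assoc)

lemma inner_mult_right: "(X ** Y) \<bullet> Z = X \<bullet> (Z ** dagger Y)" for X Y Z :: "'a::finite cmat"
  unfolding inner_eq_trace dagger_mult
  by (metis matrix_mul_assoc trace_mul_sym)

lemma inner_dagger: "dagger X \<bullet> dagger Y = X \<bullet> Y" for X :: "'a::finite cmat"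
  unfolding inner_cmat by (subst sum.swap) (simp add: mult.commute)

lemma inner_cscale: "cscale c X \<bullet> Y = X \<bullet> cscale (cnj c) Y" for X :: "'a::finite cmat"
  unfolding inner_cmat by (simp add: algebra_simps)

lemma trace_cscale: "trace (cscale c X) = c * trace X"
  by (simp add: trace_def sum_distrib_left)

section \<open>Positive operators\<close>

definition outer :: "complex^'a \<Rightarrow> complex^'a \<Rightarrow> 'a::finite cmat"
  where "outer u v = (\<chi> i j. u $ i * cnj (v $ j))"

lemma outer_nth [simp]: "outer u v $ i $ j = u $ i * cnj (v $ j)"
  by (simp add: outer_def)

lemma cinner_expand: "cinner v (X *v w) = (\<Sum>i\<in>UNIV. \<Sum>j\<in>UNIV. cnj (v $ i) * X $ i $ j * w $ j)"
  by (simp add: cinner_def matrix_vector_mult_def sum_distrib_left mult.assoc)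

lemma Re_cinner: "Re (cinner v (X *v v)) = X \<bullet> outer v v"
  unfolding cinner_expand inner_cmat Re_sum by (intro sum.cong refl) (simp add: algebra_simps)

lemma Im_cinner: "Im (cinner v (X *v v)) = X \<bullet> cscale \<i> (outer v v)"
  unfolding cinner_expand inner_cmat Im_sum by (intro sum.cong refl) (simp add: algebra_simps)

text \<open>In this form positivity is a family of closed conditions linear in \<open>X\<close>.
  Closedness and convexity of the cone, and positivity of adjoint maps, are read off from
  it.\<close>

lemma positive_op_iff:
  "positive_op X \<longleftrightarrow> (\<forall>v. 0 \<le> X \<bullet> outer v v \<and> X \<bullet> cscale \<i> (outer v v) = 0)"
  unfolding positive_op_def complex_nonneg_Reals_iff Re_cinner Im_cinner ..

lemma cinner_commute: "cinner u v = cnj (cinner v u)"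
  by (simp add: cinner_def mult.commute)

lemma cinner_adjoint: "cinner u (X *v v) = cinner (dagger X *v u) v"
  by (subst cinner_expand, subst sum.swap)
    (simp add: cinner_def matrix_vector_mult_def sum_distrib_left sum_distrib_right mult_ac)

lemma cinner_self: "cinner v v = of_real ((norm v)\<^sup>2)"
proof -
  have "cinner v v = (\<Sum>i\<in>UNIV. of_real ((norm (v $ i))\<^sup>2))"
    by (simp add: cinner_def complex_norm_square mult.commute del: of_real_power)
  then show ?thesis by (simp add: norm_vec_def L2_set_def sum_nonneg)
qed

lemma cinner_add_left: "cinner (u + v) w = cinner u w + cinner v w"
  by (simp add: cinner_def algebra_simps sum.distrib)

lemma cinner_add_right: "cinner w (u + v) = cinner w u + cinner w v"
  by (simp add: cinner_def algebra_simps sum.distrib)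

lemma cinner_scale_left: "cinner (c *s u) v = cnj c * cinner u v"
  by (simp add: cinner_def sum_distrib_left mult.assoc)

lemma cinner_scale_right: "cinner u (c *s v) = c * cinner u v"
  by (simp add: cinner_def sum_distrib_left mult_ac)

lemma cinner_axis: "cinner (axis i 1) v = v $ i"
proof -
  have "cinner (axis i 1) v = (\<Sum>k\<in>UNIV. if k = i then v $ k else 0)"
    unfolding cinner_def by (rule sum.cong) (auto simp: axis_def)
  then show ?thesis by simp
qed

lemma cinner_axis_mult_axis: "cinner (axis i 1) (X *v axis j 1) = X $ i $ j"
proof -
  have "(X *v axis j 1) $ i = (\<Sum>k\<in>UNIV. if k = j then X $ i $ k else 0)"
    unfolding matrix_vector_mult_def vec_lambda_beta by (rule sum.cong) (auto simp: axis_def)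
  then show ?thesis by (simp add: cinner_axis)
qed

text \<open>A phase on \<open>v\<close> turns the complex product into its modulus, so the real
  Cauchy-Schwarz inequality applies.\<close>

lemma norm_cinner_le: "norm (cinner u v) \<le> norm u * norm v"
proof (cases "cinner u v = 0")
  case False
  define c where "c = cnj (sgn (cinner u v))"
  have c: "norm c = 1" using False by (simp add: c_def norm_sgn)
  have Re: "Re (cinner x y) = x \<bullet> y" for x y :: "complex^'a"
    by (simp add: cinner_def inner_vec_def inner_complex_def)
  have "of_real (norm (cinner u v)) = c * cinner u v"
    using False by (simp add: c_def sgn_eq complex_norm_square[symmetric] power2_eq_square mult.commute)
  then have "norm (cinner u v) = Re (cinner u (c *s v))"
    by (metis Re_complex_of_real cinner_scale_right)
  also have "\<dots> \<le> norm u * norm (c *s v)" by (simp add: Re norm_cauchy_schwarz)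
  also have "norm (c *s v) = norm v"
    by (simp add: norm_vec_def L2_set_def norm_mult c)
  finally show ?thesis .
qed simp

text \<open>Polarization: reality of the form at \<open>u + v\<close> and at
  \<open>u + \<i> *s v\<close> determines the two halves of the symmetry of
  \<open>q\<close>.\<close>

lemma hermitian_if_positive:
  assumes "positive_op X"
  shows "dagger X = X"
proof -
  define q where "q u v = cinner u (X *v v)" for u v
  have r: "cnj (q v v) = q v v" for v
    using assms by (simp add: positive_op_def q_def complex_nonneg_Reals_iff complex_eq_iff)
  have e: "q (u + v) (u + v) = q u u + q u v + q v u + q v v" for u v
    by (simp add: q_def cinner_add_left cinner_add_right matrix_vector_right_distrib)
  have i: "q (u + \<i> *s v) (u + \<i> *s v) = q u u + \<i> * q u v - \<i> * q v u + q v v" for u v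
    by (simp add: q_def cinner_add_left cinner_add_right matrix_vector_right_distrib cinner_scale_left
        cinner_scale_right vector_scalar_commute algebra_simps)
  have sym: "q u v = cnj (q v u)" for u v
  proof -
    have 1: "cnj (q u v) + cnj (q v u) = q u v + q v u"
      using r[of "u + v"] r[of u] r[of v] unfolding e by simp
    have "- \<i> * cnj (q u v) + \<i> * cnj (q v u) = \<i> * q u v - \<i> * q v u"
      using r[of "u + \<i> *s v"] r[of u] r[of v] unfolding i by (simp add: algebra_simps)
    then have "\<i> * (cnj (q v u) - cnj (q u v)) = \<i> * (q u v - q v u)" by (simp add: algebra_simps)
    then have 2: "cnj (q v u) - cnj (q u v) = q u v - q v u" by simp
    from arg_cong2[OF 1 2, of "(+)"] show ?thesis by simp
  qed
  have "cnj (X $ j $ i) = X $ i $ j" for i j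
    using sym[of "axis i 1" "axis j 1"] unfolding q_def cinner_axis_mult_axis by (rule HOL.sym)
  then show ?thesis by (intro cmat_eqI) simp
qed

text \<open>The form is nonnegative at \<open>t *s u + v\<close> for every complex \<open>t\<close>;
  a suitable \<open>t\<close> turns this into a bound for the cross term.\<close>

lemma positive_cauchy_schwarz:
  assumes "positive_op X"
  shows "(norm (cinner u (X *v v)))\<^sup>2 \<le> Re (cinner u (X *v u)) * Re (cinner v (X *v v))"
proof -
  define q where "q u v = cinner u (X *v v)" for u v
  define a b where "a = Re (q u u)" and "b = Re (q v v)"
  have pos: "0 \<le> Re (q w w)" for w
    using assms by (auto simp: positive_op_def q_def complex_nonneg_Reals_iff)
  have sym: "q v u = cnj (q u v)"
    unfolding q_def cinner_adjoint[of v X u] hermitian_if_positive[OF assms] by (rule cinner_commute)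
  define c where "c = q u v"
  have key: "0 \<le> a * (norm t)\<^sup>2 + 2 * Re (cnj t * c) + b" for t
  proof -
    have "q (t *s u + v) (t *s u + v) = cnj t * t * q u u + cnj t * q u v + t * q v u + q v v"
      by (simp add: q_def cinner_add_left cinner_add_right matrix_vector_right_distrib cinner_scale_left
          cinner_scale_right vector_scalar_commute algebra_simps)
    moreover have "Re (cnj t * t * q u u) = (norm t)\<^sup>2 * a"
      by (simp add: a_def cmod_power2 algebra_simps) (simp add: power2_eq_square algebra_simps)
    moreover have "Re (t * q v u) = Re (cnj t * c)"
      by (simp add: sym c_def)
    ultimately show ?thesis
      using pos[of "t *s u + v"] by (simp add: b_def c_def mult.commute)
  qed
  have ab: "0 \<le> a" "0 \<le> b" using pos by (simp_all add: a_def b_def)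
  have "(norm c)\<^sup>2 \<le> a * b"
  proof (cases "a = 0")
    case True
    have "c = 0"
    proof (rule ccontr)
      assume c: "c \<noteq> 0"
      \<comment> \<open>With \<open>a = 0\<close> the expression in \<open>key\<close> is affine in
        \<open>t\<close>; this scale pushes it down to \<open>- b - 2\<close>.\<close>
      define r where "r = (b + 1) / (norm c)\<^sup>2"
      have cc: "cnj c * c = of_real ((norm c)\<^sup>2)"
        by (subst complex_norm_square) (rule mult.commute)
      have "cnj (- of_real r * c) * c = - of_real (r * (norm c)\<^sup>2)"
        using cc by (simp add: mult.assoc)
      then have "Re (cnj (- of_real r * c) * c) = - (b + 1)"
        using c by (simp add: r_def)
      then show False using key[of "- of_real r * c"] True ab by simp
    qed
    then show ?thesis using ab by simp
  next
    case False
    then have a: "a > 0" using ab by simp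
    \<comment> \<open>The expression in \<open>key\<close> is smallest at
      \<open>t = - c / a\<close>.\<close>
    define r where "r = 1 / a"
    have cc: "cnj c * c = of_real ((norm c)\<^sup>2)"
      by (subst complex_norm_square) (rule mult.commute)
    have "cnj (- of_real r * c) * c = - of_real (r * (norm c)\<^sup>2)"
      using cc by (simp add: mult.assoc)
    then have "Re (cnj (- of_real r * c) * c) = - (r * (norm c)\<^sup>2)"
      by (metis Re_complex_of_real uminus_complex.sel(1))
    moreover have "(norm (- of_real r * c))\<^sup>2 = r\<^sup>2 * (norm c)\<^sup>2"
      by (simp add: norm_mult power_mult_distrib)
    ultimately have "0 \<le> a * (r\<^sup>2 * (norm c)\<^sup>2) - 2 * (r * (norm c)\<^sup>2) + b"
      using key[of "- of_real r * c"] by simp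
    then show ?thesis using a by (simp add: r_def field_simps power2_eq_square)
  qed
  then show ?thesis by (simp add: c_def q_def a_def b_def)
qed

lemma positive_op_outer: "positive_op (outer w w)"
proof -
  have "cinner v (outer w w *v v) = cnj (cinner w v) * cinner w v" for v
    by (subst cinner_expand, unfold cinner_def cnj_sum sum_product) (intro sum.cong refl, simp)
  then show ?thesis
    by (simp add: positive_op_def complex_nonneg_Reals_iff)
qed

lemma positive_op_add: "positive_op X \<Longrightarrow> positive_op Y \<Longrightarrow> positive_op (X + Y)"
  by (auto simp: positive_op_iff inner_add_left)

lemma positive_op_scaleR: "positive_op X \<Longrightarrow> 0 \<le> r \<Longrightarrow> positive_op (r *\<^sub>R X)"
  by (auto simp: positive_op_iff)

lemma positive_op_conjugate:
  assumes "positive_op X"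
  shows "positive_op (V ** X ** dagger V)"
proof -
  have "cinner v ((V ** X ** dagger V) *v v) = cinner (dagger V *v v) (X *v (dagger V *v v))" for v
    by (metis cinner_adjoint matrix_vector_mul_assoc)
  then show ?thesis using assms by (simp add: positive_op_def)
qed

text \<open>Cholesky elimination: subtracting the rank-one part through a nonzero diagonal entry clears
  one more row.\<close>
lemma positive_op_eq_sum_outer:
  assumes "positive_op X"
  shows "\<exists>(N::nat) w. X = (\<Sum>k<N. outer (w k) (w k))"
  using assms
proof (induction "card {i. X $ i \<noteq> 0}" arbitrary: X rule: less_induct)
  case less
  show ?case
  proof (cases "X = 0")
    case True
    then show ?thesis by (intro exI[of _ 0]) simp
  next
    case False
    have herm: "cnj (X $ j $ i) = X $ i $ j" for i j
      using hermitian_if_positive[OF less.prems] by (metis dagger_nth)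
    have entry: "cinner (axis i 1) (X *v axis j 1) = X $ i $ j" for i j
      by (rule cinner_axis_mult_axis)
    have colv: "cinner (axis i 1) (X *v v) = (\<Sum>j\<in>UNIV. X $ i $ j * v $ j)" for i v
      by (simp add: cinner_axis matrix_vector_mult_def)
    from False obtain i j where ij: "X $ i $ j \<noteq> 0" by (metis cmat_eqI zero_index)
    define x where "x = Re (X $ i $ i)"
    have ii: "X $ i $ i = of_real x"
      using herm[of i i] by (simp add: x_def complex_eq_iff)
    \<comment> \<open>A nonzero entry forces a nonzero diagonal entry in its row, which serves as
      the pivot.\<close>
    have "(norm (X $ i $ j))\<^sup>2 \<le> x * Re (X $ j $ j)"
      using positive_cauchy_schwarz[OF less.prems, of "axis i 1" "axis j 1"] by (simp add: entry x_def)
    moreover have "0 < (norm (X $ i $ j))\<^sup>2" using ij by simp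
    ultimately have "x \<noteq> 0" by auto
    moreover have "0 \<le> x"
      using less.prems unfolding positive_op_def complex_nonneg_Reals_iff x_def
      by (metis entry)
    ultimately have x: "x > 0" by simp
    \<comment> \<open>Scaled so that \<open>outer w w\<close> agrees with \<open>X\<close> on row
      and column \<open>i\<close>.\<close>
    define w where "w = (\<chi> a. X $ a $ i / of_real (sqrt x))"
    define Y where "Y = X - outer w w"
    have Ynth: "Y $ a $ b = X $ a $ b - X $ a $ i * X $ i $ b / of_real x" for a b
    proof -
      have "of_real (sqrt x) * of_real (sqrt x) = (of_real x :: complex)"
        using x by (metis of_real_mult abs_of_pos real_sqrt_mult_self)
      then show ?thesis by (simp add: Y_def w_def herm)
    qed
    have "positive_op Y"
      unfolding positive_op_def
    proof
      fix v
      have "cinner w v = cinner (axis i 1) (X *v v) / of_real (sqrt x)"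
        unfolding colv by (simp add: cinner_def w_def herm sum_divide_distrib)
      then have nw: "(norm (cinner w v))\<^sup>2 = (norm (cinner (axis i 1) (X *v v)))\<^sup>2 / x"
        using x by (simp add: norm_divide power_divide)
      have "(norm (cinner (axis i 1) (X *v v)))\<^sup>2 \<le> x * Re (cinner v (X *v v))"
        using positive_cauchy_schwarz[OF less.prems, of "axis i 1" v] by (simp add: entry x_def)
      then have le: "(norm (cinner w v))\<^sup>2 \<le> Re (cinner v (X *v v))"
        using x by (simp add: nw field_simps)
      have "cinner v (outer w w *v v) = of_real ((norm (cinner w v))\<^sup>2)"
        by (subst cinner_expand, unfold complex_norm_square cinner_def cnj_sum sum_product, subst sum.swap)
        (intro sum.cong refl, simp)
      moreover have "cinner v (Y *v v) = cinner v (X *v v) - cinner v (outer w w *v v)"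
        unfolding Y_def cinner_expand by (simp add: algebra_simps sum_subtractf)
      moreover have "Im (cinner v (X *v v)) = 0"
        using less.prems by (simp add: positive_op_def complex_nonneg_Reals_iff)
      ultimately show "cinner v (Y *v v) \<in> \<real>\<^sub>\<ge>\<^sub>0"
        using le by (simp add: complex_nonneg_Reals_iff)
    qed
    moreover have "card {a. Y $ a \<noteq> 0} < card {a. X $ a \<noteq> 0}"
    proof (rule psubset_card_mono)
      have "Y $ a = 0" if "X $ a = 0" for a using that by (simp add: vec_eq_iff Ynth)
      moreover have "Y $ i = 0" using x by (simp add: vec_eq_iff Ynth ii)
      moreover have "X $ i \<noteq> 0" using ij by auto
      ultimately show "{a. Y $ a \<noteq> 0} \<subset> {a. X $ a \<noteq> 0}" by blast
    qed simp
    ultimately obtain N :: nat and u where N: "Y = (\<Sum>k<N. outer (u k) (u k))" using less.hyps by blast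
    define u' where "u' = u(N := w)"
    have "X = Y + outer w w" by (simp add: Y_def)
    also have "Y = (\<Sum>k<N. outer (u' k) (u' k))" unfolding N by (intro sum.cong) (auto simp: u'_def)
    finally have "X = (\<Sum>k<Suc N. outer (u' k) (u' k))" by (simp add: u'_def)
    then show ?thesis by blast
  qed
qed

text \<open>Splitting \<open>Y\<close> into rank-one operators reduces both claims to values of the
  quadratic form of \<open>X\<close>.\<close>

lemma inner_positive_op:
  assumes "positive_op X" and "positive_op Y"
  shows "0 \<le> X \<bullet> Y" and "X \<bullet> cscale \<i> Y = 0"
proof -
  obtain N w where Y: "Y = (\<Sum>k<(N::nat). outer (w k) (w k))"
    using positive_op_eq_sum_outer[OF assms(2)] by blast
  show "0 \<le> X \<bullet> Y" using assms(1) unfolding Y inner_sum_right positive_op_iff by (simp add: sum_nonneg)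
  show "X \<bullet> cscale \<i> Y = 0"
    using assms(1) unfolding Y cmat.scale_sum_right inner_sum_right positive_op_iff by simp
qed

lemma positive_op_mat_1: "positive_op (mat 1)"
  by (simp add: positive_op_def cinner_self complex_nonneg_Reals_iff del: of_real_power)

lemma closed_positive_op: "closed {X :: 'a::finite cmat. positive_op X}"
  unfolding positive_op_iff
  by (intro closed_Collect_all closed_Collect_conj closed_Collect_le closed_Collect_eq continuous_intros)

lemma convex_positive_op: "convex {X :: 'a::finite cmat. positive_op X}"
  unfolding convex_def by (auto intro!: positive_op_add positive_op_scaleR)

text \<open>The adjoint is taken with respect to the real inner product, the real part of the
  Hilbert-Schmidt inner product; orthogonality to the imaginary multiples of positive operators
  encodes hermiticity.\<close>
lemma positive_op_adjoint:
  assumes lin: "Vector_Spaces.linear cscale cscale F"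
    and pos: "\<And>Y. positive_op Y \<Longrightarrow> positive_op (F Y)"
    and X: "positive_op X"
  shows "positive_op (adjoint F X)"
  unfolding positive_op_iff
proof (intro allI conjI)
  fix v
  interpret F: Vector_Spaces.linear cscale cscale F by fact
  have 1: "adjoint F X \<bullet> Y = X \<bullet> F Y" for Y
    using adjoint_works[OF cscale_linear_imp_linear[OF lin]] by (simp add: inner_commute)
  show "0 \<le> adjoint F X \<bullet> outer v v"
    unfolding 1 by (intro inner_positive_op X pos positive_op_outer)
  show "adjoint F X \<bullet> cscale \<i> (outer v v) = 0"
    unfolding 1 F.scale by (intro inner_positive_op X pos positive_op_outer)
qed

section \<open>Orthogonal projections and commutants\<close>

text \<open>Characterized by pairings with \<open>W\<close> and not by least distance, because all
  later identities compare inner products.\<close>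

definition orth_proj :: "'a::euclidean_space set \<Rightarrow> 'a \<Rightarrow> 'a"
  where "orth_proj W x = (SOME y. y \<in> W \<and> (\<forall>w\<in>W. (x - y) \<bullet> w = 0))"

context
  fixes W :: "'a::euclidean_space set"
  assumes W: "subspace W"
begin

lemma orth_proj_properties: "orth_proj W x \<in> W \<and> (\<forall>w\<in>W. (x - orth_proj W x) \<bullet> w = 0)"
proof -
  obtain y z where "y \<in> span W" "\<And>w. w \<in> span W \<Longrightarrow> orthogonal z w" "x = y + z"
    using orthogonal_subspace_decomp_exists[of W x] by blast
  then have "y \<in> W \<and> (\<forall>w\<in>W. (x - y) \<bullet> w = 0)"
    using W by (metis add_diff_cancel_left' orthogonal_def span_eq_iff)
  then show ?thesis unfolding orth_proj_def by (rule someI)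
qed

lemma orth_proj_in: "orth_proj W x \<in> W"
  using orth_proj_properties by blast

lemma inner_orth_proj: "w \<in> W \<Longrightarrow> orth_proj W x \<bullet> w = x \<bullet> w"
  using orth_proj_properties[of x] by (auto simp: inner_diff_left)

lemma orth_proj_unique:
  assumes "y \<in> W" and "\<And>w. w \<in> W \<Longrightarrow> y \<bullet> w = x \<bullet> w"
  shows "orth_proj W x = y"
proof -
  have "orth_proj W x - y \<in> W" using orth_proj_in assms(1) W by (simp add: subspace_diff)
  then have "(orth_proj W x - y) \<bullet> (orth_proj W x - y) = 0"
    using assms(2) inner_orth_proj by (simp add: inner_diff_left)
  then show ?thesis by simp
qed

lemma orth_proj_id: "x \<in> W \<Longrightarrow> orth_proj W x = x"
  by (rule orth_proj_unique) auto

lemma linear_orth_proj: "linear (orth_proj W)"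
proof (rule linearI)
  show "orth_proj W (x + y) = orth_proj W x + orth_proj W y" for x y
    by (rule orth_proj_unique)
      (simp_all add: orth_proj_in W subspace_add inner_add_left inner_orth_proj)
  show "orth_proj W (r *\<^sub>R x) = r *\<^sub>R orth_proj W x" for r x
    by (rule orth_proj_unique)
      (simp_all add: orth_proj_in W subspace_mul inner_orth_proj)
qed

end

lemma cmat_subspace_imp_subspace:
  assumes "cmat.subspace W"
  shows "subspace W"
  using assms unfolding subspace_def cmat.subspace_def scaleR_eq_cscale by simp

text \<open>Orthogonality refers to the real inner product. A complex scalar crosses it as its
  conjugate, and \<open>W\<close> is closed under complex scaling.\<close>

lemma cscale_linear_orth_proj:
  assumes "cmat.subspace W"
  shows "Vector_Spaces.linear cscale cscale (orth_proj W)"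
proof -
  have W: "subspace W" using assms by (rule cmat_subspace_imp_subspace)
  show ?thesis
  proof (unfold_locales)
    show "orth_proj W (x + y) = orth_proj W x + orth_proj W y" for x y
      using linear_orth_proj[OF W] by (rule linear_add)
    show "orth_proj W (cscale c x) = cscale c (orth_proj W x)" for c x
    proof (rule orth_proj_unique[OF W])
      show "cscale c (orth_proj W x) \<in> W"
        using assms orth_proj_in[OF W] by (rule cmat.subspace_scale)
      show "cscale c (orth_proj W x) \<bullet> w = cscale c x \<bullet> w" if "w \<in> W" for w
        unfolding inner_cscale using cmat.subspace_scale[OF assms that] by (rule inner_orth_proj[OF W])
    qed
  qed
qed

section \<open>Commutants and the double commutant theorem\<close>

definition commutant :: "'a::finite cmat set \<Rightarrow> 'a cmat set"
  where "commutant S = {Y. \<forall>X\<in>S. X ** Y = Y ** X}"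

lemma commutantD: "Y \<in> commutant S \<Longrightarrow> X \<in> S \<Longrightarrow> X ** Y = Y ** X"
  by (simp add: commutant_def)

lemma subspace_commutant: "cmat.subspace (commutant S)"
  unfolding cmat.subspace_def commutant_def
  by (auto simp: matrix_add_ldistrib mult_add_left cscale_mult_left cscale_mult_right)

lemma mult_in_commutant: "X \<in> commutant S \<Longrightarrow> Y \<in> commutant S \<Longrightarrow> X ** Y \<in> commutant S"
  unfolding commutant_def by (auto simp: matrix_mul_assoc) (metis matrix_mul_assoc)

lemma mat_1_in_commutant: "mat 1 \<in> commutant S"
  by (simp add: commutant_def)

lemma commutant_span: "commutant (cmat.span S) = commutant S"
proof
  show "commutant (cmat.span S) \<subseteq> commutant S"
    using cmat.span_superset[of S] by (auto simp: commutant_def)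
  show "commutant S \<subseteq> commutant (cmat.span S)"
  proof
    fix Y assume Y: "Y \<in> commutant S"
    have "cmat.span S \<subseteq> commutant {Y}"
      using Y by (intro cmat.span_minimal subspace_commutant) (auto simp: commutant_def)
    then show "Y \<in> commutant (cmat.span S)" by (auto simp: commutant_def)
  qed
qed

definition matrix_unit :: "'a \<Rightarrow> 'a \<Rightarrow> 'a::finite cmat"
  where "matrix_unit i j = (\<chi> a b. if a = i \<and> b = j then 1 else 0)"

lemma matrix_unit_nth: "matrix_unit i j $ a $ b = (if a = i \<and> b = j then 1 else 0)"
  by (simp add: matrix_unit_def)

lemma cmat_eq_sum_matrix_unit:
  "X = (\<Sum>i\<in>UNIV. \<Sum>j\<in>UNIV. cscale (X $ i $ j) (matrix_unit i j))" (is "_ = ?R")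
proof (rule cmat_eqI)
  fix a b
  have "?R $ a $ b = (\<Sum>i\<in>UNIV. \<Sum>j\<in>UNIV. if j = b then (if i = a then X $ i $ j else 0) else 0)"
    unfolding sum_component cscale_nth matrix_unit_nth by (intro sum.cong refl) auto
  then show "X $ a $ b = ?R $ a $ b" by (simp add: sum.delta)
qed

text \<open>Left multiplication by an element of the double commutant commutes with the orthogonal
  projection onto the algebra, because that projection, read as a matrix of operators on columns,
  has its entries in the commutant. Evaluating at the identity gives the claim.\<close>
theorem double_commutant:
  assumes W: "von_neumann_algebra W" and Q: "Q \<in> commutant (commutant W)"
  shows "Q \<in> W"
proof -
  have sub: "cmat.subspace W" using W by (simp add: von_neumann_algebra_def)
  have rsub: "subspace W" using sub by (rule cmat_subspace_imp_subspace)
  interpret pr: Vector_Spaces.linear cscale cscale "orth_proj W"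
    using sub by (rule cscale_linear_orth_proj)
  \<comment> \<open>\<open>W\<close> is closed under adjoints, so left multiplication by its
    elements preserves the orthocomplement too: the projection is a left module map.\<close>
  have left: "orth_proj W (X ** Z) = X ** orth_proj W Z" if X: "X \<in> W" for X Z
  proof (rule orth_proj_unique[OF rsub])
    show "X ** orth_proj W Z \<in> W"
      using W X orth_proj_in[OF rsub] by (simp add: von_neumann_algebra_def)
    show "(X ** orth_proj W Z) \<bullet> w = (X ** Z) \<bullet> w" if w: "w \<in> W" for w
    proof -
      have "dagger X ** w \<in> W" using W X w by (simp add: von_neumann_algebra_def)
      then show ?thesis unfolding inner_mult_left by (rule inner_orth_proj[OF rsub])
    qed
  qed
  \<comment> \<open>The block of the projection that takes column \<open>i\<close> of the argument
    to column \<open>j\<close> of the result.\<close>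
  define e where "e j i = (\<chi> a b. orth_proj W (matrix_unit b i) $ a $ j)" for j i
  have orth_proj_nth: "orth_proj W Z $ a $ j = (\<Sum>i\<in>UNIV. \<Sum>b\<in>UNIV. e j i $ a $ b * Z $ b $ i)"
    for Z a j
  proof -
    have "orth_proj W Z = (\<Sum>b\<in>UNIV. \<Sum>i\<in>UNIV. cscale (Z $ b $ i) (orth_proj W (matrix_unit b i)))"
      by (subst cmat_eq_sum_matrix_unit[of Z]) (simp add: pr.sum pr.scale)
    then have "orth_proj W Z $ a $ j = (\<Sum>b\<in>UNIV. \<Sum>i\<in>UNIV. e j i $ a $ b * Z $ b $ i)"
      by (simp add: e_def mult.commute)
    then show ?thesis by (subst sum.swap)
  qed
  have mult_unit: "(X ** matrix_unit b i) $ c $ k = (if k = i then X $ c $ b else 0)" for X b i c k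
  proof -
    have "(X ** matrix_unit b i) $ c $ k = (\<Sum>l\<in>UNIV. if l = b then (if k = i then X $ c $ l else 0) else 0)"
      unfolding matrix_mult_nth matrix_unit_nth by (intro sum.cong refl) auto
    then show ?thesis by simp
  qed
  have "e j i \<in> commutant W" for j i
  proof -
    have "X ** e j i = e j i ** X" if X: "X \<in> W" for X
    proof (rule cmat_eqI)
      fix a b
      have "(X ** e j i) $ a $ b = (X ** orth_proj W (matrix_unit b i)) $ a $ j"
        by (simp add: e_def matrix_mult_nth)
      also have "\<dots> = orth_proj W (X ** matrix_unit b i) $ a $ j" by (simp add: left[OF X])
      also have "\<dots> = (\<Sum>k\<in>UNIV. \<Sum>c\<in>UNIV. if k = i then e j k $ a $ c * X $ c $ b else 0)"
        unfolding orth_proj_nth mult_unit by (intro sum.cong refl) auto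
      also have "\<dots> = (\<Sum>k\<in>UNIV. if k = i then (\<Sum>c\<in>UNIV. e j k $ a $ c * X $ c $ b) else 0)"
        by (intro sum.cong refl) auto
      also have "\<dots> = (e j i ** X) $ a $ b" by (simp add: matrix_mult_nth)
      finally show "(X ** e j i) $ a $ b = (e j i ** X) $ a $ b" .
    qed
    then show ?thesis by (simp add: commutant_def)
  qed
  then have eQ: "e j i ** Q = Q ** e j i" for j i
    using Q by (simp add: commutant_def)
  have "Q ** orth_proj W Z = orth_proj W (Q ** Z)" for Z
  proof (rule cmat_eqI)
    fix a j
    have "(Q ** orth_proj W Z) $ a $ j
        = (\<Sum>k\<in>UNIV. \<Sum>i\<in>UNIV. \<Sum>b\<in>UNIV. Q $ a $ k * (e j i $ k $ b * Z $ b $ i))"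
      unfolding matrix_mult_nth[of Q] orth_proj_nth sum_distrib_left ..
    also have "\<dots> = (\<Sum>i\<in>UNIV. \<Sum>k\<in>UNIV. \<Sum>b\<in>UNIV. Q $ a $ k * (e j i $ k $ b * Z $ b $ i))"
      by (rule sum.swap)
    also have "\<dots> = (\<Sum>i\<in>UNIV. (Q ** (e j i ** Z)) $ a $ i)"
      unfolding matrix_mult_nth sum_distrib_left ..
    also have "\<dots> = (\<Sum>i\<in>UNIV. (e j i ** (Q ** Z)) $ a $ i)"
      by (simp add: matrix_mul_assoc eQ)
    also have "\<dots> = orth_proj W (Q ** Z) $ a $ j"
      unfolding orth_proj_nth matrix_mult_nth[of "e _ _"] ..
    finally show "(Q ** orth_proj W Z) $ a $ j = orth_proj W (Q ** Z) $ a $ j" .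
  qed
  from this[of "mat 1"] have "Q ** orth_proj W (mat 1) = orth_proj W Q" by simp
  moreover have "orth_proj W (mat 1) = mat 1"
    using W by (intro orth_proj_id[OF rsub]) (simp add: von_neumann_algebra_def)
  ultimately show "Q \<in> W" using orth_proj_in[OF rsub, of Q] by simp
qed

lemma von_neumann_algebra_commutant:
  assumes "\<And>X. X \<in> S \<Longrightarrow> dagger X \<in> S"
  shows "von_neumann_algebra (commutant S)"
proof -
  have "dagger Y \<in> commutant S" if "Y \<in> commutant S" for Y
    unfolding commutant_def
  proof safe
    fix X assume "X \<in> S"
    then have "dagger X ** Y = Y ** dagger X" using assms commutantD that by blast
    then have "dagger (dagger X ** Y) = dagger (Y ** dagger X)" by simp
    then show "X ** dagger Y = dagger Y ** X" by (simp add: dagger_mult)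
  qed
  then show ?thesis
    by (simp add: von_neumann_algebra_def subspace_commutant mult_in_commutant mat_1_in_commutant)
qed

section \<open>Twirling\<close>

lemma unitary_mat_1: "unitary (mat 1)"
  by (simp add: unitary_def)

lemma unitary_mult: "unitary U \<Longrightarrow> unitary V \<Longrightarrow> unitary (U ** V)"
  unfolding unitary_def dagger_mult by (metis matrix_mul_assoc matrix_mul_rid)

lemma linear_conjugate: "linear (\<lambda>X. V ** X ** dagger V)" for V :: "'a::finite cmat"
  using linear_compose[OF linear_mult_right[of V] linear_mult_left[of "dagger V"]] by (simp add: o_def)

lemma inner_conjugate: "(V ** X ** dagger V) \<bullet> Y = X \<bullet> (dagger V ** Y ** V)"
  for V :: "'a::finite cmat"
proof -
  have "(V ** X ** dagger V) \<bullet> Y = (V ** X) \<bullet> (Y ** V)"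
    by (subst inner_mult_right) simp
  then show ?thesis by (simp add: inner_mult_left[of V X] matrix_mul_assoc)
qed

lemma norm_conjugate:
  assumes "unitary V"
  shows "norm (V ** X ** dagger V) = norm X"
proof -
  have "dagger V ** (V ** X ** dagger V) ** V = (dagger V ** V) ** X ** (dagger V ** V)"
    by (simp add: matrix_mul_assoc)
  then show ?thesis using assms
    unfolding norm_eq_sqrt_inner inner_conjugate by (simp add: unitary_def)
qed

lemma conjugate_commutant:
  assumes "unitary V" "V ** Y = Y ** V"
  shows "dagger V ** Y ** V = Y" and "V ** Y ** dagger V = Y"
  using assms unfolding unitary_def by (metis matrix_mul_assoc matrix_mul_lid matrix_mul_rid)+

text \<open>The element of least norm in the closed convex hull of the orbit is invariant, and
  coincides with the projection onto the fixed points; this replaces averaging over Haar measure.\<close>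
lemma orth_proj_commutant_in_hull:
  fixes G :: "'a::finite cmat set"
  assumes unit: "\<And>V. V \<in> G \<Longrightarrow> unitary V"
    and one: "mat 1 \<in> G" and mult: "\<And>U V. U \<in> G \<Longrightarrow> V \<in> G \<Longrightarrow> U ** V \<in> G"
  shows "orth_proj (commutant G) Q \<in> closure (convex hull ((\<lambda>V. V ** Q ** dagger V) ` G))"
proof -
  define O' where "O' = (\<lambda>V. V ** Q ** dagger V) ` G"
  define H where "H = closure (convex hull O')"
  have H: "closed H" "convex H" "H \<noteq> {}"
    using one by (auto simp: H_def O'_def convex_closure)
  define y where "y = closest_point H 0"
  have yH: "y \<in> H" unfolding y_def by (rule closest_point_in_set[OF H(1,3)])
  have inv: "V ** x ** dagger V \<in> H" if V: "V \<in> G" and x: "x \<in> H" for V x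
  proof -
    let ?c = "\<lambda>X. V ** X ** dagger V"
    have "?c ` O' \<subseteq> O'"
    proof safe
      fix X assume "X \<in> O'"
      then obtain U where "U \<in> G" "X = U ** Q ** dagger U" by (auto simp: O'_def)
      then show "?c X \<in> O'"
        unfolding O'_def using mult[OF V, of U]
        by (intro image_eqI[of _ _ "V ** U"]) (simp_all add: dagger_mult matrix_mul_assoc)
    qed
    then have "?c ` (convex hull O') \<subseteq> convex hull O'"
      using convex_hull_linear_image[OF linear_conjugate] by (metis hull_mono)
    moreover have "?c ` closure (convex hull O') \<subseteq> closure (?c ` (convex hull O'))"
      by (rule closure_linear_image_subset[OF linear_conjugate])
    ultimately show ?thesis using x unfolding H_def by (meson closure_mono image_subset_iff subset_iff)
  qed
  \<comment> \<open>Conjugation maps the hull into itself and keeps the norm, so it sends the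
    closest point to a closest point; in a closed convex set there is only one.\<close>
  have invariant: "V ** y ** dagger V = y" if V: "V \<in> G" for V
    unfolding y_def
  proof (rule closest_point_unique[OF H(2,1)])
    show "V ** closest_point H 0 ** dagger V \<in> H" using inv[OF V yH] by (simp add: y_def)
    show "\<forall>z\<in>H. dist 0 (V ** closest_point H 0 ** dagger V) \<le> dist 0 z"
      using closest_point_le[OF H(1), of _ 0] by (simp add: norm_conjugate[OF unit[OF V]])
  qed
  have "y \<in> commutant G"
    unfolding commutant_def
  proof safe
    fix V assume V: "V \<in> G"
    have "V ** y = V ** y ** (dagger V ** V)" using unit[OF V] by (simp add: unitary_def)
    also have "\<dots> = V ** y ** dagger V ** V" by (simp add: matrix_mul_assoc)
    finally show "V ** y = y ** V" by (simp add: invariant[OF V])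
  qed
  \<comment> \<open>Pairing with \<open>w\<close> is constant on the orbit, hence on its closed
    convex hull.\<close>
  moreover have "y \<bullet> w = Q \<bullet> w" if w: "w \<in> commutant G" for w
  proof -
    have "O' \<subseteq> {x. x \<bullet> w = Q \<bullet> w}"
      using conjugate_commutant(1)[OF unit] commutantD[OF w] by (auto simp: O'_def inner_conjugate)
    moreover have "convex {x. x \<bullet> w = Q \<bullet> w}"
      using convex_hyperplane[of w "Q \<bullet> w"] by (simp add: inner_commute)
    moreover have "closed {x. x \<bullet> w = Q \<bullet> w}"
      using closed_hyperplane[of w "Q \<bullet> w"] by (simp add: inner_commute)
    ultimately have "H \<subseteq> {x. x \<bullet> w = Q \<bullet> w}"
      unfolding H_def by (intro closure_minimal hull_minimal) auto
    then show ?thesis using yH by blast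
  qed
  ultimately have "orth_proj (commutant G) Q = y"
    by (intro orth_proj_unique cmat_subspace_imp_subspace subspace_commutant)
  then show ?thesis using yH by (simp add: H_def O'_def)
qed

text \<open>The orbit of a positive operator stays in the closed convex cone of positive operators,
  and so does its closed hull.\<close>

lemma positive_op_twirl:
  fixes G :: "'a::finite cmat set"
  assumes "\<And>V. V \<in> G \<Longrightarrow> unitary V"
    and "mat 1 \<in> G" and "\<And>U V. U \<in> G \<Longrightarrow> V \<in> G \<Longrightarrow> U ** V \<in> G"
    and "positive_op Q"
  shows "positive_op (orth_proj (commutant G) Q)"
proof -
  have "closure (convex hull ((\<lambda>V. V ** Q ** dagger V) ` G)) \<subseteq> {X. positive_op X}"
    using assms(4)
    by (intro closure_minimal hull_minimal convex_positive_op closed_positive_op)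
      (auto intro: positive_op_conjugate)
  with orth_proj_commutant_in_hull[OF assms(1-3)] show ?thesis by blast
qed

section \<open>Tensor products and permutations of the factors\<close>

lemma sum_fun_prod:
  fixes F :: "'n::finite \<Rightarrow> 'd::finite \<Rightarrow> complex"
  shows "(\<Sum>f\<in>UNIV. \<Prod>k\<in>UNIV. F k (f k)) = (\<Prod>k\<in>UNIV. \<Sum>i\<in>UNIV. F k i)"
  by (subst prod_sum_PiE) (simp_all add: PiE_UNIV_domain)

lemma tensor_nth: "tensor X $ f $ g = (\<Prod>k\<in>UNIV. X k $ f k $ g k)"
  by (simp add: tensor_def)

lemma tensor_mult: "tensor X ** tensor Y = tensor (\<lambda>k. X k ** Y k)"
  by (rule cmat_eqI)
    (simp add: matrix_mult_nth tensor_nth prod.distrib[symmetric]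
      sum_fun_prod[of "\<lambda>k i. X k $ _ k $ i * Y k $ i $ _ k"])

lemma dagger_tensor: "dagger (tensor X) = tensor (\<lambda>k. dagger (X k))"
  by (rule cmat_eqI) (simp add: tensor_nth)

lemma tensor_mat_1: "tensor (\<lambda>_. mat 1) = mat 1"
proof (rule cmat_eqI)
  fix f g :: "'a \<Rightarrow> 'b"
  show "tensor (\<lambda>_. mat 1) $ f $ g = (mat 1 :: ('a \<Rightarrow> 'b) cmat) $ f $ g"
    unfolding tensor_nth mat_nth by (cases "f = g") (auto simp: fun_eq_iff)
qed

lemma trace_tensor: "trace (tensor X) = (\<Prod>k\<in>UNIV. trace (X k))"
  unfolding trace_def tensor_nth by (rule sum_fun_prod)

lemma tensor_upd_nth:
  "tensor (Y(k := X)) $ f $ g = X $ f k $ g k * (\<Prod>j\<in>UNIV - {k}. Y j $ f j $ g j)"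
proof -
  have "tensor (Y(k := X)) $ f $ g = X $ f k $ g k * (\<Prod>j\<in>UNIV - {k}. (Y(k := X)) j $ f j $ g j)"
    unfolding tensor_nth by (subst prod.remove[of _ k]) auto
  also have "(\<Prod>j\<in>UNIV - {k}. (Y(k := X)) j $ f j $ g j) = (\<Prod>j\<in>UNIV - {k}. Y j $ f j $ g j)"
    by (intro prod.cong) auto
  finally show ?thesis .
qed

lemma cscale_linear_tensor_upd:
  "Vector_Spaces.linear cscale cscale (\<lambda>X. tensor (Y(k := X)))"
  by unfold_locales (auto intro!: cmat_eqI simp: tensor_upd_nth algebra_simps)

lemma tensor_power_mult: "tensor_power (X ** Y) = tensor_power X ** tensor_power Y"
  by (simp add: tensor_power_def tensor_mult)

lemma tensor_power_mat_1: "tensor_power (mat 1) = mat 1"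
  by (simp add: tensor_power_def tensor_mat_1)

lemma dagger_tensor_power: "dagger (tensor_power X) = tensor_power (dagger X)"
  by (simp add: tensor_power_def dagger_tensor)

lemma unitary_tensor_power:
  assumes "unitary V"
  shows "unitary (tensor_power V)"
  using assms unfolding unitary_def dagger_tensor_power tensor_power_mult[symmetric]
  by (simp add: tensor_power_mat_1)

lemma tensor_matrix_unit: "tensor (\<lambda>k. matrix_unit (f k) (g k)) = matrix_unit f g"
proof (rule cmat_eqI)
  fix a b
  show "tensor (\<lambda>k. matrix_unit (f k) (g k)) $ a $ b = matrix_unit f g $ a $ b"
    unfolding tensor_nth matrix_unit_nth by (cases "a = f \<and> b = g") (auto simp: fun_eq_iff)
qed

text \<open>The matrix units of the product basis are tensors of matrix units, so tensors
  span.\<close>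

lemma cscale_linear_eq_on_tensors:
  fixes F G :: "('n::finite \<Rightarrow> 'd::finite) cmat \<Rightarrow> 'b::finite cmat"
  assumes F: "Vector_Spaces.linear cscale cscale F" and G: "Vector_Spaces.linear cscale cscale G"
    and eq: "\<And>X. F (tensor X) = G (tensor X)"
  shows "F = G"
proof
  fix X
  interpret F: Vector_Spaces.linear cscale cscale F by fact
  interpret G: Vector_Spaces.linear cscale cscale G by fact
  have "F (matrix_unit f g) = G (matrix_unit f g)" for f g
    using eq[of "\<lambda>k. matrix_unit (f k) (g k)"] by (simp add: tensor_matrix_unit)
  then show "F X = G X"
    by (subst (1 2) cmat_eq_sum_matrix_unit[of X]) (simp add: F.sum F.scale G.sum G.scale)
qed

section \<open>Maps acting on one or on all tensor factors\<close>

definition slice :: "'n \<Rightarrow> ('n \<Rightarrow> 'd) \<Rightarrow> ('n \<Rightarrow> 'd) \<Rightarrow> ('n::finite \<Rightarrow> 'd::finite) cmat \<Rightarrow> 'd cmat"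
  where "slice k f g X = (\<chi> i j. X $ f(k := i) $ g(k := j))"

text \<open>This is \<open>L\<close> on the factor \<open>k\<close> tensored with the identity on
  the others: \<open>L\<close> is applied to each block obtained by freezing the indices at the
  other sites.\<close>

definition at_site ::
    "('d cmat \<Rightarrow> 'd cmat) \<Rightarrow> 'n \<Rightarrow> ('n::finite \<Rightarrow> 'd::finite) cmat \<Rightarrow> ('n \<Rightarrow> 'd) cmat"
  where "at_site L k X = (\<chi> f g. L (slice k f g X) $ f k $ g k)"

lemma slice_nth: "slice k f g X $ i $ j = X $ f(k := i) $ g(k := j)"
  by (simp add: slice_def)

lemma at_site_nth: "at_site L k X $ f $ g = L (slice k f g X) $ f k $ g k"
  by (simp add: at_site_def)

lemma at_site_eq_self: "(\<And>f g. L (slice k f g X) = slice k f g X) \<Longrightarrow> at_site L k X = X"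
  by (rule cmat_eqI) (simp add: at_site_nth slice_nth)

lemma cscale_linear_at_site:
  assumes "Vector_Spaces.linear cscale cscale L"
  shows "Vector_Spaces.linear cscale cscale (at_site L k)"
proof -
  interpret L: Vector_Spaces.linear cscale cscale L by fact
  have "L (slice k f g (X + Y)) = L (slice k f g X) + L (slice k f g Y)" for f g X Y
    unfolding L.add[symmetric] by (rule arg_cong[of _ _ L], rule cmat_eqI) (simp add: slice_nth)
  moreover have "L (slice k f g (cscale c X)) = cscale c (L (slice k f g X))" for f g c X
    unfolding L.scale[symmetric] by (rule arg_cong[of _ _ L], rule cmat_eqI) (simp add: slice_nth)
  ultimately show ?thesis
    by unfold_locales (auto intro!: cmat_eqI simp: at_site_nth)
qed

lemma at_site_tensor:
  assumes "Vector_Spaces.linear cscale cscale L"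
  shows "at_site L k (tensor X) = tensor (X(k := L (X k)))"
proof (rule cmat_eqI)
  fix f g
  interpret L: Vector_Spaces.linear cscale cscale L by fact
  have "tensor X $ f(k := i) $ g(k := j) = X k $ i $ j * (\<Prod>m\<in>UNIV - {k}. X m $ f m $ g m)" for i j
  proof -
    have "tensor X $ f(k := i) $ g(k := j)
        = X k $ i $ j * (\<Prod>m\<in>UNIV - {k}. X m $ (f(k := i)) m $ (g(k := j)) m)"
      using tensor_upd_nth[of X k "X k" "f(k := i)" "g(k := j)"] by simp
    also have "(\<Prod>m\<in>UNIV - {k}. X m $ (f(k := i)) m $ (g(k := j)) m)
        = (\<Prod>m\<in>UNIV - {k}. X m $ f m $ g m)"
      by (intro prod.cong) auto
    finally show ?thesis .
  qed
  then have "slice k f g (tensor X) = cscale (\<Prod>m\<in>UNIV - {k}. X m $ f m $ g m) (X k)"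
    by (intro cmat_eqI) (simp add: slice_nth mult.commute)
  then show "at_site L k (tensor X) $ f $ g = tensor (X(k := L (X k))) $ f $ g"
    by (simp add: at_site_nth L.scale tensor_upd_nth mult.commute)
qed

text \<open>The tensor power of \<open>L\<close>, given through matrix units so that no order of the
  sites has to be chosen.\<close>

definition tensor_map ::
    "('d cmat \<Rightarrow> 'd cmat) \<Rightarrow> ('n::finite \<Rightarrow> 'd::finite) cmat \<Rightarrow> ('n \<Rightarrow> 'd) cmat"
  where "tensor_map L X =
    (\<Sum>f\<in>UNIV. \<Sum>g\<in>UNIV. cscale (X $ f $ g) (tensor (\<lambda>k. L (matrix_unit (f k) (g k)))))"

text \<open>Treating the sites one at a time exhibits \<open>tensor_map L\<close> as a composition
  of single-site maps, so a property \<open>I\<close> that survives each such composition holds for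
  it. Positivity and fixing a given operator are transferred in this way.\<close>

lemma tensor_map_induct:
  fixes I :: "(('n::finite \<Rightarrow> 'd::finite) cmat \<Rightarrow> ('n \<Rightarrow> 'd) cmat) \<Rightarrow> bool"
  assumes L: "Vector_Spaces.linear cscale cscale L"
    and base: "I id" and step: "\<And>k F. I F \<Longrightarrow> I (at_site L k \<circ> F)"
  shows "Vector_Spaces.linear cscale cscale (tensor_map L :: ('n \<Rightarrow> 'd) cmat \<Rightarrow> _) \<and>
    (\<forall>X :: 'n \<Rightarrow> 'd cmat. tensor_map L (tensor X) = tensor (\<lambda>k. L (X k))) \<and> I (tensor_map L)"
proof -
  have "\<exists>F. Vector_Spaces.linear cscale cscale F \<and>
      (\<forall>X. F (tensor X) = tensor (\<lambda>k. if k \<in> S then L (X k) else X k)) \<and> I F" for S :: "'n set"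
    using finite[of S]
  proof (induction S rule: finite_induct)
    case empty
    show ?case by (intro exI[of _ id] conjI allI base cmat.linear_id) simp
  next
    case (insert k S)
    then obtain F where F: "Vector_Spaces.linear cscale cscale F"
      "\<And>X. F (tensor X) = tensor (\<lambda>k. if k \<in> S then L (X k) else X k)" "I F" by blast
    have "(at_site L k \<circ> F) (tensor X) = tensor (\<lambda>j. if j \<in> insert k S then L (X j) else X j)" for X
    proof -
      have "(\<lambda>j. if j \<in> S then L (X j) else X j)(k := L (X k))
          = (\<lambda>j. if j \<in> insert k S then L (X j) else X j)"
        using insert.hyps by auto
      then show ?thesis using insert.hyps by (simp add: F(2) at_site_tensor[OF L])
    qed
    moreover have "Vector_Spaces.linear cscale cscale (at_site L k \<circ> F)"
      by (intro Vector_Spaces.linear_compose[OF F(1)] cscale_linear_at_site L)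
    ultimately show ?case using step[OF F(3)] by blast
  qed
  from this[of UNIV] obtain F where F: "Vector_Spaces.linear cscale cscale F"
    "\<And>X. F (tensor X) = tensor (\<lambda>k. L (X k))" "I F" by auto
  interpret F: Vector_Spaces.linear cscale cscale F by fact
  have "tensor_map L X = F X" for X
    by (subst (2) cmat_eq_sum_matrix_unit[of X])
      (simp add: F.sum F.scale tensor_map_def tensor_matrix_unit[symmetric] F(2))
  then have "tensor_map L = F" ..
  then show ?thesis using F by simp
qed

lemma cscale_linear_tensor_map:
  "Vector_Spaces.linear cscale cscale L \<Longrightarrow> Vector_Spaces.linear cscale cscale (tensor_map L)"
  using tensor_map_induct[of L "\<lambda>_. True"] by blast

lemma tensor_map_tensor:
  "Vector_Spaces.linear cscale cscale L \<Longrightarrow> tensor_map L (tensor X) = tensor (\<lambda>k. L (X k))"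
  using tensor_map_induct[of L "\<lambda>_. True"] by blast

section \<open>Permutation operators and symmetrization\<close>

definition perm_op :: "('n \<Rightarrow> 'n) \<Rightarrow> ('n::finite \<Rightarrow> 'd::finite) cmat"
  where "perm_op \<pi> = (\<chi> f g. if g = f \<circ> \<pi> then 1 else 0)"

definition perms :: "('n::finite \<Rightarrow> 'n) set"
  where "perms = {\<pi>. bij \<pi>}"

lemma perm_op_mult_nth: "(perm_op \<pi> ** X) $ f $ g = X $ (f \<circ> \<pi>) $ g"
proof -
  have "(perm_op \<pi> ** X) $ f $ g = (\<Sum>h\<in>UNIV. if h = f \<circ> \<pi> then X $ h $ g else 0)"
    unfolding matrix_mult_nth perm_op_def by (intro sum.cong) auto
  then show ?thesis by simp
qed

lemma comp_inv_eq_iff: "bij \<pi> \<Longrightarrow> g = f \<circ> \<pi> \<longleftrightarrow> f = g \<circ> inv \<pi>"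
  by (metis bij_betw_def comp_assoc comp_id inv_o_cancel surj_iff)

lemma mult_perm_op_nth:
  assumes "bij \<pi>"
  shows "(X ** perm_op \<pi>) $ f $ g = X $ f $ (g \<circ> inv \<pi>)"
proof -
  have "(X ** perm_op \<pi>) $ f $ g = (\<Sum>h\<in>UNIV. if h = g \<circ> inv \<pi> then X $ f $ h else 0)"
    unfolding matrix_mult_nth perm_op_def
    by (intro sum.cong) (use assms in \<open>auto simp: comp_inv_eq_iff\<close>)
  then show ?thesis by simp
qed

text \<open>Row \<open>f\<close> selects \<open>f \<circ> \<pi>\<close>; this convention yields a
  homomorphism without any inversion.\<close>

lemma perm_op_comp: "perm_op \<pi> ** perm_op \<sigma> = perm_op (\<pi> \<circ> \<sigma>)"
  by (rule cmat_eqI) (simp add: perm_op_mult_nth, simp add: perm_op_def comp_assoc)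

lemma perm_op_id: "perm_op id = mat 1"
  by (rule cmat_eqI) (simp add: perm_op_def mat_nth eq_commute)

lemma dagger_perm_op: "bij \<pi> \<Longrightarrow> dagger (perm_op \<pi>) = perm_op (inv \<pi>)"
  by (rule cmat_eqI) (simp add: perm_op_def comp_inv_eq_iff)

lemma perm_op_inv:
  assumes "bij \<pi>"
  shows "perm_op \<pi> ** perm_op (inv \<pi>) = mat 1" and "perm_op (inv \<pi>) ** perm_op \<pi> = mat 1"
  using assms unfolding perm_op_comp
  by (metis bij_betw_def perm_op_id surj_iff) (metis assms bij_betw_def inv_o_cancel perm_op_id)

lemma perm_op_tensor:
  assumes "bij \<pi>"
  shows "perm_op \<pi> ** tensor X = tensor (X \<circ> inv \<pi>) ** perm_op \<pi>"
proof (rule cmat_eqI)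
  fix f g
  have "(perm_op \<pi> ** tensor X) $ f $ g = (\<Prod>k\<in>UNIV. X k $ f (\<pi> k) $ g k)"
    by (simp add: perm_op_mult_nth tensor_nth)
  also have "\<dots> = (\<Prod>k\<in>UNIV. X (inv \<pi> k) $ f k $ g (inv \<pi> k))"
    by (rule prod.reindex_bij_witness[of _ "inv \<pi>" \<pi>])
      (use assms in \<open>auto simp: bij_is_inj bij_is_surj surj_f_inv_f\<close>)
  also have "\<dots> = (tensor (X \<circ> inv \<pi>) ** perm_op \<pi>) $ f $ g"
    by (simp add: mult_perm_op_nth[OF assms] tensor_nth)
  finally show "(perm_op \<pi> ** tensor X) $ f $ g = (tensor (X \<circ> inv \<pi>) ** perm_op \<pi>) $ f $ g" .
qed

lemma perms_iff: "\<pi> \<in> perms \<longleftrightarrow> bij \<pi>"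
  by (simp add: perms_def)

lemma sum_perms_comp_left:
  assumes "bij \<pi>"
  shows "(\<Sum>\<sigma>\<in>perms. F (\<pi> \<circ> \<sigma>)) = (\<Sum>\<sigma>\<in>perms. F \<sigma>)"
  by (rule sum.reindex_bij_witness[of _ "\<lambda>\<sigma>. inv \<pi> \<circ> \<sigma>" "\<lambda>\<sigma>. \<pi> \<circ> \<sigma>"])
    (use assms in \<open>auto simp: perms_iff bij_comp bij_imp_bij_inv fun_eq_iff bij_is_inj
        bij_is_surj surj_f_inv_f\<close>)

lemma sum_perms_comp_right:
  assumes "bij \<pi>"
  shows "(\<Sum>\<sigma>\<in>perms. F (\<sigma> \<circ> \<pi>)) = (\<Sum>\<sigma>\<in>perms. F \<sigma>)"
  by (rule sum.reindex_bij_witness[of _ "\<lambda>\<sigma>. \<sigma> \<circ> inv \<pi>" "\<lambda>\<sigma>. \<sigma> \<circ> \<pi>"])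
    (use assms in \<open>auto simp: perms_iff bij_comp bij_imp_bij_inv fun_eq_iff bij_is_inj
        bij_is_surj surj_f_inv_f\<close>)

lemma sum_perms_inv: "(\<Sum>\<sigma>\<in>perms. F (inv \<sigma>)) = (\<Sum>\<sigma>\<in>perms. F \<sigma>)"
  by (rule sum.reindex_bij_witness[of _ inv inv])
    (auto simp: perms_iff bij_imp_bij_inv inv_inv_eq)

lemma perms_nonempty: "perms \<noteq> {}"
  using bij_id by (auto simp: perms_def)

text \<open>The group average, hence the orthogonal projection onto the vectors fixed by all
  permutations: the \<open>P\<close> of the overview.\<close>

definition sym_proj :: "('n::finite \<Rightarrow> 'd::finite) cmat"
  where "sym_proj = (1 / real (card (perms :: ('n \<Rightarrow> 'n) set))) *\<^sub>R (\<Sum>\<pi>\<in>perms. perm_op \<pi>)"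

lemma perm_op_sym_proj:
  fixes \<pi> :: "'n::finite \<Rightarrow> 'n"
  assumes "bij \<pi>"
  shows "perm_op \<pi> ** sym_proj = (sym_proj :: ('n \<Rightarrow> 'd::finite) cmat)"
  using sum_perms_comp_left[OF assms, of "perm_op :: _ \<Rightarrow> ('n \<Rightarrow> 'd) cmat"]
  by (simp add: sym_proj_def scaleR_mult_right mult_sum_right perm_op_comp)

lemma sym_proj_perm_op:
  fixes \<pi> :: "'n::finite \<Rightarrow> 'n"
  assumes "bij \<pi>"
  shows "sym_proj ** perm_op \<pi> = (sym_proj :: ('n \<Rightarrow> 'd::finite) cmat)"
  using sum_perms_comp_right[OF assms, of "perm_op :: _ \<Rightarrow> ('n \<Rightarrow> 'd) cmat"]
  by (simp add: sym_proj_def scaleR_mult_left mult_sum_left perm_op_comp)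

lemma dagger_sym_proj: "dagger sym_proj = (sym_proj :: ('n::finite \<Rightarrow> 'd::finite) cmat)"
proof -
  have "(\<Sum>\<pi>\<in>perms. dagger (perm_op \<pi> :: ('n \<Rightarrow> 'd) cmat)) = (\<Sum>\<pi>\<in>perms. perm_op (inv \<pi>))"
    by (intro sum.cong) (auto simp: perms_iff dagger_perm_op)
  then show ?thesis
    by (simp add: sym_proj_def dagger_scaleR dagger_sum sum_perms_inv[of "perm_op :: _ \<Rightarrow> ('n \<Rightarrow> 'd) cmat"])
qed

lemma mult_sym_proj_eq:
  fixes X :: "('n::finite \<Rightarrow> 'd::finite) cmat"
  assumes "\<And>\<pi>. bij \<pi> \<Longrightarrow> X ** perm_op \<pi> = X"
  shows "X ** sym_proj = X"
proof -
  have "(\<Sum>\<pi>\<in>(perms :: ('n \<Rightarrow> 'n) set). X ** perm_op \<pi>) = (\<Sum>\<pi>\<in>(perms :: ('n \<Rightarrow> 'n) set). X)"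
    by (intro sum.cong) (auto simp: perms_iff assms)
  then show ?thesis
    by (simp add: perms_nonempty sym_proj_def scaleR_mult_right mult_sum_right sum_constant_scaleR del: sum_constant)
qed

lemma sym_proj_mult_eq:
  fixes X :: "('n::finite \<Rightarrow> 'd::finite) cmat"
  assumes "\<And>\<pi>. bij \<pi> \<Longrightarrow> perm_op \<pi> ** X = X"
  shows "sym_proj ** X = X"
proof -
  have "(\<Sum>\<pi>\<in>(perms :: ('n \<Rightarrow> 'n) set). perm_op \<pi> ** X) = (\<Sum>\<pi>\<in>(perms :: ('n \<Rightarrow> 'n) set). X)"
    by (intro sum.cong) (auto simp: perms_iff assms)
  then show ?thesis
    by (simp add: perms_nonempty sym_proj_def scaleR_mult_left mult_sum_left sum_constant_scaleR del: sum_constant)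
qed

lemma sym_proj_idem: "sym_proj ** sym_proj = sym_proj"
  by (rule mult_sym_proj_eq) (rule sym_proj_perm_op)

text \<open>Left unnormalized, so that a tensor is sent to the plain sum \<open>sym_tensor\<close>;
  the number of permutations is divided out later.\<close>

definition symmetrize :: "('n::finite \<Rightarrow> 'd::finite) cmat \<Rightarrow> ('n \<Rightarrow> 'd) cmat"
  where "symmetrize X = (\<Sum>\<pi>\<in>perms. perm_op \<pi> ** X ** perm_op (inv \<pi>))"

definition sym_tensor :: "('n::finite \<Rightarrow> 'd::finite cmat) \<Rightarrow> ('n \<Rightarrow> 'd) cmat"
  where "sym_tensor Y = (\<Sum>\<pi>\<in>perms. tensor (Y \<circ> \<pi>))"

lemma conjugate_perm_op_tensor:
  assumes "bij \<pi>"
  shows "perm_op \<pi> ** tensor Y ** perm_op (inv \<pi>) = tensor (Y \<circ> inv \<pi>)"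
  by (simp add: perm_op_tensor[OF assms] matrix_mul_assoc[symmetric] perm_op_inv[OF assms])

lemma symmetrize_tensor: "symmetrize (tensor Y) = sym_tensor Y"
proof -
  have "symmetrize (tensor Y) = (\<Sum>\<pi>\<in>perms. tensor (Y \<circ> inv \<pi>))"
    unfolding symmetrize_def by (intro sum.cong) (auto simp: perms_iff conjugate_perm_op_tensor)
  then show ?thesis by (simp add: sym_tensor_def sum_perms_inv[of "\<lambda>\<pi>. tensor (Y \<circ> \<pi>)"])
qed

lemma cscale_linear_symmetrize: "Vector_Spaces.linear cscale cscale symmetrize"
  by unfold_locales
    (simp_all add: symmetrize_def matrix_add_ldistrib mult_add_left sum.distrib cscale_mult_right
      cscale_mult_left cmat.scale_sum_right)

lemma symmetrize_eq_scaleR: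
  fixes X :: "('n::finite \<Rightarrow> 'd::finite) cmat"
  assumes "\<And>\<pi>. bij \<pi> \<Longrightarrow> perm_op \<pi> ** X = X ** perm_op \<pi>"
  shows "symmetrize X = real (card (perms :: ('n \<Rightarrow> 'n) set)) *\<^sub>R X"
proof -
  have "symmetrize X = (\<Sum>\<pi>\<in>(perms :: ('n \<Rightarrow> 'n) set). X)"
    unfolding symmetrize_def
    by (intro sum.cong) (auto simp: perms_iff assms matrix_mul_assoc[symmetric] perm_op_inv)
  then show ?thesis by (simp add: sum_constant_scaleR del: sum_constant)
qed

lemma perm_op_symmetrize:
  assumes "bij \<pi>"
  shows "perm_op \<pi> ** symmetrize X = symmetrize X ** perm_op \<pi>"
proof -
  have "perm_op \<pi> ** symmetrize X ** perm_op (inv \<pi>)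
      = (\<Sum>\<sigma>\<in>perms. perm_op (\<pi> \<circ> \<sigma>) ** X ** perm_op (inv (\<pi> \<circ> \<sigma>)))"
    unfolding symmetrize_def mult_sum_right mult_sum_left
    by (intro sum.cong refl)
      (use assms in \<open>simp add: perms_iff o_inv_distrib perm_op_comp[symmetric] matrix_mul_assoc\<close>)
  also have "\<dots> = symmetrize X"
    unfolding symmetrize_def
    by (rule sum_perms_comp_left[OF assms, of "\<lambda>\<sigma>. perm_op \<sigma> ** X ** perm_op (inv \<sigma>)"])
  finally have "symmetrize X ** perm_op \<pi> = perm_op \<pi> ** symmetrize X ** perm_op (inv \<pi>) ** perm_op \<pi>"
    by simp
  also have "\<dots> = perm_op \<pi> ** symmetrize X"
    by (simp add: matrix_mul_assoc[symmetric] perm_op_inv[OF assms])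
  finally show ?thesis ..
qed

section \<open>The algebra power as a von Neumann algebra\<close>

lemma subspace_algebra_power: "cmat.subspace (algebra_power A)"
  by (simp add: algebra_power_def cmat.subspace_span)

lemma tensor_in_algebra_power: "(\<And>k. X k \<in> A) \<Longrightarrow> tensor X \<in> algebra_power A"
  unfolding algebra_power_def by (rule cmat.span_base) blast

lemma cscale_linear_image_span:
  assumes F: "Vector_Spaces.linear cscale cscale F" and W: "cmat.subspace W"
    and S: "\<And>X. X \<in> S \<Longrightarrow> F X \<in> W" and X: "X \<in> cmat.span S"
  shows "F X \<in> W"
proof -
  interpret F: Vector_Spaces.linear cscale cscale F by fact
  have "cmat.span S \<subseteq> {X. F X \<in> W}"
    using W S by (intro cmat.span_minimal)
      (auto simp: cmat.subspace_def F.add F.scale F.zero)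
  then show ?thesis using X by blast
qed

lemma von_neumann_algebra_span:
  assumes one: "mat 1 \<in> S" and mult: "\<And>X Y. X \<in> S \<Longrightarrow> Y \<in> S \<Longrightarrow> X ** Y \<in> S"
    and dag: "\<And>X. X \<in> S \<Longrightarrow> dagger X \<in> S"
  shows "von_neumann_algebra (cmat.span S)"
proof -
  have lin_l: "Vector_Spaces.linear cscale cscale (\<lambda>X. X ** Y)" for Y :: "'a cmat"
    by unfold_locales (simp_all add: mult_add_left cscale_mult_left)
  have lin_r: "Vector_Spaces.linear cscale cscale (\<lambda>X. Y ** X)" for Y :: "'a cmat"
    by unfold_locales (simp_all add: matrix_add_ldistrib cscale_mult_right)
  have 1: "Y ** X \<in> cmat.span S" if "Y \<in> S" "X \<in> cmat.span S" for X Y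
    by (rule cscale_linear_image_span[OF lin_r cmat.subspace_span _ that(2)])
      (use mult that(1) in \<open>auto intro: cmat.span_base\<close>)
  have 2: "Y ** X \<in> cmat.span S" if "Y \<in> cmat.span S" "X \<in> cmat.span S" for X Y
    by (rule cscale_linear_image_span[OF lin_l cmat.subspace_span _ that(1)])
      (use 1 that(2) in auto)
  have "cmat.span S \<subseteq> {X. dagger X \<in> cmat.span S}"
    using dag by (intro cmat.span_minimal)
      (auto simp: cmat.subspace_def dagger_add dagger_cscale cmat.span_base
        cmat.span_add cmat.span_scale cmat.span_zero)
  then show ?thesis
    unfolding von_neumann_algebra_def using 2 one by (auto intro: cmat.span_base)
qed

lemma von_neumann_algebra_power:
  assumes "von_neumann_algebra A"
  shows "von_neumann_algebra (algebra_power A :: ('n::finite \<Rightarrow> 'd::finite) cmat set)"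
  unfolding algebra_power_def
proof (rule von_neumann_algebra_span)
  let ?S = "{tensor X | X :: 'n \<Rightarrow> 'd cmat. \<forall>k. X k \<in> A}"
  have "tensor (\<lambda>_. mat 1) \<in> ?S" using assms unfolding von_neumann_algebra_def by blast
  then show "mat 1 \<in> ?S" by (simp add: tensor_mat_1)
  show "X ** Y \<in> ?S" if "X \<in> ?S" "Y \<in> ?S" for X Y
    using that assms unfolding von_neumann_algebra_def by (auto simp: tensor_mult)
  show "dagger X \<in> ?S" if "X \<in> ?S" for X
    using that assms unfolding von_neumann_algebra_def by (auto simp: dagger_tensor)
qed

lemma conjugate_perm_op_algebra_power:
  assumes "bij \<pi>" and "X \<in> algebra_power A"
  shows "perm_op \<pi> ** X ** perm_op (inv \<pi>) \<in> algebra_power A"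
proof -
  have "Vector_Spaces.linear cscale cscale (\<lambda>X. perm_op \<pi> ** X ** perm_op (inv \<pi>))"
    by unfold_locales (simp_all add: matrix_add_ldistrib mult_add_left cscale_mult_right cscale_mult_left)
  then show ?thesis
    by (rule cscale_linear_image_span[OF _ subspace_algebra_power _ assms(2)[unfolded algebra_power_def]])
      (auto simp: conjugate_perm_op_tensor[OF assms(1)] intro!: tensor_in_algebra_power)
qed

lemma symmetrize_algebra_power: "X \<in> algebra_power A \<Longrightarrow> symmetrize X \<in> algebra_power A"
  unfolding symmetrize_def
  by (intro cmat.subspace_sum subspace_algebra_power conjugate_perm_op_algebra_power)
    (auto simp: perms_iff)

section \<open>Schur-Weyl duality for gauge groups\<close>

definition site :: "'n \<Rightarrow> 'd cmat \<Rightarrow> ('n::finite \<Rightarrow> 'd::finite) cmat"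
  where "site k X = tensor ((\<lambda>_. mat 1)(k := X))"

text \<open>The infinitesimal action: the derivative of
  \<open>tensor_power (mat 1 + t *\<^sub>R X)\<close> at \<open>t = 0\<close>. It plays the part of
  a power sum in Newton's identities.\<close>

definition site_sum :: "'d cmat \<Rightarrow> ('n::finite \<Rightarrow> 'd::finite) cmat"
  where "site_sum X = (\<Sum>k\<in>UNIV. site k X)"

lemma cscale_linear_site: "Vector_Spaces.linear cscale cscale (site k)"
  unfolding site_def[abs_def] by (rule cscale_linear_tensor_upd)

lemma site_add: "site k (X + Y) = site k X + site k Y"
  and site_cscale: "site k (cscale c X) = cscale c (site k X)"
proof -
  interpret L: Vector_Spaces.linear cscale cscale "site k" by (rule cscale_linear_site)
  show "site k (X + Y) = site k X + site k Y" by (rule L.add)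
  show "site k (cscale c X) = cscale c (site k X)" by (rule L.scale)
qed

lemma site_sum_add: "site_sum (X + Y) = site_sum X + site_sum Y"
  by (simp add: site_sum_def site_add sum.distrib)

lemma site_sum_cscale: "site_sum (cscale c X) = cscale c (site_sum X)"
  by (simp add: site_sum_def site_cscale cmat.scale_sum_right)

lemma tensor_site: "tensor Y ** site k X = tensor (Y(k := Y k ** X))"
  unfolding site_def tensor_mult by (rule arg_cong[of _ _ tensor]) auto

lemma has_vector_derivative_cmat:
  fixes F :: "real \<Rightarrow> 'a::finite cmat"
  assumes "\<And>i j. ((\<lambda>t. F t $ i $ j) has_vector_derivative F' $ i $ j) net"
  shows "(F has_vector_derivative F') net"
proof -
  have lin: "bounded_linear (\<lambda>c. cscale c X)" for X :: "'a cmat"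
    by (rule linear_conv_bounded_linear[THEN iffD1], rule linearI)
      (simp_all add: cmat.scale_left_distrib scaleR_eq_cscale scaleR_conv_of_real)
  have "((\<lambda>t. \<Sum>i\<in>UNIV. \<Sum>j\<in>UNIV. cscale (F t $ i $ j) (matrix_unit i j)) has_vector_derivative
      (\<Sum>i\<in>UNIV. \<Sum>j\<in>UNIV. cscale (F' $ i $ j) (matrix_unit i j))) net"
    by (intro has_vector_derivative_sum bounded_linear.has_vector_derivative[OF lin] assms)
  then show ?thesis by (simp only: cmat_eq_sum_matrix_unit[symmetric])
qed

lemma bounded_bilinear_matrix_mult:
  "bounded_bilinear ((**) :: 'a::finite cmat \<Rightarrow> 'a cmat \<Rightarrow> 'a cmat)"
  by (rule bilinear_conv_bounded_bilinear[THEN iffD1], unfold bilinear_def)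
    (intro conjI allI linear_mult_left linear_mult_right)

lemma tensor_power_derivative:
  "((\<lambda>t. tensor_power (mat 1 + t *\<^sub>R K)) has_vector_derivative site_sum K) (at 0)"
proof (rule has_vector_derivative_cmat)
  fix f g :: "'a \<Rightarrow> 'b"
  define c d where "c k = (mat 1 :: 'b cmat) $ f k $ g k" and "d k = K $ f k $ g k" for k
  have "((\<lambda>t. \<Prod>k\<in>UNIV. c k + t *\<^sub>R d k) has_derivative
      (\<lambda>y. \<Sum>k\<in>UNIV. y *\<^sub>R d k * (\<Prod>j\<in>UNIV - {k}. c j + 0 *\<^sub>R d j))) (at 0)"
    by (rule has_derivative_prod) (auto intro!: derivative_eq_intros)
  then have "((\<lambda>t. \<Prod>k\<in>UNIV. c k + t *\<^sub>R d k) has_vector_derivative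
      (\<Sum>k\<in>UNIV. d k * (\<Prod>j\<in>UNIV - {k}. c j))) (at 0)"
    by (simp add: has_vector_derivative_def scaleR_sum_right)
  moreover have "site_sum K $ f $ g = (\<Sum>k\<in>UNIV. d k * (\<Prod>j\<in>UNIV - {k}. c j))"
    by (simp add: site_sum_def site_def tensor_upd_nth c_def d_def)
  ultimately show "((\<lambda>t. tensor_power (mat 1 + t *\<^sub>R K) $ f $ g) has_vector_derivative
      site_sum K $ f $ g) (at 0)"
    by (simp add: tensor_power_def tensor_nth c_def d_def)
qed

text \<open>If \<open>K\<close> fixes \<open>v\<close>, then moving \<open>K\<close> across the
  inner product gives \<open>cinner v v = - cinner v v\<close>; so 1 is not an eigenvalue.\<close>

lemma antihermitian_resolvent:
  fixes K :: "'a::finite cmat"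
  assumes K: "dagger K = - K"
  shows "\<exists>Z. Z ** (mat 1 - K) = mat 1 \<and> (mat 1 - K) ** Z = mat 1"
proof -
  have "v = 0" if v: "(mat 1 - K) *v v = 0" for v
  proof -
    have Kv: "K *v v = v" using v by (simp add: matrix_vector_mult_diff_rdistrib)
    have "cinner v v = cinner v (K *v v)" by (simp add: Kv)
    also have "\<dots> = cinner (dagger K *v v) v" by (rule cinner_adjoint)
    also have "dagger K *v v = - v"
      using matrix_vector_mult_diff_rdistrib[of 0 K v] by (simp add: K Kv vec_eq_iff)
    also have "cinner (- v) v = - cinner v v" by (simp add: cinner_def sum_negf)
    finally have "cinner v v = 0" by simp
    then show ?thesis by (simp add: cinner_self)
  qed
  then have "\<exists>Z. Z ** (mat 1 - K) = mat 1"
    by (simp add: matrix_left_invertible_injective vec.inj_iff_eq_0 matrix_left_invertible_ker)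
  then show ?thesis using matrix_left_right_inverse by blast
qed

text \<open>The Cayley transform is a unitary in the commutant. Clearing its denominator turns
  commutation into a symmetric identity.\<close>
lemma cayley_commute:
  fixes A :: "'d::finite cmat set" and Q :: "('n::finite \<Rightarrow> 'd) cmat"
  assumes Q: "Q \<in> commutant (tensor_power ` gauge_group A)"
    and K: "K \<in> commutant A" "dagger K = - K"
  shows "tensor_power (mat 1 - K) ** Q ** tensor_power (mat 1 + K)
    = tensor_power (mat 1 + K) ** Q ** tensor_power (mat 1 - K)"
proof -
  define Z W where "Z = mat 1 - K" and "W = mat 1 + K"
  obtain Zi where Zi: "Zi ** Z = mat 1" "Z ** Zi = mat 1"
    using antihermitian_resolvent[OF K(2)] by (auto simp: Z_def)
  have ZW: "Z ** W = W ** Z"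
    by (simp add: Z_def W_def mult_add_left mult_diff_left mult_diff_right matrix_add_ldistrib)
  have dZ: "dagger Z = W" "dagger W = Z"
    by (simp_all add: Z_def W_def dagger_diff dagger_add K(2))
  define Wi where "Wi = dagger Zi"
  have Wi: "Wi ** W = mat 1" "W ** Wi = mat 1"
    using arg_cong[OF Zi(1), of dagger] arg_cong[OF Zi(2), of dagger]
    by (simp_all add: dagger_mult dZ Wi_def)
  define V where "V = W ** Zi"
  have dV: "dagger V = Wi ** Z" by (simp add: V_def dagger_mult dZ Wi_def)
  have ZiW: "Zi ** W = W ** Zi"
  proof -
    have "Zi ** W = Zi ** (W ** Z) ** Zi" by (simp add: matrix_mul_assoc[symmetric] Zi)
    also have "\<dots> = (Zi ** Z) ** W ** Zi" by (simp add: ZW[symmetric] matrix_mul_assoc)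
    finally show ?thesis by (simp add: Zi)
  qed
  have "V ** dagger V = Zi ** (W ** Wi) ** Z"
    unfolding dV unfolding V_def ZiW[symmetric] by (simp add: matrix_mul_assoc)
  then have u1: "V ** dagger V = mat 1" by (simp add: Wi Zi)
  moreover have "dagger V ** V = mat 1" using u1 matrix_left_right_inverse by blast
  moreover have "X ** V = V ** X" if X: "X \<in> A" for X
  proof -
    have XK: "X ** K = K ** X" using K(1) X by (rule commutantD)
    have XZ: "X ** Z = Z ** X" and XW: "X ** W = W ** X"
      by (simp_all add: Z_def W_def mult_add_left mult_diff_left mult_diff_right matrix_add_ldistrib XK)
    have "X ** Zi = (Zi ** Z) ** X ** Zi" by (simp add: Zi)
    also have "\<dots> = Zi ** (X ** Z) ** Zi" by (simp add: XZ matrix_mul_assoc)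
    also have "\<dots> = Zi ** X" by (simp add: matrix_mul_assoc[symmetric] Zi)
    finally have "X ** Zi = Zi ** X" .
    then show ?thesis unfolding V_def by (metis XW matrix_mul_assoc)
  qed
  ultimately have "V \<in> gauge_group A" by (auto simp: gauge_group_def unitary_def)
  then have VQ: "tensor_power V ** Q = Q ** tensor_power V"
    using Q by (auto simp: commutant_def)
  let ?t = "tensor_power :: 'd cmat \<Rightarrow> ('n \<Rightarrow> 'd) cmat"
  \<comment> \<open>Since \<open>W = V ** Z = Z ** V\<close>, the factor \<open>?t V\<close> is
    split off on the right, moved across \<open>Q\<close> and absorbed on the left.\<close>
  have "?t Z ** Q ** ?t W = ?t Z ** Q ** ?t (V ** Z)"
    by (simp add: V_def matrix_mul_assoc[symmetric] Zi)
  also have "\<dots> = ?t Z ** (Q ** ?t V) ** ?t Z" by (simp add: tensor_power_mult matrix_mul_assoc)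
  also have "\<dots> = ?t (Z ** V) ** Q ** ?t Z"
    by (simp add: VQ[symmetric] tensor_power_mult matrix_mul_assoc)
  also have "Z ** V = W" by (simp add: V_def ZiW[symmetric] matrix_mul_assoc Zi)
  finally show ?thesis by (simp add: Z_def W_def)
qed

lemma minus_eq_cscale: "- X = cscale (-1) X"
  by (rule cmat_eqI) simp

lemma site_sum_antihermitian_commute:
  fixes A :: "'d::finite cmat set" and Q :: "('n::finite \<Rightarrow> 'd) cmat"
  assumes Q: "Q \<in> commutant (tensor_power ` gauge_group A)"
    and K: "K \<in> commutant A" "dagger K = - K"
  shows "site_sum K ** Q = Q ** site_sum K"
proof -
  let ?t = "tensor_power :: 'd cmat \<Rightarrow> ('n \<Rightarrow> 'd) cmat"
  let ?p = "\<lambda>s. ?t (mat 1 + s *\<^sub>R K)"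
  have p: "(?p has_vector_derivative site_sum K) (at 0)"
    by (rule tensor_power_derivative)
  have mK: "site_sum (- K) = - (site_sum K :: ('n \<Rightarrow> 'd) cmat)"
    unfolding minus_eq_cscale by (rule site_sum_cscale)
  have m: "((\<lambda>s. ?t (mat 1 - s *\<^sub>R K)) has_vector_derivative - site_sum K) (at 0)"
  proof -
    have "((\<lambda>s. ?t (mat 1 + s *\<^sub>R (- K))) has_vector_derivative site_sum (- K)) (at 0)"
      by (rule tensor_power_derivative)
    then show ?thesis by (simp add: mK)
  qed
  let ?F = "\<lambda>s. ?t (mat 1 - s *\<^sub>R K) ** Q ** ?t (mat 1 + s *\<^sub>R K)
    - ?t (mat 1 + s *\<^sub>R K) ** Q ** ?t (mat 1 - s *\<^sub>R K)"
  have "?F s = 0" for s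
  proof -
    have "s *\<^sub>R K \<in> commutant A"
      using K(1) by (simp add: scaleR_eq_cscale cmat.subspace_scale subspace_commutant)
    then show ?thesis using cayley_commute[OF Q, of "s *\<^sub>R K"] by (simp add: dagger_scaleR K(2))
  qed
  then have zero: "(?F has_vector_derivative 0) (at 0)" by simp
  note mult = bounded_bilinear.has_vector_derivative[OF bounded_bilinear_matrix_mult]
  note const = has_vector_derivative_const[of Q "at 0"]
  have "(?F has_vector_derivative
      (?t (mat 1 - 0 *\<^sub>R K) ** Q ** site_sum K
        + (?t (mat 1 - 0 *\<^sub>R K) ** 0 + (- site_sum K) ** Q) ** ?t (mat 1 + 0 *\<^sub>R K))
      - (?t (mat 1 + 0 *\<^sub>R K) ** Q ** (- site_sum K)
        + (?t (mat 1 + 0 *\<^sub>R K) ** 0 + site_sum K ** Q) ** ?t (mat 1 - 0 *\<^sub>R K))) (at 0)"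
    by (intro has_vector_derivative_diff mult p m const)
  then have "Q ** site_sum K + (- site_sum K) ** Q - (Q ** (- site_sum K) + site_sum K ** Q) = 0"
    using zero vector_derivative_unique_at by (fastforce simp: tensor_power_mat_1)
  moreover have "(- site_sum K) ** Q = - (site_sum K ** Q)" and "Q ** (- site_sum K) = - (Q ** site_sum K)"
    using mult_diff_left[of 0 "site_sum K" Q] mult_diff_right[of Q 0 "site_sum K"] by simp_all
  ultimately have "2 *\<^sub>R (Q ** site_sum K) = 2 *\<^sub>R (site_sum K ** Q)"
    by (simp add: scaleR_2 algebra_simps)
  then show ?thesis by simp
qed

text \<open>The commutant of \<open>A\<close> is closed under adjoints, so \<open>Y\<close> splits
  into an antihermitian element and \<open>\<i>\<close> times another one.\<close>

lemma site_sum_commute: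
  fixes A :: "'d::finite cmat set" and Q :: "('n::finite \<Rightarrow> 'd) cmat"
  assumes A: "von_neumann_algebra A" and Q: "Q \<in> commutant (tensor_power ` gauge_group A)"
    and Y: "Y \<in> commutant A"
  shows "site_sum Y \<in> commutant {Q}"
proof -
  have vA: "von_neumann_algebra (commutant A)"
    using A by (intro von_neumann_algebra_commutant) (simp add: von_neumann_algebra_def)
  then have dY: "dagger Y \<in> commutant A" using Y by (simp add: von_neumann_algebra_def)
  define K1 where "K1 = cscale (1/2) (Y - dagger Y)"
  define K2 where "K2 = cscale (- \<i>/2) (Y + dagger Y)"
  have K1: "K1 \<in> commutant A" and K2: "K2 \<in> commutant A"
    unfolding K1_def K2_def
    by (intro cmat.subspace_scale cmat.subspace_diff cmat.subspace_add subspace_commutant Y dY)+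
  have d1: "dagger K1 = - K1" and d2: "dagger K2 = - K2"
    by (auto intro!: cmat_eqI simp: K1_def K2_def algebra_simps)
  have "Y = K1 + cscale \<i> K2"
    by (rule cmat_eqI) (simp add: K1_def K2_def algebra_simps)
  then have "site_sum Y = site_sum K1 + cscale \<i> (site_sum K2)"
    by (simp add: site_sum_add site_sum_cscale)
  moreover have "site_sum K1 \<in> commutant {Q}" "site_sum K2 \<in> commutant {Q}"
    using site_sum_antihermitian_commute[OF Q K1 d1] site_sum_antihermitian_commute[OF Q K2 d2]
    by (simp_all add: commutant_def)
  ultimately show ?thesis
    by (metis cmat.subspace_add cmat.subspace_scale subspace_commutant)
qed

lemma sym_tensor_comp:
  assumes "bij \<tau>"
  shows "sym_tensor (Y \<circ> \<tau>) = sym_tensor Y"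
  using sum_perms_comp_left[OF assms, of "\<lambda>\<pi>. tensor (Y \<circ> \<pi>)"]
  by (simp add: sym_tensor_def comp_assoc)

text \<open>Multiplying by a power sum attaches \<open>X\<close> to each factor in turn. Labelling
  the sites by their image under \<open>\<pi>\<close> makes the list of results the same for every
  \<open>\<pi>\<close>.\<close>

lemma sym_tensor_site_sum:
  "sym_tensor Y ** site_sum X = (\<Sum>b\<in>UNIV. sym_tensor (Y(b := Y b ** X)))"
proof -
  have "tensor (Y \<circ> \<pi>) ** site_sum X = (\<Sum>b\<in>UNIV. tensor (Y(b := Y b ** X) \<circ> \<pi>))"
    if "\<pi> \<in> perms" for \<pi>
  proof -
    have pi: "bij \<pi>" using that by (simp add: perms_iff)
    have "tensor (Y \<circ> \<pi>) ** site_sum X = (\<Sum>k\<in>UNIV. tensor ((Y \<circ> \<pi>)(k := Y (\<pi> k) ** X)))"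
      by (simp add: site_sum_def mult_sum_right tensor_site)
    also have "\<dots> = (\<Sum>k\<in>UNIV. tensor (Y(\<pi> k := Y (\<pi> k) ** X) \<circ> \<pi>))"
      by (intro sum.cong refl arg_cong[of _ _ tensor])
        (use pi in \<open>auto simp: fun_eq_iff bij_is_inj inj_eq\<close>)
    also have "\<dots> = (\<Sum>b\<in>UNIV. tensor (Y(b := Y b ** X) \<circ> \<pi>))"
      by (rule sum.reindex_bij_betw[OF pi, of "\<lambda>b. tensor (Y(b := Y b ** X) \<circ> \<pi>)"])
    finally show ?thesis .
  qed
  then have "sym_tensor Y ** site_sum X = (\<Sum>\<pi>\<in>perms. \<Sum>b\<in>UNIV. tensor (Y(b := Y b ** X) \<circ> \<pi>))"
    by (simp add: sym_tensor_def mult_sum_left)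
  then show ?thesis by (simp add: sym_tensor_def sum.swap[of _ UNIV])
qed

text \<open>Newton's identities in operator form: multiplying a symmetric tensor with one nontrivial
  factor fewer by a power sum gives a positive multiple of the desired tensor plus
  symmetric tensors with fewer nontrivial factors.\<close>
lemma sym_tensor_commute:
  fixes A :: "'d::finite cmat set" and Q :: "('n::finite \<Rightarrow> 'd) cmat"
  assumes A: "von_neumann_algebra A" and Q: "Q \<in> commutant (tensor_power ` gauge_group A)"
    and "\<And>k. Y k \<in> commutant A"
  shows "sym_tensor Y \<in> commutant {Q}"
  using assms(3)
proof (induction "card {k. Y k \<noteq> mat 1}" arbitrary: Y rule: less_induct)
  case less
  note sub = subspace_commutant[of "{Q}"]
  show ?case
  proof (cases "\<exists>a. Y a \<noteq> mat 1")
    case False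
    then have "sym_tensor Y = real (card (perms :: ('n \<Rightarrow> 'n) set)) *\<^sub>R mat 1"
      by (simp add: sym_tensor_def o_def tensor_mat_1 sum_constant_scaleR del: sum_constant)
    then show ?thesis
      by (simp add: scaleR_eq_cscale cmat.subspace_scale[OF sub] mat_1_in_commutant)
  next
    case True
    then obtain a where a: "Y a \<noteq> mat 1" by blast
    define Y0 where "Y0 = Y(a := mat 1)"
    define T where "T = {k. Y k \<noteq> mat 1} - {a}"
    have Y0T: "{k. Y0 k \<noteq> mat 1} = T" by (auto simp: Y0_def T_def)
    have Y0: "Y0 k \<in> commutant A" for k using less.prems by (simp add: Y0_def mat_1_in_commutant)
    have Y: "{k. Y k \<noteq> mat 1} = insert a T" using a by (auto simp: T_def)
    have card: "card {k. Y k \<noteq> mat 1} = Suc (card T)" unfolding Y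
      by (rule card_insert_disjoint) (auto simp: T_def)
    let ?U = "\<lambda>b. sym_tensor (Y0(b := Y0 b ** Y a))"
    have in_T: "?U b \<in> commutant {Q}" if b: "b \<in> T" for b
    proof (rule less.hyps)
      have "{k. (Y0(b := Y0 b ** Y a)) k \<noteq> mat 1} \<subseteq> T" using b Y0T by auto
      then have "card {k. (Y0(b := Y0 b ** Y a)) k \<noteq> mat 1} \<le> card T" by (intro card_mono) auto
      then show "card {k. (Y0(b := Y0 b ** Y a)) k \<noteq> mat 1} < card {k. Y k \<noteq> mat 1}"
        by (simp add: card)
      show "(Y0(b := Y0 b ** Y a)) k \<in> commutant A" for k
        using Y0 less.prems by (simp add: mult_in_commutant)
    qed
    \<comment> \<open>Outside \<open>T\<close> the slot of \<open>Y0\<close> holds the identity, so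
      \<open>Y a\<close> is merely placed at \<open>b\<close> instead of \<open>a\<close>, and the
      symmetric tensor does not see this transposition.\<close>
    have notin_T: "?U b = sym_tensor Y" if b: "b \<in> - T" for b
    proof -
      have 1: "Y0 b = mat 1" using b Y0T by auto
      have "Y0(b := Y a) = Y \<circ> Transposition.transpose a b"
        using b by (auto simp: fun_eq_iff Y0_def T_def Transposition.transpose_def)
      then have "?U b = sym_tensor (Y \<circ> Transposition.transpose a b)" by (simp add: 1)
      also have "\<dots> = sym_tensor Y"
        by (rule sym_tensor_comp) (rule involuntory_imp_bij, simp)
      finally show ?thesis .
    qed
    have "sym_tensor Y0 ** site_sum (Y a) = (\<Sum>b\<in>T. ?U b) + (\<Sum>b\<in>- T. ?U b)"
      unfolding sym_tensor_site_sum by (subst sum.union_disjoint[symmetric]) (auto intro: sum.cong)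
    also have "(\<Sum>b\<in>- T. ?U b) = real (card (- T)) *\<^sub>R sym_tensor Y"
      using notin_T by (simp add: sum_constant_scaleR del: sum_constant)
    finally have sum: "sym_tensor Y0 ** site_sum (Y a)
        = (\<Sum>b\<in>T. ?U b) + real (card (- T)) *\<^sub>R sym_tensor Y" .
    have eq: "real (card (- T)) *\<^sub>R sym_tensor Y
        = sym_tensor Y0 ** site_sum (Y a) - (\<Sum>b\<in>T. ?U b)"
      unfolding sum by (rule add_diff_cancel_left'[symmetric])
    have "sym_tensor Y0 \<in> commutant {Q}"
      using Y0 by (intro less.hyps) (simp_all add: Y0T card)
    moreover have "site_sum (Y a) \<in> commutant {Q}"
      using less.prems by (intro site_sum_commute[OF A Q])
    ultimately have "real (card (- T)) *\<^sub>R sym_tensor Y \<in> commutant {Q}"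
      unfolding eq using in_T
      by (intro cmat.subspace_diff[OF sub] cmat.subspace_sum[OF sub] mult_in_commutant)
    then have "cscale (1 / of_nat (card (- T))) (real (card (- T)) *\<^sub>R sym_tensor Y) \<in> commutant {Q}"
      by (rule cmat.subspace_scale[OF sub])
    \<comment> \<open>The site \<open>a\<close> lies outside \<open>T\<close>, so division by the
      multiplicity is allowed.\<close>
    moreover have "card (- T) \<noteq> 0"
      by (auto simp: T_def)
    ultimately show ?thesis by (simp add: scaleR_eq_cscale)
  qed
qed

text \<open>A permutation invariant operator is a multiple of its own symmetrization, which is a
  combination of symmetric tensors.\<close>

lemma symmetric_tensor_commute:
  fixes A :: "'d::finite cmat set" and Q Y :: "('n::finite \<Rightarrow> 'd) cmat"
  assumes A: "von_neumann_algebra A" and Q: "Q \<in> commutant (tensor_power ` gauge_group A)"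
    and Y: "Y \<in> algebra_power (commutant A)"
    and sym: "\<And>\<pi>. bij \<pi> \<Longrightarrow> perm_op \<pi> ** Y = Y ** perm_op \<pi>"
  shows "Y \<in> commutant {Q}"
proof -
  have "symmetrize Y \<in> commutant {Q}"
    by (rule cscale_linear_image_span[OF cscale_linear_symmetrize subspace_commutant _
          Y[unfolded algebra_power_def]])
      (auto simp: symmetrize_tensor intro!: sym_tensor_commute[OF A Q])
  then have "cscale (1 / of_nat (card (perms :: ('n \<Rightarrow> 'n) set))) (symmetrize Y) \<in> commutant {Q}"
    by (rule cmat.subspace_scale[OF subspace_commutant])
  then show ?thesis
    by (simp add: symmetrize_eq_scaleR[OF sym] scaleR_eq_cscale perms_nonempty)
qed

text \<open>Such an operator is fixed by applying the projection onto the commutant of \<open>A\<close> in every factor.\<close>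
lemma commutant_sites:
  fixes A :: "'d::finite cmat set" and Y :: "('n::finite \<Rightarrow> 'd) cmat"
  assumes Y: "\<And>k X. X \<in> A \<Longrightarrow> site k X ** Y = Y ** site k X"
  shows "Y \<in> algebra_power (commutant A)"
proof -
  let ?T = "orth_proj (commutant A)"
  have lin: "Vector_Spaces.linear cscale cscale ?T"
    by (rule cscale_linear_orth_proj) (rule subspace_commutant)
  have prod_mat_1: "(\<Prod>j\<in>S. (mat 1 :: 'd cmat) $ f j $ h j) = (if \<forall>j\<in>S. f j = h j then 1 else 0)"
    if "finite S" for S and f h :: "'n \<Rightarrow> 'd"
    using that by (induction S) (auto simp: mat_nth)
  have site_nth: "site k X $ f(k := i) $ h = (if h = f(k := h k) then X $ i $ h k else 0)" for k X i and f h :: "'n \<Rightarrow> 'd"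
  proof -
    have "(\<Prod>j\<in>UNIV - {k}. (mat 1 :: 'd cmat) $ f j $ h j) = (if h = f(k := h k) then 1 else 0)"
      unfolding prod_mat_1[OF finite] by (auto simp: fun_eq_iff)
    moreover have "(\<Prod>j\<in>UNIV - {k}. (mat 1 :: 'd cmat) $ (f(k := i)) j $ h j)
        = (\<Prod>j\<in>UNIV - {k}. (mat 1 :: 'd cmat) $ f j $ h j)"
      by (intro prod.cong) auto
    ultimately show ?thesis unfolding site_def tensor_upd_nth by simp
  qed
  have site_nth': "site k X $ h $ g(k := j) = (if h = g(k := h k) then X $ h k $ j else 0)" for k X j and g h :: "'n \<Rightarrow> 'd"
  proof -
    have "(\<Prod>m\<in>UNIV - {k}. (mat 1 :: 'd cmat) $ h m $ g m) = (if h = g(k := h k) then 1 else 0)"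
      unfolding prod_mat_1[OF finite] by (auto simp: fun_eq_iff)
    moreover have "(\<Prod>m\<in>UNIV - {k}. (mat 1 :: 'd cmat) $ h m $ (g(k := j)) m)
        = (\<Prod>m\<in>UNIV - {k}. (mat 1 :: 'd cmat) $ h m $ g m)"
      by (intro prod.cong) auto
    ultimately show ?thesis unfolding site_def tensor_upd_nth by simp
  qed
  \<comment> \<open>The condition says that \<open>h\<close> agrees with \<open>f\<close> away from
    \<open>k\<close>; such functions are parametrized by their value at \<open>k\<close>.\<close>
  have reindex: "(\<Sum>h\<in>UNIV. if h = f(k := h k) then F h else 0) = (\<Sum>l\<in>UNIV. F (f(k := l)))"
    for F :: "('n \<Rightarrow> 'd) \<Rightarrow> complex" and f k
  proof -
    have "(\<Sum>h\<in>UNIV. if h = f(k := h k) then F h else 0) = (\<Sum>h\<in>{h. h = f(k := h k)}. F h)"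
      by (simp add: sum.If_cases)
    also have "\<dots> = (\<Sum>l\<in>UNIV. F (f(k := l)))"
      by (rule sum.reindex_bij_witness[of _ "\<lambda>l. f(k := l)" "\<lambda>h. h k"]) auto
    finally show ?thesis .
  qed
  \<comment> \<open>Commuting with \<open>site k X\<close>, read on one block, is commuting of that
    block with \<open>X\<close>.\<close>
  have "slice k f g Y \<in> commutant A" for k f g
    unfolding commutant_def
  proof safe
    fix X assume X: "X \<in> A"
    show "X ** slice k f g Y = slice k f g Y ** X"
    proof (rule cmat_eqI)
      fix i j
      have "(site k X ** Y) $ f(k := i) $ g(k := j) = (X ** slice k f g Y) $ i $ j"
        unfolding matrix_mult_nth site_nth
        using reindex[of f k "\<lambda>h. X $ i $ h k * Y $ h $ g(k := j)"]
        by (simp add: slice_nth if_distrib if_distribR cong: if_cong)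
      moreover have "(Y ** site k X) $ f(k := i) $ g(k := j) = (slice k f g Y ** X) $ i $ j"
        unfolding matrix_mult_nth site_nth'
        using reindex[of g k "\<lambda>h. Y $ f(k := i) $ h * X $ h k $ j"]
        by (simp add: slice_nth if_distrib if_distribR cong: if_cong)
      ultimately show "(X ** slice k f g Y) $ i $ j = (slice k f g Y ** X) $ i $ j"
        using Y[OF X] by simp
    qed
  qed
  then have "at_site ?T k Y = Y" for k
    by (intro at_site_eq_self orth_proj_id cmat_subspace_imp_subspace subspace_commutant)
  then have "tensor_map ?T Y = Y"
    using tensor_map_induct[OF lin, of "\<lambda>F. F Y = Y"] by simp
  moreover have "tensor_map ?T Y \<in> algebra_power (commutant A)"
    unfolding tensor_map_def
    by (intro cmat.subspace_sum cmat.subspace_scale subspace_algebra_power tensor_in_algebra_power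
        orth_proj_in cmat_subspace_imp_subspace subspace_commutant)
  ultimately show ?thesis by simp
qed

text \<open>An operator commuting with all of \<open>?S\<close> lies in the power of the commutant
  of \<open>A\<close>, because it commutes with the single-site operators, and it is permutation
  invariant; hence it commutes with \<open>Q\<close>. The double commutant theorem then places
  \<open>Q\<close> in the span of \<open>?S\<close>, and the projections on both sides absorb the
  permutations.\<close>

theorem schur_weyl_gauge:
  fixes A :: "'d::finite cmat set" and Q :: "('n::finite \<Rightarrow> 'd) cmat"
  assumes A: "von_neumann_algebra A" and Q: "Q \<in> commutant (tensor_power ` gauge_group A)"
  shows "\<exists>R\<in>algebra_power A. (\<forall>\<pi>. bij \<pi> \<longrightarrow> perm_op \<pi> ** R = R ** perm_op \<pi>) \<and>
    sym_proj ** Q ** sym_proj = R ** sym_proj"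
proof -
  let ?S = "{tensor X ** perm_op \<pi> | (X :: 'n \<Rightarrow> 'd cmat) \<pi>. (\<forall>k. X k \<in> A) \<and> bij \<pi>}"
  have one: "mat 1 \<in> A" and mult: "\<And>X Y. X \<in> A \<Longrightarrow> Y \<in> A \<Longrightarrow> X ** Y \<in> A"
    and dag: "\<And>X. X \<in> A \<Longrightarrow> dagger X \<in> A"
    using A by (auto simp: von_neumann_algebra_def)
  have gen: "tensor X ** perm_op \<pi> \<in> ?S" if "\<And>k. X k \<in> A" "bij \<pi>" for X \<pi> using that by blast
  have "von_neumann_algebra (cmat.span ?S)"
  proof (rule von_neumann_algebra_span)
    show "mat 1 \<in> ?S"
      using gen[of "\<lambda>_. mat 1" id] one by (simp add: tensor_mat_1 perm_op_id)
    show "X ** Y \<in> ?S" if XY: "X \<in> ?S" "Y \<in> ?S" for X Y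
    proof -
      from XY obtain X' \<pi> Y' \<sigma> where X: "X = tensor X' ** perm_op \<pi>" "\<And>k. X' k \<in> A" "bij \<pi>"
        and Y: "Y = tensor Y' ** perm_op \<sigma>" "\<And>k. Y' k \<in> A" "bij \<sigma>" by blast
      have "X ** Y = tensor X' ** (perm_op \<pi> ** tensor Y') ** perm_op \<sigma>"
        by (simp add: X Y matrix_mul_assoc)
      also have "\<dots> = tensor X' ** tensor (Y' \<circ> inv \<pi>) ** (perm_op \<pi> ** perm_op \<sigma>)"
        by (simp add: perm_op_tensor[OF X(3)] matrix_mul_assoc)
      also have "\<dots> = tensor (\<lambda>k. X' k ** Y' (inv \<pi> k)) ** perm_op (\<pi> \<circ> \<sigma>)"
        by (simp add: tensor_mult perm_op_comp)
      also have "\<dots> \<in> ?S" by (intro gen mult X Y bij_comp)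
      finally show ?thesis .
    qed
    show "dagger X \<in> ?S" if X: "X \<in> ?S" for X
    proof -
      from X obtain X' \<pi> where X: "X = tensor X' ** perm_op \<pi>" "\<And>k. X' k \<in> A" "bij \<pi>" by blast
      have "dagger X = perm_op (inv \<pi>) ** tensor (\<lambda>k. dagger (X' k))"
        by (simp add: X dagger_mult dagger_perm_op dagger_tensor)
      also have "\<dots> = tensor ((\<lambda>k. dagger (X' k)) \<circ> inv (inv \<pi>)) ** perm_op (inv \<pi>)"
        by (rule perm_op_tensor[OF bij_imp_bij_inv[OF X(3)]])
      also have "\<dots> \<in> ?S" by (intro gen bij_imp_bij_inv X) (simp add: dag X)
      finally show ?thesis .
    qed
  qed
  moreover have "Q \<in> commutant (commutant (cmat.span ?S))"
    unfolding commutant_span commutant_def[of "commutant _"]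
  proof safe
    fix Y assume Y: "Y \<in> commutant ?S"
    have "site k X ** Y = Y ** site k X" if "X \<in> A" for k X
      using commutantD[OF Y gen[of "(\<lambda>_. mat 1)(k := X)" id]] that one
      by (simp add: site_def perm_op_id)
    then have "Y \<in> algebra_power (commutant A)" by (rule commutant_sites)
    moreover have "perm_op \<pi> ** Y = Y ** perm_op \<pi>" if "bij \<pi>" for \<pi>
      using commutantD[OF Y gen[of "\<lambda>_. mat 1" \<pi>]] that one by (simp add: tensor_mat_1)
    ultimately have "Y \<in> commutant {Q}" by (intro symmetric_tensor_commute[OF A Q])
    then show "Y ** Q = Q ** Y" by (simp add: commutant_def)
  qed
  ultimately have QS: "Q \<in> cmat.span ?S" by (rule double_commutant)
  have linP: "Vector_Spaces.linear cscale cscale (\<lambda>X. sym_proj ** X ** (sym_proj :: ('n \<Rightarrow> 'd) cmat))"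
    by unfold_locales (simp_all add: matrix_add_ldistrib mult_add_left cscale_mult_right cscale_mult_left)
  interpret P: Vector_Spaces.linear cscale cscale "\<lambda>X. sym_proj ** X ** (sym_proj :: ('n \<Rightarrow> 'd) cmat)"
    by (rule linP)
  let ?W = "(\<lambda>X. sym_proj ** X ** sym_proj) ` (algebra_power A :: ('n \<Rightarrow> 'd) cmat set)"
  have "sym_proj ** Q ** sym_proj \<in> ?W"
  proof (rule cscale_linear_image_span[OF linP _ _ QS])
    show "cmat.subspace ?W" by (rule P.subspace_image[OF subspace_algebra_power])
    fix Y assume "Y \<in> ?S"
    then obtain X \<pi> where X: "Y = tensor X ** perm_op \<pi>" "\<And>k. X k \<in> A" "bij \<pi>" by blast
    have "sym_proj ** Y ** sym_proj = sym_proj ** tensor X ** (perm_op \<pi> ** sym_proj)"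
      by (simp add: X(1) matrix_mul_assoc)
    also have "\<dots> = sym_proj ** tensor X ** sym_proj" by (simp add: perm_op_sym_proj X)
    finally show "sym_proj ** Y ** sym_proj \<in> ?W"
      by (rule image_eqI) (intro tensor_in_algebra_power X)
  qed
  then obtain X where X: "X \<in> algebra_power A" "sym_proj ** Q ** sym_proj = sym_proj ** X ** sym_proj"
    by blast
  \<comment> \<open>Averaging over the permutations makes the operator invariant without changing
    its compression.\<close>
  define R where "R = (1 / real (card (perms :: ('n \<Rightarrow> 'n) set))) *\<^sub>R symmetrize X"
  have "R \<in> algebra_power A"
    unfolding R_def scaleR_eq_cscale
    by (intro cmat.subspace_scale subspace_algebra_power symmetrize_algebra_power X)
  moreover have "perm_op \<pi> ** R = R ** perm_op \<pi>" if "bij \<pi>" for \<pi>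
    by (simp add: R_def scaleR_mult_left scaleR_mult_right perm_op_symmetrize[OF that])
  moreover have "R ** sym_proj = sym_proj ** X ** sym_proj"
  proof -
    have "symmetrize X ** sym_proj = (\<Sum>\<pi>\<in>perms. perm_op \<pi> ** X ** (perm_op (inv \<pi>) ** sym_proj))"
      by (simp add: symmetrize_def mult_sum_left matrix_mul_assoc)
    also have "\<dots> = (\<Sum>\<pi>\<in>perms. perm_op \<pi> ** (X ** sym_proj))"
      by (intro sum.cong refl)
        (simp add: perm_op_sym_proj perms_iff bij_imp_bij_inv matrix_mul_assoc)
    also have "\<dots> = (\<Sum>\<pi>\<in>perms. perm_op \<pi>) ** (X ** sym_proj)" by (simp add: mult_sum_left)
    finally have "R ** sym_proj = sym_proj ** (X ** sym_proj)"
      by (simp add: R_def sym_proj_def[where 'd = 'd] scaleR_mult_left)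
    then show ?thesis by (simp add: matrix_mul_assoc)
  qed
  ultimately show ?thesis using X(2) by (intro bexI[of _ R]) simp_all
qed

section \<open>A positive section of the compression to an invariant subspace\<close>

lemma Re_cinner_eq_inner: "Re (cinner u v) = u \<bullet> v"
  by (simp add: cinner_def inner_vec_def inner_complex_def)

lemma positive_op_if_hermitian:
  assumes "dagger X = X" and "\<And>v. 0 \<le> Re (cinner v (X *v v))"
  shows "positive_op X"
proof -
  have "cinner v (X *v v) = cnj (cinner v (X *v v))" for v
    by (subst (2) cinner_commute) (simp add: cinner_adjoint[of v X v] assms(1))
  then have "Im (cinner v (X *v v)) = 0" for v
    by (metis Reals_cnj_iff complex_is_Real_iff)
  then show ?thesis using assms(2) by (simp add: positive_op_def complex_nonneg_Reals_iff)
qed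

lemma positive_op_gram: "positive_op (X ** dagger X)"
  using positive_op_conjugate[OF positive_op_mat_1, of X] by simp

text \<open>A crude constant suffices: the uses below only need some bound, for integrability or for
  powers whose growth is compared with a constant.\<close>

lemma norm_cmat_le_entries:
  fixes X :: "'a::finite cmat"
  assumes e: "\<And>i j. norm (X $ i $ j) \<le> c"
  shows "norm X \<le> real CARD('a) * (real CARD('a) * c)"
proof -
  have l1: "norm x \<le> (\<Sum>i\<in>UNIV. norm (x $ i))" for x :: "'b::real_normed_vector ^ 'a"
    unfolding norm_vec_def by (rule L2_set_le_sum) simp
  have "norm X \<le> (\<Sum>i\<in>UNIV. norm (X $ i))" by (rule l1)
  also have "\<dots> \<le> (\<Sum>i\<in>UNIV. \<Sum>j\<in>UNIV. norm (X $ i $ j))" by (intro sum_mono l1)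
  also have "\<dots> \<le> (\<Sum>i\<in>(UNIV :: 'a set). \<Sum>j\<in>(UNIV :: 'a set). c)" by (intro sum_mono e)
  finally show ?thesis by simp
qed

lemma norm_cmat_le:
  fixes X :: "'a::finite cmat"
  assumes "\<And>v. norm (X *v v) \<le> c * norm v"
  shows "norm X \<le> real CARD('a) * (real CARD('a) * c)"
proof (rule norm_cmat_le_entries)
  fix i j
  have "norm (X $ i $ j) \<le> norm (X *v axis j 1)"
    by (metis cinner_axis cinner_axis_mult_axis Finite_Cartesian_Product.norm_nth_le)
  also have "\<dots> \<le> c" using assms[of "axis j 1"] by simp
  finally show "norm (X $ i $ j) \<le> c" .
qed

lemma norm_mult_vec_bounded:
  "\<exists>c>0. \<forall>(X :: 'a::finite cmat) v. norm (X *v v) \<le> norm X * norm v * c"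
proof -
  have "bilinear ((*v) :: 'a cmat \<Rightarrow> complex^'a \<Rightarrow> complex^'a)"
    unfolding bilinear_def
    by (intro conjI allI linearI)
      (simp_all add: matrix_vector_right_distrib matrix_vector_mult_add_rdistrib
        vec_eq_iff matrix_vector_mult_def scaleR_sum_right distrib_left distrib_right sum.distrib)
  then have "bounded_bilinear ((*v) :: 'a cmat \<Rightarrow> complex^'a \<Rightarrow> complex^'a)"
    by (rule bilinear_conv_bounded_bilinear[THEN iffD1])
  from bounded_bilinear.pos_bounded[OF this] show ?thesis by blast
qed

text \<open>This is \<open>X\<close> to the power \<open>2 ^ j\<close>.\<close>

definition iter_square :: "nat \<Rightarrow> 'a::finite cmat \<Rightarrow> 'a cmat"
  where "iter_square j = (\<lambda>X. X ** X) ^^ j"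

lemma iter_square_Suc: "iter_square (Suc j) X = iter_square j X ** iter_square j X"
  by (simp add: iter_square_def)

lemma iter_square_0: "iter_square 0 X = X"
  by (simp add: iter_square_def)

text \<open>A spectral radius argument without a spectrum: the growth ratio \<open>r\<close> on a
  vector at least squares at each step, so any ratio above 1 would exceed every constant
  \<open>C\<close>.\<close>

lemma norm_hermitian_le_if_powers_bounded:
  assumes h: "dagger h = h" and C: "\<And>j v. norm (iter_square j h *v v) \<le> C * norm v"
  shows "norm (h *v v) \<le> norm v"
proof (cases "v = 0")
  case False
  define r where "r j = norm (iter_square j h *v v) / norm v" for j
  have hj: "dagger (iter_square j h) = iter_square j h" for j
    by (induction j) (simp_all add: iter_square_Suc iter_square_0 dagger_mult h)
  \<comment> \<open>For a hermitian operator the squared norm of the image of \<open>v\<close> is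
    the pairing of \<open>v\<close> with its image under the square; then Cauchy-Schwarz.\<close>
  have "(r j)\<^sup>2 \<le> r (Suc j)" for j
  proof -
    let ?x = "iter_square j h *v v"
    have "of_real ((norm ?x)\<^sup>2) = cinner v (iter_square (Suc j) h *v v)"
      unfolding cinner_self[symmetric] iter_square_Suc matrix_vector_mul_assoc[symmetric]
      by (simp add: cinner_adjoint[of v "iter_square j h"] hj)
    then have "(norm ?x)\<^sup>2 = norm (cinner v (iter_square (Suc j) h *v v))"
      by (metis abs_of_nonneg norm_of_real zero_le_power2)
    also have "\<dots> \<le> norm v * norm (iter_square (Suc j) h *v v)" by (rule norm_cinner_le)
    finally show ?thesis using False by (simp add: r_def power_divide power2_eq_square field_simps)
  qed
  moreover have "0 \<le> r j" for j by (simp add: r_def)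
  ultimately have pow: "r 0 ^ (2 ^ j) \<le> r j" for j
  proof (induction j)
    case (Suc j)
    have "r 0 ^ (2 ^ Suc j) = (r 0 ^ (2 ^ j))\<^sup>2" by (simp add: power_mult[symmetric] mult.commute)
    also have "\<dots> \<le> (r j)\<^sup>2" using Suc by (intro power_mono) auto
    also have "\<dots> \<le> r (Suc j)" by (rule Suc)
    finally show ?case .
  qed simp
  have "r 0 \<le> 1"
  proof (rule ccontr)
    assume "\<not> r 0 \<le> 1"
    then obtain n where n: "C < r 0 ^ n" using real_arch_pow[of "r 0" C] by auto
    also have "r 0 ^ n \<le> r 0 ^ (2 ^ n)"
      using \<open>\<not> r 0 \<le> 1\<close> by (intro power_increasing) (auto intro: less_imp_le)
    also have "\<dots> \<le> r n" by (rule pow)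
    also have "\<dots> \<le> C" using C[of n v] False by (simp add: r_def field_simps)
    finally show False by simp
  qed
  then show ?thesis using False by (simp add: r_def iter_square_0 field_simps)
qed simp

text \<open>The kernel \<open>J\<close> of the compression is an ideal, so its orthocomplement \<open>K\<close> is a complementary
  ideal on which the compression is an injective *-homomorphism, hence isometric on hermitian
  elements and positive in both directions.\<close>
lemma positive_section:
  fixes B :: "'a::finite cmat set"
  assumes B: "von_neumann_algebra B"
    and P: "P ** P = P" "dagger P = P" and comm: "\<And>R. R \<in> B \<Longrightarrow> P ** R = R ** P"
  shows "\<exists>g. linear g \<and> positive_op (mat 1 - g P) \<and>
    (\<forall>R\<in>B. g (R ** P) \<in> B \<and> g (R ** P) ** P = R ** P \<and>
      (positive_op (R ** P) \<longrightarrow> positive_op (g (R ** P))))"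
proof -
  have csub: "cmat.subspace B" and one: "mat 1 \<in> B"
    and mult: "\<And>X Y. X \<in> B \<Longrightarrow> Y \<in> B \<Longrightarrow> X ** Y \<in> B"
    and dag: "\<And>X. X \<in> B \<Longrightarrow> dagger X \<in> B"
    using B by (auto simp: von_neumann_algebra_def)
  have sub: "subspace B" using csub by (rule cmat_subspace_imp_subspace)
  define J where "J = {R \<in> B. R ** P = 0}"
  define K where "K = {R \<in> B. \<forall>S\<in>J. R \<bullet> S = 0}"
  have subJ: "subspace J"
    using sub unfolding J_def subspace_def by (auto simp: mult_add_left scaleR_mult_left)
  have subK: "subspace K"
    using sub unfolding K_def subspace_def by (auto simp: inner_add_left)
  have KB: "R \<in> B" if "R \<in> K" for R using that by (simp add: K_def)
  have inj: "R = 0" if "R \<in> K" "R ** P = 0" for R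
  proof -
    have "R \<in> J" using that KB by (simp add: J_def)
    then have "R \<bullet> R = 0" using that by (simp add: K_def)
    then show ?thesis by simp
  qed
  have inj2: "R = S" if "R \<in> K" "S \<in> K" "R ** P = S ** P" for R S
    using inj[of "R - S"] that subK by (simp add: mult_diff_left subspace_diff)
  \<comment> \<open>Multiplication crosses the inner product as multiplication by the adjoint, which
    preserves \<open>J\<close>. The other two closure properties of \<open>K\<close> follow the same
    pattern.\<close>
  have left: "S ** R \<in> K" if R: "R \<in> K" and S: "S \<in> B" for R S
  proof -
    have "dagger S ** T \<in> J" if "T \<in> J" for T
      using that S by (auto simp: J_def mult dag matrix_mul_assoc[symmetric])
    then show ?thesis using R S by (simp add: K_def mult inner_mult_left)
  qed
  have right: "R ** S \<in> K" if R: "R \<in> K" and S: "S \<in> B" for R S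
  proof -
    have "T ** dagger S \<in> J" if T: "T \<in> J" for T
    proof -
      have "T ** dagger S ** P = T ** P ** dagger S"
        using comm[OF dag[OF S]] by (simp add: matrix_mul_assoc[symmetric])
      then show ?thesis using T S by (simp add: J_def mult dag)
    qed
    then show ?thesis using R S by (simp add: K_def mult inner_mult_right)
  qed
  have dagK: "dagger R \<in> K" if R: "R \<in> K" for R
  proof -
    have "dagger T \<in> J" if T: "T \<in> J" for T
    proof -
      have "dagger T ** P = dagger (P ** T)" by (simp add: dagger_mult P)
      also have "P ** T = 0" using T comm by (simp add: J_def)
      finally show ?thesis using T by (simp add: J_def dag)
    qed
    then show ?thesis using R dag inner_dagger[of R "dagger _"] by (auto simp: K_def)
  qed
  have lift: "\<exists>S\<in>K. S ** P = R ** P" if R: "R \<in> B" for R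
  proof (intro bexI)
    have J: "orth_proj J R \<in> J" by (rule orth_proj_in[OF subJ])
    then show "(R - orth_proj J R) ** P = R ** P" by (simp add: mult_diff_left J_def)
    show "R - orth_proj J R \<in> K"
      using J R sub inner_orth_proj[OF subJ, of _ R]
      by (auto simp: K_def inner_diff_left J_def subspace_diff)
  qed
  have "inj_on (\<lambda>X. X ** P) K" by (rule inj_onI) (rule inj2)
  \<comment> \<open>Inverse of the compression on \<open>K\<close>, extended linearly to all
    matrices; only its values on compressions of elements of \<open>B\<close> matter.\<close>
  then obtain g where g: "linear g" and gP: "\<And>R. R \<in> K \<Longrightarrow> g (R ** P) = R"
    using linear_exists_left_inverse_on[OF linear_mult_left[of P] subK] by blast
  have hermK: "dagger R = R" if R: "R \<in> K" and A: "dagger (R ** P) = R ** P" for R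
  proof (rule inj2[OF dagK[OF R] R])
    show "dagger R ** P = R ** P"
      using A comm[OF dag[OF KB[OF R]]] by (simp add: dagger_mult P)
  qed
  \<comment> \<open>Compression is multiplicative, so the iterated squares of \<open>h\<close> come
    from those of the contraction \<open>h ** P\<close> by applying \<open>g\<close>. Continuity of
    \<open>g\<close> bounds all of them by one constant, which the power argument improves to
    1.\<close>
  have bound: "norm (h *v v) \<le> norm v"
    if h: "h \<in> K" and dh: "dagger h = h" and le: "\<And>v. norm ((h ** P) *v v) \<le> norm v" for h v
  proof -
    obtain c where c: "0 < c" "\<And>(X :: 'a cmat) v. norm (X *v v) \<le> norm X * norm v * c"
      using norm_mult_vec_bounded by blast
    obtain C where C: "0 < C" "\<And>X. norm (g X) \<le> C * norm X"
      using linear_bounded_pos[OF g] by blast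
    have hK: "iter_square j h \<in> K" for j
      by (induction j) (simp_all add: iter_square_Suc iter_square_0 h left KB)
    have hP: "iter_square j h ** P = iter_square j (h ** P)" for j
    proof (induction j)
      case (Suc j)
      have "iter_square (Suc j) h ** P = iter_square j h ** (iter_square j h ** P) ** P"
        using P(1) by (simp add: iter_square_Suc matrix_mul_assoc[symmetric])
      also have "\<dots> = iter_square j h ** (P ** iter_square j h) ** P"
        by (simp only: comm[OF KB[OF hK[of j]]])
      also have "\<dots> = iter_square j h ** P ** (iter_square j h ** P)"
        by (simp only: matrix_mul_assoc)
      finally show ?case by (simp add: Suc iter_square_Suc)
    qed (simp add: iter_square_0)
    have le': "norm (iter_square j (h ** P) *v v) \<le> 1 * norm v" for j v
    proof (induction j arbitrary: v)
      case (Suc j)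
      then show ?case
        using order_trans[OF Suc[of "iter_square j (h ** P) *v v"], of "1 * norm v"]
        by (simp add: iter_square_Suc matrix_vector_mul_assoc[symmetric])
    qed (simp add: iter_square_0 le)
    let ?N = "real CARD('a) * (real CARD('a) * 1)"
    have "norm (iter_square j h *v v) \<le> C * ?N * c * norm v" for j v
    proof -
      have "norm (iter_square j h) = norm (g (iter_square j (h ** P)))"
        using gP[OF hK[of j]] by (simp add: hP)
      also have "\<dots> \<le> C * norm (iter_square j (h ** P))" by (rule C)
      also have "\<dots> \<le> C * ?N" using C(1) norm_cmat_le[OF le'] by (intro mult_left_mono) auto
      finally have "norm (iter_square j h) * norm v * c \<le> C * ?N * norm v * c"
        using c(1) by (intro mult_right_mono) auto
      with c(2)[of "iter_square j h" v] show ?thesis by (simp add: mult_ac)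
    qed
    then show ?thesis by (rule norm_hermitian_le_if_powers_bounded[OF dh])
  qed
  \<comment> \<open>The lift of the identity is the unit of the ideal \<open>K\<close>, and
    \<open>mat 1 - z\<close> is the unit of the kernel \<open>J\<close>.\<close>
  obtain z where z: "z \<in> K" "z ** P = P" using lift[OF one] by auto
  have gz: "g P = z" using gP[OF z(1)] z(2) by simp
  have dz: "dagger z = z" using hermK[OF z(1)] by (simp add: z P)
  have zR: "z ** R = R" if R: "R \<in> K" for R
  proof (rule inj2[OF left[OF R KB[OF z(1)]] R])
    have "z ** R ** P = z ** P ** R" using comm[OF KB[OF R]] by (simp add: matrix_mul_assoc[symmetric])
    then show "z ** R ** P = R ** P" by (simp add: z comm[OF KB[OF R]])
  qed
  have Rz: "R ** z = R" if R: "R \<in> K" for R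
    by (rule inj2[OF left[OF z(1) KB[OF R]] R]) (simp add: matrix_mul_assoc[symmetric] z)
  \<comment> \<open>Positivity is turned into a norm bound: for small \<open>t > 0\<close> the
    compression of \<open>z - t *\<^sub>R R\<close> is a contraction, so by \<open>bound\<close> the
    operator itself is one. Its form is therefore at most that of the identity, which leaves the
    form of \<open>R\<close> nonnegative.\<close>
  have pos: "positive_op R" if R: "R \<in> K" and A: "positive_op (R ** P)" for R
  proof -
    define A where "A = R ** P"
    have dR: "dagger R = R" using hermK[OF R] hermitian_if_positive[OF that(2)] by blast
    have posA: "positive_op A" using A_def that(2) by simp
    have dA: "dagger A = A" using posA by (rule hermitian_if_positive)
    have PA: "P ** A = A"
      unfolding A_def by (metis P(1) comm[OF KB[OF R]] matrix_mul_assoc)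
    obtain c where c: "0 < c" "\<And>(X :: 'a cmat) v. norm (X *v v) \<le> norm X * norm v * c"
      using norm_mult_vec_bounded by blast
    define C where "C = norm A * c"
    have C: "0 \<le> C" "norm (A *v v) \<le> C * norm v" for v
      using c by (simp_all add: C_def mult_ac)
    define q where "q v = Re (cinner v (A *v v))" for v
    have q: "0 \<le> q v" for v
      using posA by (simp add: q_def positive_op_def complex_nonneg_Reals_iff)
    \<comment> \<open>The operator inequality \<open>A ** A \<le> C A\<close>, from Cauchy-Schwarz
      for the form of \<open>A\<close> at \<open>A *v v\<close> and \<open>v\<close>. It lets the
      term quadratic in \<open>t\<close> be absorbed by the linear one.\<close>
    have Aq: "(norm (A *v v))\<^sup>2 \<le> C * q v" for v
    proof (cases "A *v v = 0")
      case False
      let ?u = "A *v v"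
      have "((norm ?u)\<^sup>2)\<^sup>2 = (norm (cinner ?u ?u))\<^sup>2"
        unfolding cinner_self norm_of_real by simp
      also have "\<dots> \<le> Re (cinner ?u (A *v ?u)) * q v"
        unfolding q_def by (rule positive_cauchy_schwarz[OF posA])
      also have "\<dots> \<le> (norm ?u * (C * norm ?u)) * q v"
        by (intro mult_right_mono q order_trans[OF complex_Re_le_cmod]
            order_trans[OF norm_cinner_le] mult_left_mono C(2)) simp
      finally have "(norm ?u)\<^sup>2 * (norm ?u)\<^sup>2 \<le> (norm ?u)\<^sup>2 * (C * q v)"
        by (simp add: power2_eq_square mult_ac)
      then show ?thesis by (rule mult_left_le_imp_le) (use False in simp)
    qed (simp add: C q)
    \<comment> \<open>\<open>C\<close> may vanish; the added 1 keeps the quotient defined, and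
      \<open>t * C \<le> 1\<close> still holds.\<close>
    define t where "t = 1 / (C + 1)"
    have t: "0 < t" "t * C \<le> 1" using C(1) by (auto simp: t_def)
    define h where "h = z - t *\<^sub>R R"
    have hK: "h \<in> K" using subK z(1) R by (simp add: h_def subspace_diff subspace_mul)
    have dh: "dagger h = h" by (simp add: h_def dagger_diff dagger_scaleR dz dR)
    have hP: "h ** P = P - t *\<^sub>R A"
      by (simp add: h_def mult_diff_left scaleR_mult_left z A_def)
    have "norm ((h ** P) *v v) \<le> norm v" for v
    proof -
      have Pv: "(norm (P *v v))\<^sup>2 \<le> (norm v)\<^sup>2"
      proof -
        have "(norm (P *v v))\<^sup>2 = Re (cinner v (P *v v))"
          using cinner_self[of "P *v v"] cinner_adjoint[of v P "P *v v"]
          by (simp add: P matrix_vector_mul_assoc del: of_real_power)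
        also have "\<dots> \<le> norm v * norm (P *v v)"
          by (rule order_trans[OF complex_Re_le_cmod norm_cinner_le])
        finally have "norm (P *v v) \<le> norm v"
          by (cases "P *v v = 0") (simp_all add: power2_eq_square)
        then show ?thesis by (simp add: power_mono)
      qed
      have "(P *v v) \<bullet> (A *v v) = q v"
        unfolding Re_cinner_eq_inner[symmetric] q_def
        using cinner_adjoint[of v P "A *v v"] by (simp add: P matrix_vector_mul_assoc PA)
      moreover have "(h ** P) *v v = P *v v - t *\<^sub>R (A *v v)"
        by (simp add: hP matrix_vector_mult_diff_rdistrib vec_eq_iff matrix_vector_mult_def
            scaleR_sum_right sum_subtractf algebra_simps)
      moreover have "(norm (x - t *\<^sub>R y))\<^sup>2 = (norm x)\<^sup>2 - 2 * t * (x \<bullet> y) + t\<^sup>2 * (norm y)\<^sup>2"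
        for x y :: "complex^'a"
        unfolding power2_norm_eq_inner
        by (simp add: inner_diff_left inner_diff_right inner_commute[of y x] power2_eq_square algebra_simps
            del: real_inner_class.dot_square_norm)
      ultimately have "(norm ((h ** P) *v v))\<^sup>2
          = (norm (P *v v))\<^sup>2 - 2 * t * q v + t\<^sup>2 * (norm (A *v v))\<^sup>2"
        by simp
      also have "t\<^sup>2 * (norm (A *v v))\<^sup>2 \<le> t\<^sup>2 * (C * q v)"
        by (intro mult_left_mono Aq) simp
      also have "t\<^sup>2 * (C * q v) = (t * C) * (t * q v)" by (simp add: power2_eq_square mult_ac)
      also have "\<dots> \<le> 1 * (t * q v)" using t q by (intro mult_right_mono) auto
      finally have "(norm ((h ** P) *v v))\<^sup>2 \<le> (norm (P *v v))\<^sup>2 - t * q v" by simp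
      also have "\<dots> \<le> (norm v)\<^sup>2" using Pv t q[of v] mult_nonneg_nonneg[of t "q v"] by linarith
      finally show ?thesis by (simp add: power2_le_iff_abs_le)
    qed
    note hv = bound[OF hK dh this]
    show ?thesis
    proof (rule positive_op_if_hermitian[OF dR])
      fix v
      \<comment> \<open>Since \<open>R = z ** R ** z\<close> with \<open>z\<close> hermitian,
        vectors of this form suffice; on them \<open>h\<close> acts as the identity minus
        \<open>t *\<^sub>R R\<close>.\<close>
      let ?w = "z *v v"
      have zw: "z *v ?w = ?w" by (simp add: matrix_vector_mul_assoc zR[OF z(1)])
      have "Re (cinner ?w (h *v ?w)) \<le> norm ?w * norm ?w"
        by (rule order_trans[OF complex_Re_le_cmod order_trans[OF norm_cinner_le]])
          (intro mult_left_mono hv, simp)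
      moreover have "h *v ?w = ?w - t *\<^sub>R (R *v ?w)"
      proof -
        have "h *v ?w = z *v ?w - (t *\<^sub>R R) *v ?w" by (simp add: h_def matrix_vector_mult_diff_rdistrib)
        also have "(t *\<^sub>R R) *v ?w = t *\<^sub>R (R *v ?w)"
          by (simp add: vec_eq_iff matrix_vector_mult_def scaleR_sum_right)
        finally show ?thesis by (simp add: zw)
      qed
      ultimately have "t * Re (cinner ?w (R *v ?w)) \<ge> 0"
        by (simp add: Re_cinner_eq_inner inner_diff_right power2_norm_eq_inner[symmetric] power2_eq_square)
      then have "0 \<le> Re (cinner ?w (R *v ?w))" using t(1) by (simp add: zero_le_mult_iff)
      also have "cinner ?w (R *v ?w) = cinner v (R *v v)"
        using cinner_adjoint[of v z "R *v ?w"]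
        by (simp add: dz matrix_vector_mul_assoc zR[OF R] Rz[OF R])
      finally show "0 \<le> Re (cinner v (R *v v))" .
    qed
  qed
  have "positive_op (mat 1 - g P)"
  proof -
    have "(mat 1 - z) ** dagger (mat 1 - z) = mat 1 - z"
      by (simp add: dagger_diff dz mult_diff_left mult_diff_right zR[OF z(1)])
    then show ?thesis using positive_op_gram[of "mat 1 - z"] by (simp add: gz)
  qed
  moreover have "g (R ** P) \<in> B \<and> g (R ** P) ** P = R ** P \<and>
      (positive_op (R ** P) \<longrightarrow> positive_op (g (R ** P)))" if R: "R \<in> B" for R
  proof -
    obtain S where S: "S \<in> K" "S ** P = R ** P" using lift[OF R] by blast
    then have "g (R ** P) = S" using gP by metis
    then show ?thesis using S pos[OF S(1)] KB by auto
  qed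
  ultimately show ?thesis using g by blast
qed

section \<open>Channels\<close>

lemma quantum_channelD:
  assumes "quantum_channel E"
  shows "Vector_Spaces.linear cscale cscale E" and "completely_positive E"
    and "trace (E X) = trace X"
  using assms by (auto simp: quantum_channel_def)

lemma completely_positive_imp_positive:
  assumes "completely_positive E" and "positive_op X"
  shows "positive_op (E X)"
proof -
  have "positive_block 1 (\<lambda>_ _. X)"
    using assms(2) by (simp add: positive_block_def positive_op_def)
  then have "positive_block 1 (\<lambda>_ _. E X)"
    using assms(1) unfolding completely_positive_def by blast
  then have "cinner (v 0) (E X *v v 0) \<in> \<real>\<^sub>\<ge>\<^sub>0" for v :: "nat \<Rightarrow> complex^'b"
    by (simp add: positive_block_def)
  from this[of "\<lambda>_. _"] show ?thesis by (simp add: positive_op_def)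
qed

lemma channel_states:
  assumes "quantum_channel E" and "\<rho> \<in> states"
  shows "E \<rho> \<in> states"
  using assms completely_positive_imp_positive[OF quantum_channelD(2)[OF assms(1)]]
  by (simp add: states_def quantum_channelD(3))

lemma cinner_sum_left: "cinner (\<Sum>x\<in>S. f x) v = (\<Sum>x\<in>S. cinner (f x) v)"
  unfolding cinner_def by (simp add: sum_distrib_right sum.swap[of _ S])

lemma cinner_sum_right: "cinner u (\<Sum>x\<in>S. f x) = (\<Sum>x\<in>S. cinner u (f x))"
  unfolding cinner_def by (simp add: sum_distrib_left sum.swap[of _ S])

text \<open>The map \<open>\<phi>\<close> may repeat basis vectors. This is used when several blocks
  address the same basis function.\<close>

lemma cinner_combination:
  fixes X :: "'a::finite cmat"
  assumes "u = (\<Sum>x\<in>S. c x *s axis (\<phi> x) 1)"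
  shows "cinner u (X *v u) = (\<Sum>x\<in>S. \<Sum>y\<in>S. cnj (c x) * X $ \<phi> x $ \<phi> y * c y)"
proof -
  have Xu: "X *v u = (\<Sum>y\<in>S. c y *s (X *v axis (\<phi> y) 1))"
    unfolding assms
    by (subst linear_sum[OF matrix_vector_mul_linear]) (simp add: vector_scalar_commute)
  have left: "cinner u w = (\<Sum>x\<in>S. cnj (c x) * cinner (axis (\<phi> x) 1) w)" for w
    by (simp add: assms cinner_sum_left cinner_scale_left)
  have "cinner u (X *v u)
      = (\<Sum>x\<in>S. \<Sum>y\<in>S. cnj (c x) * (c y * cinner (axis (\<phi> x) 1) (X *v axis (\<phi> y) 1)))"
    by (subst left, subst Xu) (simp add: cinner_sum_right cinner_scale_right sum_distrib_left)
  then show ?thesis by (simp add: cinner_axis_mult_axis mult_ac)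
qed

text \<open>The remaining tensor factors serve as the ancilla: its basis is enumerated by the functions
  with a prescribed value at the site \<open>k\<close>.\<close>
lemma positive_op_at_site:
  fixes X :: "('n::finite \<Rightarrow> 'd::finite) cmat"
  assumes cp: "completely_positive L" and X: "positive_op X"
  shows "positive_op (at_site L k X)"
proof -
  \<comment> \<open>The ancilla is first indexed by all functions; blocks whose functions differ
    only at \<open>k\<close> coincide, which does no harm to positivity.\<close>
  obtain e where e: "bij_betw e {0..<card (UNIV :: ('n \<Rightarrow> 'd) set)} (UNIV :: ('n \<Rightarrow> 'd) set)"
    using ex_bij_betw_nat_finite[of "UNIV :: ('n \<Rightarrow> 'd) set"] by auto
  define m where "m = card (UNIV :: ('n \<Rightarrow> 'd) set)"
  have e: "bij_betw e {..<m} UNIV" using e by (simp add: m_def lessThan_atLeast0)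
  have "positive_block m (\<lambda>i j. slice k (e i) (e j) X)"
    unfolding positive_block_def
  proof
    fix v :: "nat \<Rightarrow> complex^'d"
    define u where "u = (\<Sum>(i, a)\<in>{..<m} \<times> UNIV. (v i $ a) *s axis ((e i)(k := a)) (1::complex))"
    have "cinner u (X *v u) = (\<Sum>x\<in>{..<m} \<times> UNIV. \<Sum>y\<in>{..<m} \<times> UNIV.
        cnj (v (fst x) $ snd x) * X $ (e (fst x))(k := snd x) $ (e (fst y))(k := snd y) * v (fst y) $ snd y)"
      by (rule cinner_combination) (simp add: u_def case_prod_unfold)
    also have "\<dots> = (\<Sum>i<m. \<Sum>a\<in>UNIV. \<Sum>j<m. \<Sum>b\<in>UNIV.
        cnj (v i $ a) * X $ (e i)(k := a) $ (e j)(k := b) * v j $ b)"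
      by (simp add: sum.cartesian_product')
    also have "\<dots> = (\<Sum>i<m. \<Sum>j<m. \<Sum>a\<in>UNIV. \<Sum>b\<in>UNIV.
        cnj (v i $ a) * X $ (e i)(k := a) $ (e j)(k := b) * v j $ b)"
      by (intro sum.cong refl sum.swap)
    also have "\<dots> = (\<Sum>i<m. \<Sum>j<m. cinner (v i) (slice k (e i) (e j) X *v v j))"
      by (simp add: cinner_expand slice_nth)
    finally show "(\<Sum>i<m. \<Sum>j<m. cinner (v i) (slice k (e i) (e j) X *v v j)) \<in> \<real>\<^sub>\<ge>\<^sub>0"
      using X unfolding positive_op_def by metis
  qed
  then have block: "positive_block m (\<lambda>i j. L (slice k (e i) (e j) X))"
    using cp by (simp add: completely_positive_def)
  show ?thesis
    unfolding positive_op_def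
  proof
    fix u :: "complex^('n \<Rightarrow> 'd)"
    obtain d0 :: 'd where True by blast
    \<comment> \<open>Only functions with the arbitrary reference value \<open>d0\<close> at
      \<open>k\<close> carry a component, so each coincident block is counted once.\<close>
    define V where "V f = (if f k = d0 then (\<chi> a. u $ f(k := a)) else 0)" for f
    let ?F = "{f :: 'n \<Rightarrow> 'd. f k = d0}"
    have split: "(\<Sum>h\<in>UNIV. H h) = (\<Sum>f\<in>?F. \<Sum>a\<in>UNIV. H (f(k := a)))" for H :: "('n \<Rightarrow> 'd) \<Rightarrow> complex"
      unfolding sum.cartesian_product
      by (rule sum.reindex_bij_witness[of _ "\<lambda>(f, a). f(k := a)" "\<lambda>h. (h(k := d0), h k)"]) auto
    have slice_upd: "slice k (f(k := a)) (g(k := b)) X = slice k f g X" for f g a b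
      by (rule cmat_eqI) (simp add: slice_nth)
    have "(\<Sum>i<m. \<Sum>j<m. cinner (V (e i)) (L (slice k (e i) (e j) X) *v V (e j)))
        = (\<Sum>f\<in>UNIV. \<Sum>j<m. cinner (V f) (L (slice k f (e j) X) *v V (e j)))"
      by (rule sum.reindex_bij_betw[OF e, of "\<lambda>f. \<Sum>j<m. cinner (V f) (L (slice k f (e j) X) *v V (e j))"])
    also have "\<dots> = (\<Sum>f\<in>UNIV. \<Sum>g\<in>UNIV. cinner (V f) (L (slice k f g X) *v V g))"
      by (intro sum.cong refl
          sum.reindex_bij_betw[OF e, of "\<lambda>g. cinner (V _) (L (slice k _ g X) *v V g)"])
    also have "\<dots> = (\<Sum>f\<in>?F. \<Sum>g\<in>?F. cinner (V f) (L (slice k f g X) *v V g))"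
    proof -
      have "(\<Sum>g\<in>UNIV. cinner (V f) (L (slice k f g X) *v V g))
          = (\<Sum>g\<in>?F. cinner (V f) (L (slice k f g X) *v V g))" for f
        by (rule sum.mono_neutral_right) (auto simp: V_def cinner_def)
      moreover have "(\<Sum>f\<in>UNIV. \<Sum>g\<in>?F. cinner (V f) (L (slice k f g X) *v V g))
          = (\<Sum>f\<in>?F. \<Sum>g\<in>?F. cinner (V f) (L (slice k f g X) *v V g))"
        by (rule sum.mono_neutral_right) (auto simp: V_def cinner_def)
      ultimately show ?thesis by simp
    qed
    also have "\<dots> = (\<Sum>f\<in>?F. \<Sum>g\<in>?F. \<Sum>a\<in>UNIV. \<Sum>b\<in>UNIV.
        cnj (u $ f(k := a)) * L (slice k f g X) $ a $ b * u $ g(k := b))"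
      by (intro sum.cong refl) (simp add: cinner_expand V_def)
    also have "\<dots> = (\<Sum>f\<in>?F. \<Sum>a\<in>UNIV. \<Sum>g\<in>?F. \<Sum>b\<in>UNIV.
        cnj (u $ f(k := a)) * L (slice k f g X) $ a $ b * u $ g(k := b))"
      by (intro sum.cong refl sum.swap)
    also have "\<dots> = (\<Sum>f\<in>?F. \<Sum>a\<in>UNIV. \<Sum>g\<in>?F. \<Sum>b\<in>UNIV.
        cnj (u $ f(k := a)) * at_site L k X $ f(k := a) $ g(k := b) * u $ g(k := b))"
      by (simp add: at_site_nth slice_upd)
    also have "\<dots> = cinner u (at_site L k X *v u)"
      unfolding cinner_expand split ..
    finally show "cinner u (at_site L k X *v u) \<in> \<real>\<^sub>\<ge>\<^sub>0"
      using block[unfolded positive_block_def, rule_format, of "\<lambda>i. V (e i)"] by simp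
  qed
qed

text \<open>Positivity is passed on site by site. Each step treats the other copies as an ancilla,
  which is where complete positivity enters.\<close>

lemma positive_op_tensor_map:
  fixes L :: "'d::finite cmat \<Rightarrow> 'd cmat" and X :: "('n::finite \<Rightarrow> 'd) cmat"
  assumes "quantum_channel L" and "positive_op X"
  shows "positive_op (tensor_map L X)"
proof -
  let ?I = "\<lambda>F :: ('n \<Rightarrow> 'd) cmat \<Rightarrow> ('n \<Rightarrow> 'd) cmat. \<forall>X. positive_op X \<longrightarrow> positive_op (F X)"
  have "?I (at_site L k \<circ> F)" if "?I F" for k F
    using that by (simp add: positive_op_at_site[OF quantum_channelD(2)[OF assms(1)]])
  then have "?I (tensor_map L)"
    using tensor_map_induct[OF quantum_channelD(1)[OF assms(1)], of ?I] by simp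
  then show ?thesis using assms(2) by blast
qed

text \<open>Multiplying the traces by the identity makes them matrix-valued linear maps, to which
  extensionality on tensors applies.\<close>

lemma trace_eq_on_tensors:
  fixes F G :: "('n::finite \<Rightarrow> 'd::finite) cmat \<Rightarrow> 'b::finite cmat"
  assumes F: "Vector_Spaces.linear cscale cscale F" and G: "Vector_Spaces.linear cscale cscale G"
    and eq: "\<And>X. trace (F (tensor X)) = trace (G (tensor X))"
  shows "trace (F X) = trace (G X)"
proof -
  interpret F: Vector_Spaces.linear cscale cscale F by fact
  interpret G: Vector_Spaces.linear cscale cscale G by fact
  have "(\<lambda>X. cscale (trace (F X)) (mat 1 :: 'b cmat)) = (\<lambda>X. cscale (trace (G X)) (mat 1))"
  proof (rule cscale_linear_eq_on_tensors)
    show "Vector_Spaces.linear cscale cscale (\<lambda>X. cscale (trace (F X)) (mat 1 :: 'b cmat))"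
      by unfold_locales (simp_all add: F.add F.scale trace_add trace_cscale cmat.scale_left_distrib)
    show "Vector_Spaces.linear cscale cscale (\<lambda>X. cscale (trace (G X)) (mat 1 :: 'b cmat))"
      by unfold_locales (simp_all add: G.add G.scale trace_add trace_cscale cmat.scale_left_distrib)
  qed (simp add: eq)
  then have "cscale (trace (F X)) (mat 1 :: 'b cmat) $ i $ i = cscale (trace (G X)) (mat 1) $ i $ i" for i
    by metis
  then show ?thesis by (simp add: mat_nth)
qed

lemma trace_tensor_map:
  assumes "quantum_channel L"
  shows "trace (tensor_map L X) = trace X"
  using trace_eq_on_tensors[OF cscale_linear_tensor_map[OF quantum_channelD(1)[OF assms]] cmat.linear_id]
  by (simp add: tensor_map_tensor[OF quantum_channelD(1)[OF assms]] trace_tensor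
      quantum_channelD(3)[OF assms])

lemma tensor_map_tensor_power:
  "Vector_Spaces.linear cscale cscale L \<Longrightarrow> tensor_map L (tensor_power X) = tensor_power (L X)"
  by (simp add: tensor_power_def tensor_map_tensor)

lemma conjugate_tensor:
  "tensor_power V ** tensor X ** dagger (tensor_power V) = tensor (\<lambda>k. V ** X k ** dagger V)"
  by (simp add: tensor_power_def dagger_tensor tensor_mult)

lemma tensor_map_covariant:
  fixes X :: "('n::finite \<Rightarrow> 'd::finite) cmat"
  assumes L: "Vector_Spaces.linear cscale cscale L"
    and cov: "\<And>X. L (V ** X ** dagger V) = V ** L X ** dagger V"
  shows "tensor_map L (tensor_power V ** X ** dagger (tensor_power V))
    = tensor_power V ** tensor_map L X ** dagger (tensor_power V)"
proof -
  let ?c = "\<lambda>X :: ('n \<Rightarrow> 'd) cmat. tensor_power V ** X ** dagger (tensor_power V)"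
  have c: "Vector_Spaces.linear cscale cscale ?c"
    by unfold_locales (simp_all add: matrix_add_ldistrib mult_add_left cscale_mult_right cscale_mult_left)
  have m: "Vector_Spaces.linear cscale cscale (tensor_map L :: ('n \<Rightarrow> 'd) cmat \<Rightarrow> _)"
    by (rule cscale_linear_tensor_map[OF L])
  have "tensor_map L \<circ> ?c = ?c \<circ> tensor_map L"
    by (rule cscale_linear_eq_on_tensors)
      (simp_all add: Vector_Spaces.linear_compose[OF c m] Vector_Spaces.linear_compose[OF m c]
        conjugate_tensor tensor_map_tensor[OF L] cov)
  then show ?thesis by (metis comp_apply)
qed

lemma trace_outer: "trace (outer u v) = cinner v u"
  by (simp add: trace_def cinner_def mult.commute)

text \<open>States span all matrices: rank-one operators are rescaled pure states, and polarization
  recovers the matrix units.\<close>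

lemma noiseless_on_all:
  fixes E :: "'a::finite cmat \<Rightarrow> 'a cmat"
  assumes noiseless: "noiseless_on A E" and E: "Vector_Spaces.linear cscale cscale E" and R: "R \<in> A"
  shows "trace (R ** E X) = trace (R ** X)"
proof -
  interpret E: Vector_Spaces.linear cscale cscale E by fact
  define f where "f X = trace (R ** E X) - trace (R ** X)" for X
  have add: "f (X + Y) = f X + f Y" for X Y
    by (simp add: f_def E.add matrix_add_ldistrib trace_add)
  have scale: "f (cscale c X) = c * f X" for c X
    by (simp add: f_def E.scale cscale_mult_right trace_cscale algebra_simps)
  have self: "f (outer v v) = 0" for v
  proof (cases "v = 0")
    case True
    then have "outer v v = cscale 0 0" by (intro cmat_eqI) simp
    then show ?thesis using scale[of 0 0] by simp
  next
    case False
    define \<rho> where "\<rho> = (1 / (norm v)\<^sup>2) *\<^sub>R outer v v"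
    have "trace \<rho> = of_real (1 / (norm v)\<^sup>2) * of_real ((norm v)\<^sup>2)"
      by (simp only: \<rho>_def scaleR_eq_cscale trace_cscale trace_outer cinner_self)
    then have "\<rho> \<in> states"
      using False by (simp add: states_def \<rho>_def positive_op_scaleR positive_op_outer)
    then have "f \<rho> = 0" using noiseless R by (simp add: noiseless_on_def f_def)
    moreover have "outer v v = cscale (of_real ((norm v)\<^sup>2)) \<rho>"
      using False by (simp add: \<rho>_def scaleR_eq_cscale)
    ultimately show ?thesis by (simp add: scale)
  qed
  have "f (matrix_unit i j) = 0" for i j
  proof -
    let ?u = "axis i 1 :: complex^'a" and ?w = "axis j 1 :: complex^'a"
    have "cscale 4 (matrix_unit i j) = cscale 1 (outer (?u + ?w) (?u + ?w))
        + cscale (-1) (outer (?u - ?w) (?u - ?w)) + cscale \<i> (outer (?u + \<i> *s ?w) (?u + \<i> *s ?w))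
        + cscale (-\<i>) (outer (?u - \<i> *s ?w) (?u - \<i> *s ?w))"
      by (rule cmat_eqI) (auto simp: matrix_unit_nth axis_def algebra_simps)
    then have "f (cscale 4 (matrix_unit i j)) = 0" by (simp only: add scale self) simp
    then show ?thesis by (simp add: scale)
  qed
  moreover have "f (\<Sum>x\<in>S. h x) = (\<Sum>x\<in>S. f (h x))" for h :: "'a \<Rightarrow> 'a cmat" and S
    using scale[of 0 0] by (induction S rule: infinite_finite_induct) (simp_all add: add)
  ultimately have "f X = 0"
    by (subst cmat_eq_sum_matrix_unit[of X]) (simp add: scale)
  then show ?thesis by (simp add: f_def)
qed

text \<open>The inner product pairs with the adjoint of \<open>R\<close>, which again lies in
  \<open>A\<close>.\<close>

lemma inner_noiseless:
  assumes "von_neumann_algebra A" and "R \<in> A" and "\<And>R. R \<in> A \<Longrightarrow> trace (R ** F X) = trace (R ** X)"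
  shows "R \<bullet> F X = R \<bullet> X"
  using assms by (simp add: inner_eq_trace von_neumann_algebra_def)

text \<open>On tensors both traces factor into single-copy traces; linearity in both arguments does
  the rest.\<close>

lemma tensor_map_noiseless:
  fixes X R :: "('n::finite \<Rightarrow> 'd::finite) cmat"
  assumes noiseless: "noiseless_on A L" and L: "Vector_Spaces.linear cscale cscale L"
    and R: "R \<in> algebra_power A"
  shows "trace (R ** tensor_map L X) = trace (R ** X)"
proof -
  have m: "Vector_Spaces.linear cscale cscale (tensor_map L :: ('n \<Rightarrow> 'd) cmat \<Rightarrow> _)"
    by (rule cscale_linear_tensor_map[OF L])
  have r: "Vector_Spaces.linear cscale cscale (\<lambda>X :: ('n \<Rightarrow> 'd) cmat. T ** X)" for T
    by unfold_locales (simp_all add: matrix_add_ldistrib cscale_mult_right)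
  have "trace (tensor Z ** tensor_map L X) = trace (tensor Z ** X)" if "\<And>k. Z k \<in> A" for Z
    using trace_eq_on_tensors[OF Vector_Spaces.linear_compose[OF m r[of "tensor Z"]] r[of "tensor Z"], of X]
      noiseless_on_all[OF noiseless L that]
    by (simp add: tensor_map_tensor[OF L] tensor_mult trace_tensor)
  then have "algebra_power A \<subseteq> {R. trace (R ** tensor_map L X) = trace (R ** X)}"
    unfolding algebra_power_def
    by (intro cmat.span_minimal)
      (auto simp: cmat.subspace_def mult_add_left trace_add cscale_mult_left trace_cscale)
  then show ?thesis using R by blast
qed

lemma inner_adjoint:
  fixes F :: "'a::euclidean_space \<Rightarrow> 'b::euclidean_space"
  assumes "linear F"
  shows "adjoint F X \<bullet> Y = X \<bullet> F Y"
  using adjoint_works[OF assms, of Y X] by (simp add: inner_commute)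

text \<open>Unitality is dual to trace preservation.\<close>

lemma adjoint_mat_1:
  fixes F :: "'a::finite cmat \<Rightarrow> 'b::finite cmat"
  assumes F: "linear F" and tr: "\<And>X. trace (F X) = trace X"
  shows "adjoint F (mat 1) = mat 1"
proof -
  have "adjoint F (mat 1) \<bullet> Y = mat 1 \<bullet> Y" for Y
    unfolding inner_adjoint[OF F] by (simp add: inner_eq_trace tr)
  then show ?thesis by (metis vector_eq_rdot inner_commute)
qed

text \<open>In finite dimension a linear map is continuous, so it carries convergent series
  along.\<close>

lemma povm_linear_image:
  assumes M: "povm \<Omega> M" and \<Psi>: "linear \<Psi>" and one: "\<Psi> (mat 1) = mat 1"
    and pos: "\<And>B. B \<in> sets \<Omega> \<Longrightarrow> positive_op (\<Psi> (M B))"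
  shows "povm \<Omega> (\<lambda>B. \<Psi> (M B))"
  using M bounded_linear.sums[OF linear_conv_bounded_linear[THEN iffD1, OF \<Psi>]] one pos
  unfolding povm_def by auto

section \<open>Moments of the prior\<close>

lemma reference_measureD:
  assumes "reference_measure \<mu>"
  shows "sets \<mu> = sets (restrict_space borel states)" and "space \<mu> = states"
    and "unitary V \<Longrightarrow> distr \<mu> \<mu> (conjugate_by V) = \<mu>"
proof -
  show s: "sets \<mu> = sets (restrict_space borel states)" and "unitary V \<Longrightarrow> distr \<mu> \<mu> (conjugate_by V) = \<mu>"
    using assms by (auto simp: reference_measure_def)
  show "space \<mu> = states" using sets_eq_imp_space_eq[OF s] by (simp add: space_restrict_space)
qed

lemma measurable_linear_states:
  fixes L :: "'d::finite cmat \<Rightarrow> 'd cmat"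
  assumes \<mu>: "reference_measure \<mu>" and L: "linear L" and states: "\<And>\<rho>. \<rho> \<in> states \<Longrightarrow> L \<rho> \<in> states"
  shows "L \<in> measurable \<mu> \<mu>"
proof -
  have "L \<in> borel_measurable borel"
    using linear_continuous_on[OF linear_conv_bounded_linear[THEN iffD1, OF L]]
    by (intro borel_measurable_continuous_onI)
  then have "L \<in> measurable (restrict_space borel states) (restrict_space borel states)"
    by (rule measurable_restrict_space3) (use states in auto)
  then show ?thesis
    using measurable_cong_sets[OF reference_measureD(1)[OF \<mu>] reference_measureD(1)[OF \<mu>]] by simp
qed

lemma borel_measurable_tensor_power:
  fixes \<mu> :: "'d::finite cmat measure"
  assumes \<mu>: "reference_measure \<mu>"
  shows "(tensor_power :: 'd cmat \<Rightarrow> ('n::finite \<Rightarrow> 'd) cmat) \<in> borel_measurable \<mu>"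
proof -
  have "continuous_on UNIV (tensor_power :: 'd cmat \<Rightarrow> ('n \<Rightarrow> 'd) cmat)"
    unfolding tensor_power_def tensor_def
    by (intro continuous_on_vec_lambda continuous_intros)
  then have "(tensor_power :: 'd cmat \<Rightarrow> ('n \<Rightarrow> 'd) cmat) \<in> borel_measurable (restrict_space borel states)"
    by (intro measurable_restrict_space1 borel_measurable_continuous_onI)
  then show ?thesis
    by (simp add: measurable_cong_sets[OF reference_measureD(1)[OF \<mu>] refl])
qed

text \<open>Cauchy-Schwarz bounds an entry by two diagonal entries, which are nonnegative and sum to
  1. The uniform bound makes tensor powers integrable.\<close>

lemma norm_state_entry_le_1:
  assumes \<rho>: "\<rho> \<in> states"
  shows "norm (\<rho> $ i $ j) \<le> 1"
proof -
  have pos: "positive_op \<rho>" and tr: "trace \<rho> = 1" using \<rho> by (auto simp: states_def)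
  have diag: "0 \<le> Re (\<rho> $ k $ k)" for k
    using pos unfolding positive_op_def complex_nonneg_Reals_iff by (metis cinner_axis_mult_axis)
  have "(\<Sum>k\<in>UNIV. Re (\<rho> $ k $ k)) = 1"
    using arg_cong[OF tr, of Re] by (simp add: trace_def)
  then have "Re (\<rho> $ k $ k) \<le> 1" for k
    using member_le_sum[of k UNIV "\<lambda>k. Re (\<rho> $ k $ k)"] diag by simp
  then have "Re (\<rho> $ i $ i) * Re (\<rho> $ j $ j) \<le> 1" using diag by (intro mult_le_one)
  then have "(norm (\<rho> $ i $ j))\<^sup>2 \<le> 1"
    using positive_cauchy_schwarz[OF pos, of "axis i 1" "axis j 1"] by (simp add: cinner_axis_mult_axis)
  then show ?thesis using abs_square_le_1[of "norm (\<rho> $ i $ j)"] by simp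
qed

lemma norm_tensor_power_bounded:
  "\<exists>C. \<forall>\<rho>\<in>states. norm (tensor_power \<rho> :: ('n::finite \<Rightarrow> 'd::finite) cmat) \<le> C"
proof (intro exI ballI)
  fix \<rho> :: "'d cmat" assume \<rho>: "\<rho> \<in> states"
  show "norm (tensor_power \<rho> :: ('n \<Rightarrow> 'd) cmat)
      \<le> real CARD('n \<Rightarrow> 'd) * (real CARD('n \<Rightarrow> 'd) * 1)"
  proof (rule norm_cmat_le_entries)
    show "norm ((tensor_power \<rho> :: ('n \<Rightarrow> 'd) cmat) $ f $ g) \<le> 1" for f g
      unfolding tensor_power_def tensor_nth prod_norm[symmetric]
      by (intro prod_le_1) (use norm_state_entry_le_1[OF \<rho>] in auto)
  qed
qed

lemma space_law: "space (law \<mu> p) = space \<mu>" and sets_law: "sets (law \<mu> p) = sets \<mu>"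
  by (simp_all add: law_def)

lemma integral_law:
  fixes f :: "'d::finite cmat \<Rightarrow> 'b::{banach, second_countable_topology}"
  assumes \<mu>: "reference_measure \<mu>" and p: "prior \<mu> p" and f: "f \<in> borel_measurable \<mu>"
  shows "(\<integral>\<rho>. f \<rho> \<partial>law \<mu> p) = (\<integral>\<rho>. p \<rho> *\<^sub>R f \<rho> \<partial>\<mu>)"
  unfolding law_def
proof (rule integral_density[OF f])
  show "p \<in> borel_measurable \<mu>" using p by (simp add: prior_def)
  show "AE \<rho> in \<mu>. 0 \<le> p \<rho>" using p reference_measureD(2)[OF \<mu>] by (intro AE_I2) (simp add: prior_def)
qed

lemma measurable_law: "f \<in> measurable (law \<mu> p) N \<longleftrightarrow> f \<in> measurable \<mu> N"
  by (rule arg_cong[where f = "\<lambda>S. f \<in> S"]) (rule measurable_cong_sets, simp_all add: sets_law)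

lemma integrable_law_tensor_power:
  fixes p :: "'d::finite cmat \<Rightarrow> real"
  assumes \<mu>: "reference_measure \<mu>" and p: "prior \<mu> p" and S: "S \<in> sets \<mu>"
  shows "integrable (law \<mu> p) (\<lambda>\<rho>. indicator S \<rho> *\<^sub>R (tensor_power \<rho> :: ('n::finite \<Rightarrow> 'd) cmat))"
proof -
  interpret prob_space "law \<mu> p" using p by (simp add: prior_def)
  obtain C where C: "\<And>\<rho>. \<rho> \<in> states \<Longrightarrow> norm (tensor_power \<rho> :: ('n \<Rightarrow> 'd) cmat) \<le> C"
    using norm_tensor_power_bounded[where 'n = 'n and 'd = 'd] by blast
  show ?thesis
  proof (rule integrable_const_bound)
    show "AE \<rho> in law \<mu> p. norm (indicator S \<rho> *\<^sub>R (tensor_power \<rho> :: ('n \<Rightarrow> 'd) cmat)) \<le> \<bar>C\<bar>"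
    proof (rule AE_I2)
      fix \<rho> assume "\<rho> \<in> space (law \<mu> p)"
      then have "\<rho> \<in> states" by (simp add: space_law reference_measureD(2)[OF \<mu>])
      from C[OF this] show "norm (indicator S \<rho> *\<^sub>R (tensor_power \<rho> :: ('n \<Rightarrow> 'd) cmat)) \<le> \<bar>C\<bar>"
        by (cases "\<rho> \<in> S") auto
    qed
    show "(\<lambda>\<rho>. indicator S \<rho> *\<^sub>R (tensor_power \<rho> :: ('n \<Rightarrow> 'd) cmat)) \<in> borel_measurable (law \<mu> p)"
      unfolding measurable_law
      using S borel_measurable_tensor_power[OF \<mu>]
      by (intro borel_measurable_scaleR borel_measurable_indicator)
  qed
qed

text \<open>Unnormalized, since the two conditional probabilities to be compared share the factor
  \<open>1 / parameter_prob \<mu> p s \<Delta>\<close>.\<close>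

definition moment :: "'d::finite cmat measure \<Rightarrow> ('d cmat \<Rightarrow> real) \<Rightarrow> 'd cmat set \<Rightarrow> ('n::finite \<Rightarrow> 'd) cmat"
  where "moment \<mu> p S = (\<integral>\<rho>. indicator S \<rho> *\<^sub>R tensor_power \<rho> \<partial>law \<mu> p)"

lemma inner_eq_Re_trace: "positive_op X \<Longrightarrow> X \<bullet> Y = Re (trace (X ** Y))"
  by (simp add: inner_eq_trace hermitian_if_positive)

text \<open>Pulling \<open>E\<close> back to the measurement makes the outcome probability linear in
  \<open>tensor_power \<rho>\<close>, so integration passes to the moment.\<close>

lemma outcome_integral_eq_inner_moment:
  fixes E :: "('n::finite \<Rightarrow> 'd::finite) cmat \<Rightarrow> ('n \<Rightarrow> 'd) cmat"
  assumes \<mu>: "reference_measure \<mu>" and p: "prior \<mu> p" and S: "S \<in> sets \<mu>"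
    and E: "linear E" and X: "positive_op (M B)"
  shows "(LINT \<rho>:S|\<mu>. p \<rho> * outcome_prob E M B \<rho>) = adjoint E (M B) \<bullet> moment \<mu> p S"
proof -
  let ?t = "tensor_power :: 'd cmat \<Rightarrow> ('n \<Rightarrow> 'd) cmat"
  let ?A = "adjoint E (M B)"
  have o: "outcome_prob E M B \<rho> = ?A \<bullet> ?t \<rho>" for \<rho>
    by (simp add: outcome_prob_def inner_adjoint[OF E] inner_eq_Re_trace[OF X])
  have "(LINT \<rho>:S|\<mu>. p \<rho> * outcome_prob E M B \<rho>) = (\<integral>\<rho>. p \<rho> *\<^sub>R (?A \<bullet> (indicator S \<rho> *\<^sub>R ?t \<rho>)) \<partial>\<mu>)"
    unfolding set_lebesgue_integral_def o by (simp add: mult_ac)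
  also have "\<dots> = (\<integral>\<rho>. ?A \<bullet> (indicator S \<rho> *\<^sub>R ?t \<rho>) \<partial>law \<mu> p)"
    using S borel_measurable_tensor_power[OF \<mu>, where 'n = 'n]
    by (intro integral_law[symmetric] \<mu> p borel_measurable_inner borel_measurable_scaleR
        borel_measurable_indicator) auto
  also have "\<dots> = ?A \<bullet> moment \<mu> p S"
    unfolding moment_def by (rule integral_inner_right) (rule integrable_law_tensor_power[OF \<mu> p S])
  finally show ?thesis .
qed

text \<open>A non-integrable function has integral 0 by convention, so a nonzero value makes the
  integrand measurable. The event is exactly where the integrand does not vanish, as
  \<open>p\<close> is nonzero on its support.\<close>

lemma measurable_parameter_set:
  fixes \<mu> :: "'d::finite cmat measure"
  assumes \<mu>: "reference_measure \<mu>" and nz: "parameter_prob \<mu> p s \<Delta> \<noteq> 0"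
  shows "{\<rho> \<in> supp p. s \<rho> \<in> \<Delta>} \<in> sets \<mu>"
proof -
  let ?S = "{\<rho> \<in> supp p. s \<rho> \<in> \<Delta>}"
  let ?w = "\<lambda>\<rho>. indicator ?S \<rho> *\<^sub>R p \<rho>"
  have "integrable \<mu> ?w"
    using nz not_integrable_integral_eq unfolding parameter_prob_def set_lebesgue_integral_def by blast
  then have "?w -` (- {0}) \<inter> space \<mu> \<in> sets \<mu>"
    by (intro measurable_sets[OF borel_measurable_integrable]) auto
  moreover have "?w -` (- {0}) \<inter> space \<mu> = ?S"
    by (auto simp: reference_measureD(2)[OF \<mu>] supp_def indicator_def split: if_splits)
  ultimately show ?thesis by simp
qed

lemma conjugate_states:
  assumes "unitary V" and "\<rho> \<in> states"
  shows "conjugate_by V \<rho> \<in> states"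
proof -
  have "trace (V ** \<rho> ** dagger V) = trace (dagger V ** V ** \<rho>)"
    by (metis matrix_mul_assoc trace_mul_sym)
  then show ?thesis
    using assms by (simp add: states_def conjugate_by_def positive_op_conjugate unitary_def)
qed

lemma tensor_power_conjugate:
  "tensor_power (conjugate_by V \<rho>) = tensor_power V ** tensor_power \<rho> ** dagger (tensor_power V)"
  by (simp add: conjugate_by_def tensor_power_mult dagger_tensor_power)

lemma integral_linear:
  fixes L :: "'a::euclidean_space \<Rightarrow> 'b::euclidean_space"
  assumes "linear L" and "integrable M f"
  shows "(\<integral>x. L (f x) \<partial>M) = L (\<integral>x. f x \<partial>M)"
  using assms by (intro integral_bounded_linear) (simp_all add: linear_conv_bounded_linear)

text \<open>Change of variables by \<open>conjugate_by V\<close>: reference measure, density and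
  event are invariant, so the moment is fixed under conjugation by
  \<open>tensor_power V\<close>.\<close>

lemma moment_commutant:
  fixes \<mu> :: "'d::finite cmat measure" and S :: "'d cmat set"
  assumes \<mu>: "reference_measure \<mu>" and p: "prior \<mu> p" and S: "S \<in> sets \<mu>"
    and unit: "\<And>V. V \<in> G \<Longrightarrow> unitary V"
    and p_sym: "prior_symmetry G p"
    and S_sym: "\<And>V \<rho>. V \<in> G \<Longrightarrow> \<rho> \<in> states \<Longrightarrow> conjugate_by V \<rho> \<in> S \<longleftrightarrow> \<rho> \<in> S"
  shows "(moment \<mu> p S :: ('n::finite \<Rightarrow> 'd) cmat) \<in> commutant (tensor_power ` G)"
  unfolding commutant_def
proof safe
  fix V assume V: "V \<in> G"
  let ?t = "tensor_power :: 'd cmat \<Rightarrow> ('n \<Rightarrow> 'd) cmat"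
  let ?f = "\<lambda>\<rho>. p \<rho> *\<^sub>R (indicator S \<rho> *\<^sub>R ?t \<rho>)"
  note [measurable] = S borel_measurable_tensor_power[OF \<mu>, where 'n = 'n]
  have [measurable]: "p \<in> borel_measurable \<mu>" using p by (simp add: prior_def)
  have conj: "conjugate_by V \<in> measurable \<mu> \<mu>"
    using conjugate_states[OF unit[OF V]] linear_conjugate[of V]
    by (intro measurable_linear_states[OF \<mu>]) (auto simp: conjugate_by_def[abs_def])
  have i: "indicator S (conjugate_by V \<rho>) = (indicator S \<rho> :: real)" if "\<rho> \<in> states" for \<rho>
    using S_sym[OF V that] by (simp add: indicator_def)
  have m: "moment \<mu> p S = (\<integral>\<rho>. ?f \<rho> \<partial>\<mu>)"
    unfolding moment_def by (rule integral_law[OF \<mu> p]) measurable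
  have "moment \<mu> p S = (\<integral>\<rho>. ?f \<rho> \<partial>distr \<mu> \<mu> (conjugate_by V))"
    by (simp add: m reference_measureD(3)[OF \<mu> unit[OF V]])
  also have "\<dots> = (\<integral>\<rho>. ?f (conjugate_by V \<rho>) \<partial>\<mu>)"
    by (rule integral_distr[OF conj]) measurable
  also have "\<dots> = (\<integral>\<rho>. p \<rho> *\<^sub>R (?t V ** (indicator S \<rho> *\<^sub>R ?t \<rho>) ** dagger (?t V)) \<partial>\<mu>)"
    using p_sym V
    by (intro Bochner_Integration.integral_cong refl)
      (simp add: reference_measureD(2)[OF \<mu>] i prior_symmetry_def tensor_power_conjugate
        scaleR_mult_left scaleR_mult_right)
  also have "\<dots> = (\<integral>\<rho>. ?t V ** (indicator S \<rho> *\<^sub>R ?t \<rho>) ** dagger (?t V) \<partial>law \<mu> p)"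
  proof (rule integral_law[OF \<mu> p, symmetric])
    have "(\<lambda>X. ?t V ** X ** dagger (?t V)) \<in> borel_measurable borel"
      using linear_continuous_on[OF linear_conv_bounded_linear[THEN iffD1, OF linear_conjugate]]
      by (intro borel_measurable_continuous_onI)
    then show "(\<lambda>\<rho>. ?t V ** (indicator S \<rho> *\<^sub>R ?t \<rho>) ** dagger (?t V)) \<in> borel_measurable \<mu>"
      by (rule measurable_compose[rotated]) measurable
  qed
  also have "\<dots> = ?t V ** moment \<mu> p S ** dagger (?t V)"
    unfolding moment_def
    by (rule integral_linear[OF linear_conjugate integrable_law_tensor_power[OF \<mu> p S]])
  finally have "moment \<mu> p S ** ?t V = ?t V ** moment \<mu> p S ** (dagger (?t V) ** ?t V)"
    by (metis matrix_mul_assoc)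
  then show "?t V ** moment \<mu> p S = moment \<mu> p S ** ?t V"
    using unitary_tensor_power[OF unit[OF V]] by (metis unitary_def matrix_mul_rid)
qed

text \<open>Change of variables along \<open>N\<close>. It acts on each copy separately, so the
  power of \<open>N \<psi>\<close> is a linear image of the power of \<open>\<psi>\<close>, and the
  linear map leaves the integral.\<close>

lemma moment_distortion:
  fixes \<mu> :: "'d::finite cmat measure" and N :: "'d cmat \<Rightarrow> 'd cmat"
  assumes \<mu>: "reference_measure \<mu>" and p: "prior \<mu> p" and p': "prior \<mu> p'" and S: "S \<in> sets \<mu>"
    and N: "quantum_channel N" and law: "distr (law \<mu> p') \<mu> N = law \<mu> p"
  shows "N -` S \<inter> space \<mu> \<in> sets \<mu>"
    and "(moment \<mu> p S :: ('n::finite \<Rightarrow> 'd) cmat) = tensor_map N (moment \<mu> p' (N -` S \<inter> space \<mu>))"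
proof -
  let ?t = "tensor_power :: 'd cmat \<Rightarrow> ('n \<Rightarrow> 'd) cmat"
  note linN = quantum_channelD(1)[OF N]
  have mN: "N \<in> measurable \<mu> \<mu>"
    using channel_states[OF N] by (intro measurable_linear_states[OF \<mu>] cscale_linear_imp_linear linN)
  show S': "N -` S \<inter> space \<mu> \<in> sets \<mu>" by (rule measurable_sets[OF mN S])
  note [measurable] = S borel_measurable_tensor_power[OF \<mu>, where 'n = 'n]
  have "moment \<mu> p S = (\<integral>\<rho>. indicator S \<rho> *\<^sub>R ?t \<rho> \<partial>distr (law \<mu> p') \<mu> N)"
    by (simp add: moment_def law)
  also have "\<dots> = (\<integral>\<psi>. indicator S (N \<psi>) *\<^sub>R ?t (N \<psi>) \<partial>law \<mu> p')"
    by (rule integral_distr) (simp add: measurable_law mN, measurable)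
  also have "\<dots> = (\<integral>\<psi>. tensor_map N (indicator (N -` S \<inter> space \<mu>) \<psi> *\<^sub>R ?t \<psi>) \<partial>law \<mu> p')"
  proof (intro Bochner_Integration.integral_cong refl)
    interpret T: Vector_Spaces.linear cscale cscale "tensor_map N :: ('n \<Rightarrow> 'd) cmat \<Rightarrow> _"
      by (rule cscale_linear_tensor_map[OF linN])
    fix \<psi> assume "\<psi> \<in> space (law \<mu> p')"
    then show "indicator S (N \<psi>) *\<^sub>R ?t (N \<psi>) = tensor_map N (indicator (N -` S \<inter> space \<mu>) \<psi> *\<^sub>R ?t \<psi>)"
      by (simp add: space_law indicator_def tensor_map_tensor_power[OF linN] T.zero)
  qed
  also have "\<dots> = tensor_map N (moment \<mu> p' (N -` S \<inter> space \<mu>))"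
    unfolding moment_def
    by (intro integral_linear cscale_linear_imp_linear cscale_linear_tensor_map linN
        integrable_law_tensor_power \<mu> p' S')
  finally show "(moment \<mu> p S :: ('n \<Rightarrow> 'd) cmat) = tensor_map N (moment \<mu> p' (N -` S \<inter> space \<mu>))" .
qed

text \<open>For a rank-one operator the entries split into a product over the row index times one
  over the column index, and each product can be permuted alone.\<close>

lemma perm_op_pure:
  fixes \<psi> :: "'d::finite cmat" and \<pi> :: "'n::finite \<Rightarrow> 'n"
  assumes \<psi>: "\<psi> \<in> pure_states" and \<pi>: "bij \<pi>"
  shows "perm_op \<pi> ** tensor_power \<psi> = tensor_power \<psi>"
    and "tensor_power \<psi> ** perm_op \<pi> = tensor_power \<psi>"
proof -
  obtain v where v: "\<psi> = (\<chi> i j. v $ i * cnj (v $ j))" using \<psi> by (auto simp: pure_states_def)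
  have e: "(tensor_power \<psi> :: ('n \<Rightarrow> 'd) cmat) $ f $ g
      = (\<Prod>k\<in>UNIV. v $ f k) * (\<Prod>k\<in>UNIV. cnj (v $ g k))" for f g
    by (simp add: tensor_power_def tensor_nth v prod.distrib)
  have r: "(\<Prod>k\<in>UNIV. h (f (\<sigma> k))) = (\<Prod>k\<in>UNIV. h (f k))"
    if "bij \<sigma>" for \<sigma> :: "'n \<Rightarrow> 'n" and h :: "'d \<Rightarrow> complex" and f :: "'n \<Rightarrow> 'd"
    by (rule prod.reindex_bij_betw[OF that, of "\<lambda>k. h (f k)"])
  show "perm_op \<pi> ** tensor_power \<psi> = tensor_power \<psi>"
    by (rule cmat_eqI) (simp add: perm_op_mult_nth e r[OF \<pi>])
  show "tensor_power \<psi> ** perm_op \<pi> = tensor_power \<psi>"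
    by (rule cmat_eqI) (simp add: mult_perm_op_nth[OF \<pi>] e r[OF bij_imp_bij_inv[OF \<pi>], of "\<lambda>i. cnj (v $ i)"])
qed

lemma moment_pure_sym:
  fixes \<mu> :: "'d::finite cmat measure"
  assumes \<mu>: "reference_measure \<mu>" and p: "prior \<mu> p" and S: "S \<in> sets \<mu>"
    and pure: "supp p \<subseteq> pure_states"
  shows "sym_proj ** moment \<mu> p S = (moment \<mu> p S :: ('n::finite \<Rightarrow> 'd) cmat)"
    and "moment \<mu> p S ** sym_proj = (moment \<mu> p S :: ('n \<Rightarrow> 'd) cmat)"
proof -
  let ?t = "tensor_power :: 'd cmat \<Rightarrow> ('n \<Rightarrow> 'd) cmat"
  \<comment> \<open>The density vanishes outside the support, so it is enough that \<open>L\<close>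
    fixes the powers of pure states.\<close>
  have fixed: "L (moment \<mu> p S) = moment \<mu> p S"
    if L: "linear L" and eq: "\<And>\<psi>. \<psi> \<in> pure_states \<Longrightarrow> L (?t \<psi>) = ?t \<psi>" for L
  proof -
    have "L (moment \<mu> p S) = (\<integral>\<psi>. L (indicator S \<psi> *\<^sub>R ?t \<psi>) \<partial>law \<mu> p)"
      unfolding moment_def
      by (rule integral_linear[OF L integrable_law_tensor_power[OF \<mu> p S], symmetric])
    also have "\<dots> = (\<integral>\<rho>. p \<rho> *\<^sub>R L (indicator S \<rho> *\<^sub>R ?t \<rho>) \<partial>\<mu>)"
    proof (rule integral_law[OF \<mu> p])
      have "L \<in> borel_measurable borel"
        using linear_continuous_on[OF linear_conv_bounded_linear[THEN iffD1, OF L]]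
        by (intro borel_measurable_continuous_onI)
      then show "(\<lambda>\<rho>. L (indicator S \<rho> *\<^sub>R ?t \<rho>)) \<in> borel_measurable \<mu>"
        by (rule measurable_compose[rotated])
          (intro borel_measurable_scaleR borel_measurable_indicator S borel_measurable_tensor_power[OF \<mu>])
    qed
    also have "\<dots> = (\<integral>\<rho>. p \<rho> *\<^sub>R (indicator S \<rho> *\<^sub>R ?t \<rho>) \<partial>\<mu>)"
    proof (intro Bochner_Integration.integral_cong refl)
      fix \<rho> assume "\<rho> \<in> space \<mu>"
      then have "p \<rho> = 0 \<or> \<rho> \<in> pure_states"
        using pure by (auto simp: supp_def reference_measureD(2)[OF \<mu>])
      then show "p \<rho> *\<^sub>R L (indicator S \<rho> *\<^sub>R ?t \<rho>) = p \<rho> *\<^sub>R (indicator S \<rho> *\<^sub>R ?t \<rho>)"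
        using eq by (auto simp: linear_scale[OF L])
    qed
    also have "\<dots> = moment \<mu> p S"
      unfolding moment_def using S borel_measurable_tensor_power[OF \<mu>]
      by (intro integral_law[OF \<mu> p, symmetric] borel_measurable_scaleR borel_measurable_indicator)
    finally show ?thesis .
  qed
  show "sym_proj ** moment \<mu> p S = (moment \<mu> p S :: ('n \<Rightarrow> 'd) cmat)"
    by (intro sym_proj_mult_eq fixed linear_mult_right perm_op_pure)
  show "moment \<mu> p S ** sym_proj = (moment \<mu> p S :: ('n \<Rightarrow> 'd) cmat)"
    by (intro mult_sym_proj_eq fixed[of "\<lambda>X. X ** perm_op _"] linear_mult_left perm_op_pure)
qed

section \<open>The transferred measurement\<close>

lemma inner_bilateral: "(P ** Q ** R) \<bullet> X = Q \<bullet> (dagger P ** X ** dagger R)" 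
  for P Q R X :: "'a::finite cmat"
proof -
  have "(P ** Q ** R) \<bullet> X = (P ** Q) \<bullet> (X ** dagger R)" by (rule inner_mult_right)
  then show ?thesis by (simp add: inner_mult_left[of P Q] matrix_mul_assoc)
qed

text \<open>Inside a pairing, covariance carries conjugation through \<open>tensor_map N\<close>,
  where the invariant \<open>Y\<close> absorbs it.\<close>

lemma adjoint_tensor_map_commutant:
  fixes N :: "'d::finite cmat \<Rightarrow> 'd cmat" and Y :: "('n::finite \<Rightarrow> 'd) cmat"
  assumes N: "Vector_Spaces.linear cscale cscale N" and cov: "covariant G N"
    and unit: "\<And>V. V \<in> G \<Longrightarrow> unitary V"
    and Y: "Y \<in> commutant (tensor_power ` G)"
  shows "adjoint (tensor_map N) Y \<in> commutant (tensor_power ` G)"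
  unfolding commutant_def
proof safe
  fix V assume V: "V \<in> G"
  let ?V = "tensor_power V :: ('n \<Rightarrow> 'd) cmat" and ?Q = "adjoint (tensor_map N) Y"
  note adj = inner_adjoint[OF cscale_linear_imp_linear[OF cscale_linear_tensor_map[OF N]], of Y]
  have uV: "unitary ?V" using unit[OF V] by (rule unitary_tensor_power)
  have "(dagger ?V ** ?Q ** ?V) \<bullet> X = ?Q \<bullet> X" for X
  proof -
    have "(dagger ?V ** ?Q ** ?V) \<bullet> X = Y \<bullet> (?V ** tensor_map N X ** dagger ?V)"
      using cov V
      by (simp add: inner_bilateral adj covariant_def conjugate_by_def tensor_map_covariant[OF N])
    also have "\<dots> = (dagger ?V ** Y ** ?V) \<bullet> tensor_map N X" by (simp add: inner_bilateral)
    also have "dagger ?V ** Y ** ?V = Y"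
      using Y V by (intro conjugate_commutant(1) uV) (auto simp: commutant_def)
    finally show ?thesis by (simp add: adj)
  qed
  then have "dagger ?V ** ?Q ** ?V = ?Q" by (metis vector_eq_rdot inner_commute)
  then have "?V ** ?Q = ?V ** dagger ?V ** ?Q ** ?V" by (metis matrix_mul_assoc)
  then show "?V ** ?Q = ?Q ** ?V" using uV by (simp add: unitary_def)
qed

lemma gauge_group_monoid:
  shows "mat 1 \<in> gauge_group A" and "U \<in> gauge_group A \<Longrightarrow> V \<in> gauge_group A \<Longrightarrow> U ** V \<in> gauge_group A"
    and "V \<in> gauge_group A \<Longrightarrow> unitary V"
proof -
  show "mat 1 \<in> gauge_group A" by (simp add: gauge_group_def unitary_mat_1)
  show "V \<in> gauge_group A \<Longrightarrow> unitary V" by (simp add: gauge_group_def)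
  assume UV: "U \<in> gauge_group A" "V \<in> gauge_group A"
  have "U ** V ** X = X ** (U ** V)" if "X \<in> A" for X
  proof -
    have "U ** X = X ** U" "V ** X = X ** V" using UV that by (auto simp: gauge_group_def)
    then show ?thesis by (metis matrix_mul_assoc)
  qed
  then show "U ** V \<in> gauge_group A" using UV by (simp add: gauge_group_def unitary_mult)
qed

theorem theorem13:
  fixes \<A> :: "'d::finite cmat set"
    and \<mu> :: "'d cmat measure"
    and p :: "'d cmat \<Rightarrow> real"
    and s :: "'d cmat \<Rightarrow> real^'l"
    and E :: "('n::finite \<Rightarrow> 'd) cmat \<Rightarrow> ('n \<Rightarrow> 'd) cmat"
    and \<Omega> :: "'w measure"
    and M :: "'w set \<Rightarrow> ('n \<Rightarrow> 'd) cmat"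
  assumes "von_neumann_algebra \<A>"
    and "reference_measure \<mu>"
    and "prior \<mu> p"
    and "parameters \<mu> p s"
    and "quantum_channel E"
    and "prior_symmetry (gauge_group \<A>) p"
    and "parameter_symmetry (gauge_group \<A>) p s"
    and "noiseless_on (algebra_power \<A>) E"
    and "\<exists>p' N. prior \<mu> p' \<and> supp p' \<subseteq> pure_states \<and> gauge_distortion \<mu> \<A> p p' N"
    and "povm \<Omega> M"
  shows "\<exists>M' :: 'w set \<Rightarrow> ('n \<Rightarrow> 'd) cmat.
    povm \<Omega> M' \<and> (\<forall>B\<in>sets \<Omega>. M' B \<in> algebra_power \<A>) \<and>
    (\<forall>B\<in>sets \<Omega>. \<forall>\<Delta> :: (real^'l) set. is_interval \<Delta> \<longrightarrow> parameter_prob \<mu> p s \<Delta> \<noteq> 0 \<longrightarrow>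
      conditional_outcome_prob \<mu> p s E M B \<Delta> = conditional_outcome_prob \<mu> p s E M' B \<Delta>)"
proof -
  note A = assms(1) and \<mu> = assms(2) and p = assms(3)
  let ?D = "algebra_power \<A> :: ('n \<Rightarrow> 'd) cmat set"
  let ?G = "tensor_power ` gauge_group \<A> :: ('n \<Rightarrow> 'd) cmat set"
  let ?P = "sym_proj :: ('n \<Rightarrow> 'd) cmat"
  obtain p' N where p': "prior \<mu> p'" and pure: "supp p' \<subseteq> pure_states"
    and N: "quantum_channel N" "noiseless_on \<A> N" "covariant (gauge_group \<A>) N"
    and law: "distr (law \<mu> p') \<mu> N = law \<mu> p"
    using assms(9) by (auto simp: gauge_distortion_def)
  note linN = quantum_channelD(1)[OF N(1)] and linE = quantum_channelD(1)[OF assms(5)]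
  let ?N = "tensor_map N :: ('n \<Rightarrow> 'd) cmat \<Rightarrow> ('n \<Rightarrow> 'd) cmat"
  have rN: "linear ?N" by (intro cscale_linear_imp_linear cscale_linear_tensor_map linN)
  have rE: "linear E" by (intro cscale_linear_imp_linear linE)
  have vD: "von_neumann_algebra ?D" by (rule von_neumann_algebra_power[OF A])

  \<comment> \<open>Permutation invariance makes these operators commute with \<open>?P\<close>, so
    that \<open>R ** ?P\<close> is multiplicative in \<open>R\<close>.\<close>
  define \<B> where "\<B> = ?D \<inter> commutant (perm_op ` {\<pi>. bij \<pi>})"
  have "von_neumann_algebra (commutant (perm_op ` {\<pi>. bij \<pi>}) :: ('n \<Rightarrow> 'd) cmat set)"
    by (rule von_neumann_algebra_commutant) (auto simp: dagger_perm_op bij_imp_bij_inv)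
  then have vB: "von_neumann_algebra \<B>"
    using vD unfolding \<B>_def von_neumann_algebra_def by (auto intro: cmat.subspace_inter)
  have PB: "?P ** R = R ** ?P" if "R \<in> \<B>" for R
  proof -
    have "(\<Sum>\<pi>\<in>perms. perm_op \<pi> ** R) = (\<Sum>\<pi>\<in>perms. R ** perm_op \<pi>)"
      using that by (intro sum.cong) (auto simp: \<B>_def commutant_def perms_def)
    then show ?thesis
      by (simp add: sym_proj_def scaleR_mult_left scaleR_mult_right mult_sum_left mult_sum_right)
  qed
  obtain g where g: "linear g" "positive_op (mat 1 - g ?P)"
    and gR: "\<And>R. R \<in> \<B> \<Longrightarrow> g (R ** ?P) \<in> \<B>" "\<And>R. R \<in> \<B> \<Longrightarrow> g (R ** ?P) ** ?P = R ** ?P"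
      "\<And>R. R \<in> \<B> \<Longrightarrow> positive_op (R ** ?P) \<Longrightarrow> positive_op (g (R ** ?P))"
    using positive_section[OF vB sym_proj_idem dagger_sym_proj PB] by blast
  have one: "mat 1 \<in> \<B>" using vB by (simp add: von_neumann_algebra_def)
  have gP: "g ?P \<in> \<B>" "g ?P ** ?P = ?P" using gR[OF one] by simp_all

  note G = gauge_group_monoid[where A = \<A>]
  let ?C = "commutant ?G"
  have subC: "subspace ?C" by (intro cmat_subspace_imp_subspace subspace_commutant)
  \<comment> \<open>The twirl stands between the two pullbacks: there the operator is paired with an
    invariant moment, and pulling back along \<open>N\<close> afterwards keeps it invariant.\<close>
  define Q where "Q X = adjoint ?N (orth_proj ?C (adjoint E X))" for X
  have linQ: "linear Q"
    using linear_compose[OF linear_compose[OF adjoint_linear[OF rE] linear_orth_proj[OF subC]]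
        adjoint_linear[OF rN]] by (simp add: o_def Q_def[abs_def])
  have QC: "Q X \<in> ?C" for X
    unfolding Q_def by (intro adjoint_tensor_map_commutant linN N(3) G(3) orth_proj_in subC)
  have posQ: "positive_op (Q X)" if "positive_op X" for X
    unfolding Q_def
  proof (rule positive_op_adjoint[OF cscale_linear_tensor_map[OF linN]])
    show "positive_op (orth_proj ?C (adjoint E X))"
    proof (rule positive_op_twirl)
      show "mat 1 \<in> ?G" using G(1) tensor_power_mat_1 by (metis imageI)
      show "U ** V \<in> ?G" if "U \<in> ?G" "V \<in> ?G" for U V
      proof -
        from that obtain U' V' where "U = tensor_power U'" "V = tensor_power V'"
          "U' \<in> gauge_group \<A>" "V' \<in> gauge_group \<A>" by blast
        then show ?thesis by (intro image_eqI[of _ _ "U' ** V'"] G(2)) (simp_all add: tensor_power_mult)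
      qed
      show "positive_op (adjoint E X)"
        by (rule positive_op_adjoint[OF linE _ that])
          (rule completely_positive_imp_positive[OF quantum_channelD(2)[OF assms(5)]])
    qed (auto intro: unitary_tensor_power G(3))
  qed (rule positive_op_tensor_map[OF N(1)])
  have Q1: "Q (mat 1) = mat 1"
    unfolding Q_def
    by (simp add: adjoint_mat_1[OF rE quantum_channelD(3)[OF assms(5)]] orth_proj_id[OF subC]
        mat_1_in_commutant adjoint_mat_1[OF rN trace_tensor_map[OF N(1)]])
  have compress: "\<exists>R\<in>\<B>. ?P ** Q X ** ?P = R ** ?P" for X
    using schur_weyl_gauge[OF A QC[of X]] by (auto simp: \<B>_def commutant_def)

  \<comment> \<open>The normalized trace: a positive functional with value 1 at the identity. Its
    multiple of \<open>mat 1 - g ?P\<close> supplies the part of the identity that compression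
    loses.\<close>
  define c where "c X = (X \<bullet> mat 1) / ((mat 1 :: ('n \<Rightarrow> 'd) cmat) \<bullet> mat 1)" for X :: "('n \<Rightarrow> 'd) cmat"
  define \<Psi> where "\<Psi> X = g (?P ** Q X ** ?P) + c X *\<^sub>R (mat 1 - g ?P)" for X
  have ne: "(mat 1 :: ('n \<Rightarrow> 'd) cmat) \<bullet> mat 1 \<noteq> 0"
  proof
    assume "(mat 1 :: ('n \<Rightarrow> 'd) cmat) \<bullet> mat 1 = 0"
    then have "(mat 1 :: ('n \<Rightarrow> 'd) cmat) $ f $ f = 0" for f by simp
    then show False by (simp add: mat_nth)
  qed
  have lin\<Psi>: "linear \<Psi>"
    by (rule linearI)
      (simp_all add: \<Psi>_def c_def linear_add[OF linQ] linear_scale[OF linQ] linear_add[OF g(1)]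
        linear_scale[OF g(1)] matrix_add_ldistrib mult_add_left scaleR_mult_left scaleR_mult_right
        inner_add_left add_divide_distrib algebra_simps)
  have \<Psi>1: "\<Psi> (mat 1) = mat 1"
    using ne by (simp add: \<Psi>_def c_def Q1 sym_proj_idem)
  have pos\<Psi>: "positive_op (\<Psi> X)" if X: "positive_op X" for X
  proof -
    obtain R where R: "R \<in> \<B>" "?P ** Q X ** ?P = R ** ?P" using compress by blast
    have "positive_op (?P ** Q X ** ?P)"
      using positive_op_conjugate[OF posQ[OF X], of ?P] by (simp add: dagger_sym_proj)
    then have "positive_op (g (?P ** Q X ** ?P))" using R gR(3) by simp
    moreover have "0 \<le> c X"
      unfolding c_def using X by (intro divide_nonneg_nonneg inner_positive_op positive_op_mat_1)
    ultimately show ?thesis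
      unfolding \<Psi>_def by (intro positive_op_add positive_op_scaleR g(2))
  qed
  have \<Psi>D: "\<Psi> X \<in> ?D" for X
  proof -
    obtain R where R: "R \<in> \<B>" "?P ** Q X ** ?P = R ** ?P" using compress by blast
    have B: "subspace \<B>"
      using vB by (simp add: von_neumann_algebra_def cmat_subspace_imp_subspace)
    have "\<Psi> X \<in> \<B>"
      unfolding \<Psi>_def R(2)
      by (intro subspace_add[OF B] subspace_mul[OF B] subspace_diff[OF B] gR(1) R one gP)
    then show ?thesis by (simp add: \<B>_def)
  qed

  have same: "adjoint E X \<bullet> moment \<mu> p S = adjoint E (\<Psi> X) \<bullet> moment \<mu> p S"
    if S: "S \<in> sets \<mu>"
      and S_sym: "\<And>V \<rho>. V \<in> gauge_group \<A> \<Longrightarrow> \<rho> \<in> states \<Longrightarrow> conjugate_by V \<rho> \<in> S \<longleftrightarrow> \<rho> \<in> S"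
    for X S
  proof -
    define l where "l = (moment \<mu> p S :: ('n \<Rightarrow> 'd) cmat)"
    define l' where "l' = (moment \<mu> p' (N -` S \<inter> space \<mu>) :: ('n \<Rightarrow> 'd) cmat)"
    have lC: "l \<in> ?C"
      unfolding l_def by (rule moment_commutant[OF \<mu> p S G(3) assms(6) S_sym])
    have ll': "l = ?N l'"
      unfolding l_def l'_def by (rule moment_distortion(2)[OF \<mu> p p' S N(1) law])
    have Pl': "?P ** l' = l'" "l' ** ?P = l'"
      unfolding l'_def
      by (intro moment_pure_sym[OF \<mu> p' moment_distortion(1)[OF \<mu> p p' S N(1) law] pure])+
    obtain R where R: "R \<in> \<B>" "?P ** Q X ** ?P = R ** ?P" using compress by blast
    have "adjoint E X \<bullet> l = orth_proj ?C (adjoint E X) \<bullet> ?N l'"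
      using inner_orth_proj[OF subC lC] by (simp add: ll')
    also have "\<dots> = Q X \<bullet> l'" by (simp add: Q_def inner_adjoint[OF rN])
    also have "\<dots> = (?P ** Q X ** ?P) \<bullet> l'" by (simp add: inner_bilateral dagger_sym_proj Pl')
    also have "\<dots> = (g (?P ** Q X ** ?P) ** ?P) \<bullet> l'" by (simp add: R gR(2))
    also have "\<dots> = g (?P ** Q X ** ?P) \<bullet> l'" by (simp add: inner_mult_right dagger_sym_proj Pl')
    also have "\<dots> = \<Psi> X \<bullet> l'"
    proof -
      \<comment> \<open>The normalizing summand is invisible here: \<open>?P\<close> annihilates it,
        and \<open>l'\<close> absorbs \<open>?P\<close>.\<close>
      have "(mat 1 - g ?P) \<bullet> l' = ((mat 1 - g ?P) ** ?P) \<bullet> l'"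
        by (simp add: inner_mult_right dagger_sym_proj Pl')
      also have "\<dots> = 0" by (simp add: mult_diff_left gP)
      finally show ?thesis by (simp add: \<Psi>_def inner_add_left)
    qed
    \<comment> \<open>Now that the operator lies in the algebra power, both channels may be
      reinserted: \<open>N\<close> restores \<open>l\<close>, and \<open>E\<close> then restores the
      measured statistics.\<close>
    also have "\<dots> = \<Psi> X \<bullet> ?N l'"
      using inner_noiseless[where F = ?N, OF vD \<Psi>D tensor_map_noiseless[OF N(2) linN]] by simp
    also have "\<dots> = \<Psi> X \<bullet> E l"
      unfolding ll'[symmetric]
      using inner_noiseless[where F = E, OF vD \<Psi>D noiseless_on_all[OF assms(8) linE]] by simp
    also have "\<dots> = adjoint E (\<Psi> X) \<bullet> l" by (simp add: inner_adjoint[OF rE])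
    finally show ?thesis by (simp add: l_def)
  qed

  have posM: "positive_op (M B)" if "B \<in> sets \<Omega>" for B
    using assms(10) that by (simp add: povm_def)
  show ?thesis
  proof (intro exI[of _ "\<lambda>B. \<Psi> (M B)"] conjI ballI allI impI)
    show "povm \<Omega> (\<lambda>B. \<Psi> (M B))"
      by (rule povm_linear_image[OF assms(10) lin\<Psi> \<Psi>1 pos\<Psi>[OF posM]])
    show "\<Psi> (M B) \<in> algebra_power \<A>" for B by (rule \<Psi>D)
    fix B \<Delta> assume B: "B \<in> sets \<Omega>" and nz: "parameter_prob \<mu> p s \<Delta> \<noteq> 0"
    let ?S = "{\<rho> \<in> supp p. s \<rho> \<in> \<Delta>}"
    have S: "?S \<in> sets \<mu>" by (rule measurable_parameter_set[OF \<mu> nz])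
    \<comment> \<open>The symmetry of \<open>s\<close> concerns the support only; the symmetry of
      \<open>p\<close> makes the support itself invariant.\<close>
    have S_sym: "conjugate_by V \<rho> \<in> ?S \<longleftrightarrow> \<rho> \<in> ?S" if "V \<in> gauge_group \<A>" "\<rho> \<in> states" for V \<rho>
      using assms(6,7) that conjugate_states[OF G(3)[OF that(1)] that(2)]
      by (auto simp: prior_symmetry_def parameter_symmetry_def supp_def)
    show "conditional_outcome_prob \<mu> p s E M B \<Delta>
        = conditional_outcome_prob \<mu> p s E (\<lambda>B. \<Psi> (M B)) B \<Delta>"
      using outcome_integral_eq_inner_moment[OF \<mu> p S rE, of M B]
        outcome_integral_eq_inner_moment[OF \<mu> p S rE, of "\<lambda>B. \<Psi> (M B)" B]
        same[OF S S_sym, of "M B"]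
      by (simp add: conditional_outcome_prob_def posM[OF B] pos\<Psi>)
  qed
qed

end
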